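(* Let $\Bbbk$ be an algebraically closed field and let $\mathcal C$ be a Frobenius tensor category over $\Bbbk$ of subexponential growth. Let $\{S_i\}_{i\in I}$ be a full set of representatives of the isomorphism classes of simple objects of $\mathcal C$. Then the coradical filtration of $\mathcal C$ is finite. More precisely, its Loewy length does not exceed $$\sum_{i\in I}[E(\mathbf 1):S_i]\,\rho(S_i\otimes E(\mathbf 1)\otimes S_i^* ).$$
   Context: An artinian category over $\Bbbk$ is an essentially small $\Bbbk$-linear abelian category in which all objects have finite length and all Hom spaces are finite dimensional. A tensor category is a rigid monoidal artinian category over $\Bbbk$ with unit object $\mathbf 1$, with tensor product bilinear on morphisms and $\mathrm{End}(\mathbf 1)=\Bbbk$. For an object $X$: $\ell(X)$ is its length; $\ell\ell(X)$ is its Loewy length (the length of its socle series); $X^*$ is its left dual, so that $\mathrm{Hom}(Y\otimes X,Z)\cong\mathrm{Hom}(Y,Z\otimes X^* )$; and $[X:S]$ is the multiplicity of a simple object $S$ in a composition series of $X$. The coradical filtration $(\mathcal C_n)_{n\ge0}$ of $\mathcal C$: $\mathcal C_n$ is the full subcategory of objects of Loewy length at most $n+1$. It is finite if $\mathcal C_n=\mathcal C$ for some $n$; its (Loewy) length is then the maximal Loewy length of an object of $\mathcal C$, equivalently of an indecomposable injective object. $\mathcal C$ has subexponential growth if for every $X\in\mathcal C$ there is a constant $K\ge1$ with $\ell(X^{\otimes n})\le K^n$ for all large enough $n$; the infimum of such $K$ is the spectral radius $\rho(X)$. $\mathcal C$ is Frobenius if every simple object has an injective hull in $\mathcal C$ (equivalently,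 $\mathcal C$ has injective hulls); $E(X)$ denotes the injective hull of $X$. *)

theory Defs
  imports
    "HOL-Computational_Algebra.Polynomial"
    "HOL-Analysis.Infinite_Sum"
begin

section \<open>Linear and abelian categories\<close>

text \<open>
  A category has a set \<open>Obj\<close> of objects and a set \<open>Arr\<close> of arrows, each arrow knowing its domain
  and codomain. As objects form a set, essential smallness is built in. Composition is written
  in the usual order: \<open>g \<cdot> f\<close> means first \<open>f\<close>, then \<open>g\<close>. \<open>Add\<close> is relevant only for parallel
  arrows, and all operations are unconstrained outside the category.
\<close>

record ('o, 'm, 'k) lincat =
  Obj :: "'o set"
  Arr :: "'m set"
  Dom :: "'m \<Rightarrow> 'o"
  Cod :: "'m \<Rightarrow> 'o"
  Id :: "'o \<Rightarrow> 'm"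
  Comp :: "'m \<Rightarrow> 'm \<Rightarrow> 'm"  (infixr "\<cdot>\<index>" 70)
  Add :: "'m \<Rightarrow> 'm \<Rightarrow> 'm"
  Zero :: "'o \<Rightarrow> 'o \<Rightarrow> 'm"
  Scale :: "'k \<Rightarrow> 'm \<Rightarrow> 'm"

definition Hom :: "('o, 'm, 'k, 'z) lincat_scheme \<Rightarrow> 'o \<Rightarrow> 'o \<Rightarrow> 'm set" where
  "Hom C A B = {f \<in> Arr C. Dom C f = A \<and> Cod C f = B}"

locale category =
  fixes C :: "('o, 'm, 'k, 'z) lincat_scheme" (structure)
  assumes Dom_Obj: "f \<in> Arr C \<Longrightarrow> Dom C f \<in> Obj C"
    and Cod_Obj: "f \<in> Arr C \<Longrightarrow> Cod C f \<in> Obj C"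
    and Id_Hom: "A \<in> Obj C \<Longrightarrow> Id C A \<in> Hom C A A"
    and Comp_Hom: "\<lbrakk>f \<in> Hom C A B; g \<in> Hom C B D\<rbrakk> \<Longrightarrow> g \<cdot> f \<in> Hom C A D"
    and Comp_assoc: "\<lbrakk>f \<in> Hom C A B; g \<in> Hom C B D; h \<in> Hom C D F\<rbrakk>
      \<Longrightarrow> (h \<cdot> g) \<cdot> f = h \<cdot> (g \<cdot> f)"
    and Id_left: "f \<in> Hom C A B \<Longrightarrow> Id C B \<cdot> f = f"
    and Id_right: "f \<in> Hom C A B \<Longrightarrow> f \<cdot> Id C A = f"

locale linear_category = category C
  for C :: "('o, 'm, 'k::field, 'z) lincat_scheme" (structure) +
  assumes Add_Hom: "\<lbrakk>f \<in> Hom C A B; g \<in> Hom C A B\<rbrakk> \<Longrightarrow> Add C f g \<in> Hom C A B"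
    and Add_assoc: "\<lbrakk>f \<in> Hom C A B; g \<in> Hom C A B; h \<in> Hom C A B\<rbrakk>
      \<Longrightarrow> Add C (Add C f g) h = Add C f (Add C g h)"
    and Add_commute: "\<lbrakk>f \<in> Hom C A B; g \<in> Hom C A B\<rbrakk> \<Longrightarrow> Add C f g = Add C g f"
    and Zero_Hom: "\<lbrakk>A \<in> Obj C; B \<in> Obj C\<rbrakk> \<Longrightarrow> Zero C A B \<in> Hom C A B"
    and Add_Zero: "f \<in> Hom C A B \<Longrightarrow> Add C f (Zero C A B) = f"
    and Add_inverse: "f \<in> Hom C A B \<Longrightarrow> \<exists>g \<in> Hom C A B. Add C f g = Zero C A B"
    and Scale_Hom: "f \<in> Hom C A B \<Longrightarrow> Scale C c f \<in> Hom C A B"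
    and Scale_one: "f \<in> Hom C A B \<Longrightarrow> Scale C 1 f = f"
    and Scale_Scale: "f \<in> Hom C A B \<Longrightarrow> Scale C c (Scale C d f) = Scale C (c * d) f"
    and Scale_add_left: "f \<in> Hom C A B
      \<Longrightarrow> Scale C (c + d) f = Add C (Scale C c f) (Scale C d f)"
    and Scale_Add_right: "\<lbrakk>f \<in> Hom C A B; g \<in> Hom C A B\<rbrakk>
      \<Longrightarrow> Scale C c (Add C f g) = Add C (Scale C c f) (Scale C c g)"
    and Comp_Add_right: "\<lbrakk>f \<in> Hom C A B; f' \<in> Hom C A B; g \<in> Hom C B D\<rbrakk>
      \<Longrightarrow> g \<cdot> Add C f f' = Add C (g \<cdot> f) (g \<cdot> f')"
    and Comp_Add_left: "\<lbrakk>f \<in> Hom C A B; g \<in> Hom C B D; g' \<in> Hom C B D\<rbrakk>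
      \<Longrightarrow> Add C g g' \<cdot> f = Add C (g \<cdot> f) (g' \<cdot> f)"
    and Comp_Scale_right: "\<lbrakk>f \<in> Hom C A B; g \<in> Hom C B D\<rbrakk>
      \<Longrightarrow> g \<cdot> Scale C c f = Scale C c (g \<cdot> f)"
    and Comp_Scale_left: "\<lbrakk>f \<in> Hom C A B; g \<in> Hom C B D\<rbrakk>
      \<Longrightarrow> Scale C c g \<cdot> f = Scale C c (g \<cdot> f)"

definition mono_arr :: "('o, 'm, 'k, 'z) lincat_scheme \<Rightarrow> 'm \<Rightarrow> bool" where
  "mono_arr C m \<longleftrightarrow> m \<in> Arr C \<and>
     (\<forall>f\<in>Arr C. \<forall>g\<in>Arr C. Dom C f = Dom C g \<and> Cod C f = Dom C m \<and> Cod C g = Dom C m \<and>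
        m \<cdot>\<^bsub>C\<^esub> f = m \<cdot>\<^bsub>C\<^esub> g \<longrightarrow> f = g)"

definition epi_arr :: "('o, 'm, 'k, 'z) lincat_scheme \<Rightarrow> 'm \<Rightarrow> bool" where
  "epi_arr C e \<longleftrightarrow> e \<in> Arr C \<and>
     (\<forall>f\<in>Arr C. \<forall>g\<in>Arr C. Cod C f = Cod C g \<and> Dom C f = Cod C e \<and> Dom C g = Cod C e \<and>
        f \<cdot>\<^bsub>C\<^esub> e = g \<cdot>\<^bsub>C\<^esub> e \<longrightarrow> f = g)"

definition inverse_arrs :: "('o, 'm, 'k, 'z) lincat_scheme \<Rightarrow> 'm \<Rightarrow> 'm \<Rightarrow> bool" where
  "inverse_arrs C f g \<longleftrightarrow> f \<in> Arr C \<and> g \<in> Hom C (Cod C f) (Dom C f) \<and>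
     g \<cdot>\<^bsub>C\<^esub> f = Id C (Dom C f) \<and> f \<cdot>\<^bsub>C\<^esub> g = Id C (Cod C f)"

definition iso_arr :: "('o, 'm, 'k, 'z) lincat_scheme \<Rightarrow> 'm \<Rightarrow> bool" where
  "iso_arr C f \<longleftrightarrow> (\<exists>g. inverse_arrs C f g)"

definition inv_arr :: "('o, 'm, 'k, 'z) lincat_scheme \<Rightarrow> 'm \<Rightarrow> 'm" where
  "inv_arr C f = (THE g. inverse_arrs C f g)"

definition isomorphic :: "('o, 'm, 'k, 'z) lincat_scheme \<Rightarrow> 'o \<Rightarrow> 'o \<Rightarrow> bool" where
  "isomorphic C A B \<longleftrightarrow> (\<exists>f \<in> Hom C A B. iso_arr C f)"

definition zero_obj :: "('o, 'm, 'k, 'z) lincat_scheme \<Rightarrow> 'o \<Rightarrow> bool" where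
  "zero_obj C Z \<longleftrightarrow> Z \<in> Obj C \<and>
     (\<forall>A\<in>Obj C. (\<exists>!f. f \<in> Hom C Z A) \<and> (\<exists>!f. f \<in> Hom C A Z))"

definition is_kernel :: "('o, 'm, 'k, 'z) lincat_scheme \<Rightarrow> 'm \<Rightarrow> 'm \<Rightarrow> bool" where
  "is_kernel C k f \<longleftrightarrow> f \<in> Arr C \<and> k \<in> Arr C \<and> Cod C k = Dom C f \<and>
     f \<cdot>\<^bsub>C\<^esub> k = Zero C (Dom C k) (Cod C f) \<and>
     (\<forall>h\<in>Arr C. Cod C h = Dom C f \<and> f \<cdot>\<^bsub>C\<^esub> h = Zero C (Dom C h) (Cod C f) \<longrightarrow>
        (\<exists>!u. u \<in> Hom C (Dom C h) (Dom C k) \<and> k \<cdot>\<^bsub>C\<^esub> u = h))"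

definition is_cokernel :: "('o, 'm, 'k, 'z) lincat_scheme \<Rightarrow> 'm \<Rightarrow> 'm \<Rightarrow> bool" where
  "is_cokernel C c f \<longleftrightarrow> f \<in> Arr C \<and> c \<in> Arr C \<and> Dom C c = Cod C f \<and>
     c \<cdot>\<^bsub>C\<^esub> f = Zero C (Dom C f) (Cod C c) \<and>
     (\<forall>h\<in>Arr C. Dom C h = Cod C f \<and> h \<cdot>\<^bsub>C\<^esub> f = Zero C (Dom C f) (Cod C h) \<longrightarrow>
        (\<exists>!u. u \<in> Hom C (Cod C c) (Cod C h) \<and> u \<cdot>\<^bsub>C\<^esub> c = h))"

definition is_product ::
    "('o, 'm, 'k, 'z) lincat_scheme \<Rightarrow> 'o \<Rightarrow> 'o \<Rightarrow> 'o \<Rightarrow> 'm \<Rightarrow> 'm \<Rightarrow> bool" where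
  "is_product C A B P p q \<longleftrightarrow> p \<in> Hom C P A \<and> q \<in> Hom C P B \<and>
     (\<forall>X\<in>Obj C. \<forall>f\<in>Hom C X A. \<forall>g\<in>Hom C X B.
        \<exists>!u. u \<in> Hom C X P \<and> p \<cdot>\<^bsub>C\<^esub> u = f \<and> q \<cdot>\<^bsub>C\<^esub> u = g)"

text \<open>Binary products suffice: in a linear category they are biproducts.\<close>

locale abelian_category = linear_category C
  for C :: "('o, 'm, 'k::field, 'z) lincat_scheme" (structure) +
  assumes ex_zero_obj: "\<exists>Z. zero_obj C Z"
    and ex_product: "\<lbrakk>A \<in> Obj C; B \<in> Obj C\<rbrakk> \<Longrightarrow> \<exists>P p q. is_product C A B P p q"
    and ex_kernel: "f \<in> Arr C \<Longrightarrow> \<exists>k. is_kernel C k f"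
    and ex_cokernel: "f \<in> Arr C \<Longrightarrow> \<exists>c. is_cokernel C c f"
    and mono_normal: "mono_arr C m \<Longrightarrow> \<exists>f. is_kernel C m f"
    and epi_normal: "epi_arr C e \<Longrightarrow> \<exists>f. is_cokernel C e f"

section \<open>Length, multiplicity and Loewy length\<close>

definition short_exact :: "('o, 'm, 'k, 'z) lincat_scheme \<Rightarrow> 'm \<Rightarrow> 'm \<Rightarrow> bool" where
  "short_exact C i p \<longleftrightarrow> is_kernel C i p \<and> is_cokernel C p i"

definition simple_obj :: "('o, 'm, 'k, 'z) lincat_scheme \<Rightarrow> 'o \<Rightarrow> bool" where
  "simple_obj C S \<longleftrightarrow> S \<in> Obj C \<and> \<not> zero_obj C S \<and>
     (\<forall>m. mono_arr C m \<and> Cod C m = S \<longrightarrow> zero_obj C (Dom C m) \<or> iso_arr C m)"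

text \<open>
  \<open>composition_series C X Fs\<close>: there is a chain of monomorphisms
  \<open>0 = X\<^sub>0 \<rightarrow> X\<^sub>1 \<rightarrow> \<dots> \<rightarrow> X\<^sub>n = X\<close> with simple successive quotients, and \<open>Fs\<close> lists these quotients
  from bottom to top.
\<close>

inductive composition_series ::
    "('o, 'm, 'k, 'z) lincat_scheme \<Rightarrow> 'o \<Rightarrow> 'o list \<Rightarrow> bool"
  for C :: "('o, 'm, 'k, 'z) lincat_scheme" where
  zero: "zero_obj C X \<Longrightarrow> composition_series C X []"
| step: "\<lbrakk>composition_series C Y Fs; i \<in> Hom C Y X; p \<in> Hom C X S; short_exact C i p;
          simple_obj C S\<rbrakk>
    \<Longrightarrow> composition_series C X (Fs @ [S])"

definition finite_length :: "('o, 'm, 'k, 'z) lincat_scheme \<Rightarrow> 'o \<Rightarrow> bool" where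
  "finite_length C X \<longleftrightarrow> (\<exists>Fs. composition_series C X Fs)"

text \<open>By the Jordan--Hoelder theorem the choice of a composition series is immaterial.\<close>

definition comp_factors :: "('o, 'm, 'k, 'z) lincat_scheme \<Rightarrow> 'o \<Rightarrow> 'o list" where
  "comp_factors C X = (SOME Fs. composition_series C X Fs)"

definition obj_length :: "('o, 'm, 'k, 'z) lincat_scheme \<Rightarrow> 'o \<Rightarrow> nat" where
  "obj_length C X = length (comp_factors C X)"

definition multiplicity_in :: "('o, 'm, 'k, 'z) lincat_scheme \<Rightarrow> 'o \<Rightarrow> 'o \<Rightarrow> nat" where
  "multiplicity_in C X S = length (filter (isomorphic C S) (comp_factors C X))"

text \<open>
  The socle is the sum of the simple subobjects, that is, the smallest subobject through which
  every simple subobject factors.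
\<close>

definition factors_through :: "('o, 'm, 'k, 'z) lincat_scheme \<Rightarrow> 'm \<Rightarrow> 'm \<Rightarrow> bool" where
  "factors_through C t s \<longleftrightarrow> (\<exists>u \<in> Hom C (Dom C t) (Dom C s). s \<cdot>\<^bsub>C\<^esub> u = t)"

definition contains_simples :: "('o, 'm, 'k, 'z) lincat_scheme \<Rightarrow> 'o \<Rightarrow> 'm \<Rightarrow> bool" where
  "contains_simples C X s \<longleftrightarrow> mono_arr C s \<and> Cod C s = X \<and>
     (\<forall>t. mono_arr C t \<and> Cod C t = X \<and> simple_obj C (Dom C t) \<longrightarrow> factors_through C t s)"

definition is_socle :: "('o, 'm, 'k, 'z) lincat_scheme \<Rightarrow> 'o \<Rightarrow> 'm \<Rightarrow> bool" where
  "is_socle C X s \<longleftrightarrow> contains_simples C X s \<and>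
     (\<forall>s'. contains_simples C X s' \<longrightarrow> factors_through C s s')"

text \<open>
  \<open>socle_series C X n s\<close>: the monomorphism \<open>s\<close> represents the \<open>n\<close>-th term \<open>soc\<^sup>n X\<close> of the socle
  series, where \<open>soc\<^sup>0 X = 0\<close> and \<open>soc\<^sup>n\<^sup>+\<^sup>1 X\<close> is the preimage of \<open>soc (X / soc\<^sup>n X)\<close> under the
  quotient map \<open>q\<close> of \<open>X\<close>, i.e. the kernel of \<open>X \<rightarrow> X / soc\<^sup>n X \<rightarrow> (X / soc\<^sup>n X) / soc (X / soc\<^sup>n X)\<close>.
\<close>

inductive socle_series ::
    "('o, 'm, 'k, 'z) lincat_scheme \<Rightarrow> 'o \<Rightarrow> nat \<Rightarrow> 'm \<Rightarrow> bool"
  for C :: "('o, 'm, 'k, 'z) lincat_scheme" and X :: 'o where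
  zero: "\<lbrakk>zero_obj C Z; s \<in> Hom C Z X\<rbrakk> \<Longrightarrow> socle_series C X 0 s"
| Suc: "\<lbrakk>socle_series C X n s; is_cokernel C q s; is_socle C (Cod C q) t; is_cokernel C c t;
         is_kernel C s' (c \<cdot>\<^bsub>C\<^esub> q)\<rbrakk>
    \<Longrightarrow> socle_series C X (Suc n) s'"

definition loewy_length :: "('o, 'm, 'k, 'z) lincat_scheme \<Rightarrow> 'o \<Rightarrow> nat" where
  "loewy_length C X = (LEAST n. \<exists>s. socle_series C X n s \<and> iso_arr C s)"

text \<open>The members of the coradical filtration, as full subcategories, are given by their objects.\<close>

definition coradical_filtration :: "('o, 'm, 'k, 'z) lincat_scheme \<Rightarrow> nat \<Rightarrow> 'o set" where
  "coradical_filtration C n = {X \<in> Obj C. loewy_length C X \<le> n + 1}"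

definition coradically_finite :: "('o, 'm, 'k, 'z) lincat_scheme \<Rightarrow> bool" where
  "coradically_finite C \<longleftrightarrow> (\<exists>n. coradical_filtration C n = Obj C)"

text \<open>Meaningful for categories with finite coradical filtration only.\<close>

definition category_loewy_length :: "('o, 'm, 'k, 'z) lincat_scheme \<Rightarrow> nat" where
  "category_loewy_length C = Max (loewy_length C ` Obj C)"

section \<open>Artinian categories and injective hulls\<close>

inductive_set arr_span :: "('o, 'm, 'k, 'z) lincat_scheme \<Rightarrow> 'o \<Rightarrow> 'o \<Rightarrow> 'm set \<Rightarrow> 'm set"
  for C :: "('o, 'm, 'k, 'z) lincat_scheme" and A B :: 'o and G :: "'m set" where
  zero: "Zero C A B \<in> arr_span C A B G"
| add: "\<lbrakk>g \<in> G; f \<in> arr_span C A B G\<rbrakk> \<Longrightarrow> Add C (Scale C a g) f \<in> arr_span C A B G"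

locale artinian_category = abelian_category C
  for C :: "('o, 'm, 'k::field, 'z) lincat_scheme" (structure) +
  assumes obj_finite_length: "X \<in> Obj C \<Longrightarrow> finite_length C X"
    and Hom_finite_dim: "\<lbrakk>A \<in> Obj C; B \<in> Obj C\<rbrakk>
      \<Longrightarrow> \<exists>G. finite G \<and> G \<subseteq> Hom C A B \<and> Hom C A B \<subseteq> arr_span C A B G"

definition injective_obj :: "('o, 'm, 'k, 'z) lincat_scheme \<Rightarrow> 'o \<Rightarrow> bool" where
  "injective_obj C E \<longleftrightarrow> E \<in> Obj C \<and>
     (\<forall>m f. mono_arr C m \<and> f \<in> Hom C (Dom C m) E \<longrightarrow>
        (\<exists>g \<in> Hom C (Cod C m) E. g \<cdot>\<^bsub>C\<^esub> m = f))"

definition essential_mono :: "('o, 'm, 'k, 'z) lincat_scheme \<Rightarrow> 'm \<Rightarrow> bool" where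
  "essential_mono C e \<longleftrightarrow> mono_arr C e \<and>
     (\<forall>f\<in>Arr C. Dom C f = Cod C e \<and> mono_arr C (f \<cdot>\<^bsub>C\<^esub> e) \<longrightarrow> mono_arr C f)"

definition injective_hull :: "('o, 'm, 'k, 'z) lincat_scheme \<Rightarrow> 'o \<Rightarrow> 'o \<Rightarrow> bool" where
  "injective_hull C X E \<longleftrightarrow> injective_obj C E \<and> (\<exists>e \<in> Hom C X E. essential_mono C e)"

definition frobenius_category :: "('o, 'm, 'k, 'z) lincat_scheme \<Rightarrow> bool" where
  "frobenius_category C \<longleftrightarrow> (\<forall>S. simple_obj C S \<longrightarrow> (\<exists>E. injective_hull C S E))"

definition simple_representatives ::
    "('o, 'm, 'k, 'z) lincat_scheme \<Rightarrow> 'i set \<Rightarrow> ('i \<Rightarrow> 'o) \<Rightarrow> bool" where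
  "simple_representatives C I S \<longleftrightarrow>
     (\<forall>i\<in>I. simple_obj C (S i)) \<and>
     (\<forall>T. simple_obj C T \<longrightarrow> (\<exists>i\<in>I. isomorphic C T (S i))) \<and>
     (\<forall>i\<in>I. \<forall>j\<in>I. isomorphic C (S i) (S j) \<longrightarrow> i = j)"

section \<open>Tensor categories\<close>

text \<open>
  \<open>Assoc A B D\<close> goes from \<open>(A \<otimes> B) \<otimes> D\<close> to \<open>A \<otimes> (B \<otimes> D)\<close>, \<open>LUnit A\<close> from \<open>\<one> \<otimes> A\<close> to \<open>A\<close>
  and \<open>RUnit A\<close> from \<open>A \<otimes> \<one>\<close> to \<open>A\<close>; the tensor product of arrows is written \<open>f \<boxtimes> g\<close>.
\<close>

record ('o, 'm, 'k) moncat = "('o, 'm, 'k) lincat" +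
  TensO :: "'o \<Rightarrow> 'o \<Rightarrow> 'o"  (infixl "\<otimes>\<index>" 75)
  TensA :: "'m \<Rightarrow> 'm \<Rightarrow> 'm"  (infixl "\<boxtimes>\<index>" 75)
  Unit :: 'o
  Assoc :: "'o \<Rightarrow> 'o \<Rightarrow> 'o \<Rightarrow> 'm"
  LUnit :: "'o \<Rightarrow> 'm"
  RUnit :: "'o \<Rightarrow> 'm"

locale monoidal_category = category C
  for C :: "('o, 'm, 'k, 'z) moncat_scheme" (structure) +
  assumes TensO_Obj: "\<lbrakk>A \<in> Obj C; B \<in> Obj C\<rbrakk> \<Longrightarrow> A \<otimes> B \<in> Obj C"
    and TensA_Hom: "\<lbrakk>f \<in> Hom C A A'; g \<in> Hom C B B'\<rbrakk> \<Longrightarrow> f \<boxtimes> g \<in> Hom C (A \<otimes> B) (A' \<otimes> B')"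
    and TensA_Id: "\<lbrakk>A \<in> Obj C; B \<in> Obj C\<rbrakk> \<Longrightarrow> Id C A \<boxtimes> Id C B = Id C (A \<otimes> B)"
    and TensA_Comp: "\<lbrakk>f \<in> Hom C A A'; f' \<in> Hom C A' A''; g \<in> Hom C B B'; g' \<in> Hom C B' B''\<rbrakk>
      \<Longrightarrow> (f' \<cdot> f) \<boxtimes> (g' \<cdot> g) = (f' \<boxtimes> g') \<cdot> (f \<boxtimes> g)"
    and Unit_Obj: "Unit C \<in> Obj C"
    and Assoc_Hom: "\<lbrakk>A \<in> Obj C; B \<in> Obj C; D \<in> Obj C\<rbrakk>
      \<Longrightarrow> Assoc C A B D \<in> Hom C ((A \<otimes> B) \<otimes> D) (A \<otimes> (B \<otimes> D))"
    and Assoc_iso: "\<lbrakk>A \<in> Obj C; B \<in> Obj C; D \<in> Obj C\<rbrakk> \<Longrightarrow> iso_arr C (Assoc C A B D)"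
    and Assoc_natural: "\<lbrakk>f \<in> Hom C A A'; g \<in> Hom C B B'; h \<in> Hom C D D'\<rbrakk>
      \<Longrightarrow> Assoc C A' B' D' \<cdot> ((f \<boxtimes> g) \<boxtimes> h) = (f \<boxtimes> (g \<boxtimes> h)) \<cdot> Assoc C A B D"
    and LUnit_Hom: "A \<in> Obj C \<Longrightarrow> LUnit C A \<in> Hom C (Unit C \<otimes> A) A"
    and LUnit_iso: "A \<in> Obj C \<Longrightarrow> iso_arr C (LUnit C A)"
    and LUnit_natural: "f \<in> Hom C A A'
      \<Longrightarrow> LUnit C A' \<cdot> (Id C (Unit C) \<boxtimes> f) = f \<cdot> LUnit C A"
    and RUnit_Hom: "A \<in> Obj C \<Longrightarrow> RUnit C A \<in> Hom C (A \<otimes> Unit C) A"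
    and RUnit_iso: "A \<in> Obj C \<Longrightarrow> iso_arr C (RUnit C A)"
    and RUnit_natural: "f \<in> Hom C A A'
      \<Longrightarrow> RUnit C A' \<cdot> (f \<boxtimes> Id C (Unit C)) = f \<cdot> RUnit C A"
    and pentagon: "\<lbrakk>A \<in> Obj C; B \<in> Obj C; D \<in> Obj C; F \<in> Obj C\<rbrakk>
      \<Longrightarrow> (Id C A \<boxtimes> Assoc C B D F) \<cdot> Assoc C A (B \<otimes> D) F \<cdot> (Assoc C A B D \<boxtimes> Id C F)
        = Assoc C A B (D \<otimes> F) \<cdot> Assoc C (A \<otimes> B) D F"
    and triangle: "\<lbrakk>A \<in> Obj C; B \<in> Obj C\<rbrakk>
      \<Longrightarrow> (Id C A \<boxtimes> LUnit C B) \<cdot> Assoc C A (Unit C) B = RUnit C A \<boxtimes> Id C B"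

text \<open>
  \<open>D\<close> is a left dual of \<open>X\<close>: there are \<open>ev : D \<otimes> X \<rightarrow> \<one>\<close> and \<open>coev : \<one> \<rightarrow> X \<otimes> D\<close> satisfying the
  zigzag equations, so that \<open>Hom (Y \<otimes> X) Z \<cong> Hom Y (Z \<otimes> D)\<close>. To avoid inverse unitors, the
  equations are composed with \<open>LUnit X\<close> and \<open>RUnit D\<close>, respectively.
\<close>

definition left_dual :: "('o, 'm, 'k, 'z) moncat_scheme \<Rightarrow> 'o \<Rightarrow> 'o \<Rightarrow> bool" where
  "left_dual C X D \<longleftrightarrow> X \<in> Obj C \<and> D \<in> Obj C \<and>
     (\<exists>ev \<in> Hom C (D \<otimes>\<^bsub>C\<^esub> X) (Unit C). \<exists>coev \<in> Hom C (Unit C) (X \<otimes>\<^bsub>C\<^esub> D).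
        RUnit C X \<cdot>\<^bsub>C\<^esub> (Id C X \<boxtimes>\<^bsub>C\<^esub> ev) \<cdot>\<^bsub>C\<^esub> Assoc C X D X \<cdot>\<^bsub>C\<^esub> (coev \<boxtimes>\<^bsub>C\<^esub> Id C X)
          = LUnit C X \<and>
        LUnit C D \<cdot>\<^bsub>C\<^esub> (ev \<boxtimes>\<^bsub>C\<^esub> Id C D) \<cdot>\<^bsub>C\<^esub> inv_arr C (Assoc C D X D) \<cdot>\<^bsub>C\<^esub> (Id C D \<boxtimes>\<^bsub>C\<^esub> coev)
          = RUnit C D)"

text \<open>In the second rigidity axiom \<open>D\<close> is a right dual of \<open>X\<close>.\<close>

locale tensor_category = monoidal_category C + artinian_category C
  for C :: "('o, 'm, 'k::field, 'z) moncat_scheme" (structure) +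
  assumes TensA_Add_left: "\<lbrakk>f \<in> Hom C A A'; f' \<in> Hom C A A'; g \<in> Hom C B B'\<rbrakk>
      \<Longrightarrow> Add C f f' \<boxtimes> g = Add C (f \<boxtimes> g) (f' \<boxtimes> g)"
    and TensA_Add_right: "\<lbrakk>f \<in> Hom C A A'; g \<in> Hom C B B'; g' \<in> Hom C B B'\<rbrakk>
      \<Longrightarrow> f \<boxtimes> Add C g g' = Add C (f \<boxtimes> g) (f \<boxtimes> g')"
    and TensA_Scale_left: "\<lbrakk>f \<in> Hom C A A'; g \<in> Hom C B B'\<rbrakk>
      \<Longrightarrow> Scale C c f \<boxtimes> g = Scale C c (f \<boxtimes> g)"
    and TensA_Scale_right: "\<lbrakk>f \<in> Hom C A A'; g \<in> Hom C B B'\<rbrakk>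
      \<Longrightarrow> f \<boxtimes> Scale C c g = Scale C c (f \<boxtimes> g)"
    and ex_left_dual: "X \<in> Obj C \<Longrightarrow> \<exists>D. left_dual C X D"
    and ex_right_dual: "X \<in> Obj C \<Longrightarrow> \<exists>D. left_dual C D X"
    and End_Unit: "bij_betw (\<lambda>c. Scale C c (Id C (Unit C))) UNIV (Hom C (Unit C) (Unit C))"

fun tensor_power :: "('o, 'm, 'k, 'z) moncat_scheme \<Rightarrow> 'o \<Rightarrow> nat \<Rightarrow> 'o" where
  "tensor_power C X 0 = Unit C"
| "tensor_power C X (Suc n) = tensor_power C X n \<otimes>\<^bsub>C\<^esub> X"

definition growth_bounds :: "('o, 'm, 'k, 'z) moncat_scheme \<Rightarrow> 'o \<Rightarrow> real set" where
  "growth_bounds C X = {K. K \<ge> 1 \<and>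
     (\<forall>\<^sub>F n in sequentially. real (obj_length C (tensor_power C X n)) \<le> K ^ n)}"

definition subexponential_growth :: "('o, 'm, 'k, 'z) moncat_scheme \<Rightarrow> bool" where
  "subexponential_growth C \<longleftrightarrow> (\<forall>X\<in>Obj C. growth_bounds C X \<noteq> {})"

definition spectral_radius :: "('o, 'm, 'k, 'z) moncat_scheme \<Rightarrow> 'o \<Rightarrow> real" where
  "spectral_radius C X = Inf (growth_bounds C X)"

end

theory Submission
  imports Defs "HOL-Library.Multiset"
begin

text \<open>
  Let \<open>E\<close> be an injective object containing the unit object. Tensoring with an object that has
  duals on both sides is exact and preserves injective objects, so every simple object \<open>T\<close> embeds
  into the injective object \<open>T \<otimes> E\<close>. Every object embeds into a finite product of these, and its
  Loewy length is therefore at most the maximal length of \<open>T \<otimes> E\<close>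
  (\<open>loewy_length_le_of_injectives\<close>). The theorem follows once the length of \<open>T \<otimes> E\<close> is bounded
  independently of \<open>T\<close>. This length is the sum of the lengths of \<open>T \<otimes> X\<close>, with \<open>X\<close> running
  through the composition factors of \<open>E\<close>, so the claim is that the length of \<open>T \<otimes> X\<close> is at most
  the spectral radius of \<open>Y = X \<otimes> E \<otimes> X\<^sup>*\<close>, for all simple \<open>T\<close>.

  Multiplicities of \<open>T\<close> link the two numbers. For every composition factor \<open>F\<close> of \<open>T \<otimes> X\<close>,
  the embedding of \<open>F\<close> into the injective object \<open>F \<otimes> E\<close> yields a nonzero map
  \<open>T \<otimes> X \<rightarrow> F \<otimes> E\<close>, that is, an embedding of \<open>T\<close> into \<open>F \<otimes> E \<otimes> X\<^sup>*\<close>. Adding up over \<open>F\<close>, the length of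
  \<open>T \<otimes> X\<close> is at most \<open>m = [T \<otimes> Y : T]\<close> (\<open>length_tensor_le_multiplicity\<close>). By exactness,
  \<open>m\<^sup>n \<le> [T \<otimes> Y\<^sup>n : T]\<close> (\<open>multiplicity_tensor_power_ge\<close>). Finally \<open>[T \<otimes> Z : T]\<close> is at most a constant
  times the length of \<open>Z\<close> (\<open>multiplicity_tensor_le_length\<close>): a simple \<open>Z\<close> for which it is nonzero has
  a nonzero map \<open>T \<otimes> Z \<rightarrow> T \<otimes> E\<close>, hence embeds into a fixed object, so that it belongs to one of
  finitely many isomorphism classes. So \<open>m\<^sup>n\<close> grows
  at most like the length of \<open>Y\<^sup>n\<close>, which gives \<open>m \<le> \<rho>(Y)\<close>.
\<close>

section \<open>Arrows in categories and linear categories\<close>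

lemma Hom_iff: "f \<in> Hom C A B \<longleftrightarrow> f \<in> Arr C \<and> Dom C f = A \<and> Cod C f = B"
  by (simp add: Hom_def)

context category
begin

lemma Comp_Arr [simp]:
  assumes "f \<in> Arr C" "g \<in> Arr C" "Cod C f = Dom C g"
  shows "g \<cdot> f \<in> Arr C" "Dom C (g \<cdot> f) = Dom C f" "Cod C (g \<cdot> f) = Cod C g"
  using Comp_Hom[of f "Dom C f" "Dom C g" g "Cod C g"] assms by (auto simp: Hom_iff)

lemma Comp_assoc_Arr [simp]:
  assumes "f \<in> Arr C" "g \<in> Arr C" "h \<in> Arr C" "Cod C f = Dom C g" "Cod C g = Dom C h"
  shows "(h \<cdot> g) \<cdot> f = h \<cdot> g \<cdot> f"
  using assms by (intro Comp_assoc) (auto simp: Hom_iff)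

lemma Id_Arr [simp]:
  assumes "A \<in> Obj C"
  shows "Id C A \<in> Arr C" "Dom C (Id C A) = A" "Cod C (Id C A) = A"
  using Id_Hom[OF assms] by (auto simp: Hom_iff)

lemma Id_Comp [simp]: "\<lbrakk>f \<in> Arr C; Cod C f = B\<rbrakk> \<Longrightarrow> Id C B \<cdot> f = f"
  by (rule Id_left) (auto simp: Hom_iff)

lemma Comp_Id [simp]: "\<lbrakk>f \<in> Arr C; Dom C f = A\<rbrakk> \<Longrightarrow> f \<cdot> Id C A = f"
  by (rule Id_right) (auto simp: Hom_iff)

lemmas [simp] = Dom_Obj Cod_Obj

text \<open>
  Composites are normalised to be bracketed to the right; there, an equation between composites
  of two arrows applies in the middle of a longer composite only in this form.
\<close>

lemma Comp_rewrite:
  assumes "g \<cdot> f = h" "f \<in> Arr C" "g \<in> Arr C" "Cod C f = Dom C g" "x \<in> Arr C" "Cod C x = Dom C f"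
  shows "g \<cdot> f \<cdot> x = h \<cdot> x"
  using assms Comp_assoc_Arr[of x f g] by simp

lemma mono_ArrD: "mono_arr C m \<Longrightarrow> m \<in> Arr C"
  by (simp add: mono_arr_def)

lemma epi_ArrD: "epi_arr C e \<Longrightarrow> e \<in> Arr C"
  by (simp add: epi_arr_def)

lemma mono_cancel:
  "\<lbrakk>mono_arr C m; m \<cdot> f = m \<cdot> g; f \<in> Arr C; g \<in> Arr C; Dom C f = Dom C g; Cod C f = Dom C m;
    Cod C g = Dom C m\<rbrakk> \<Longrightarrow> f = g"
  by (auto simp: mono_arr_def)

lemma epi_cancel:
  "\<lbrakk>epi_arr C e; f \<cdot> e = g \<cdot> e; f \<in> Arr C; g \<in> Arr C; Cod C f = Cod C g; Dom C f = Cod C e;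
    Dom C g = Cod C e\<rbrakk> \<Longrightarrow> f = g"
  by (auto simp: epi_arr_def)

lemma mono_arrI:
  assumes "m \<in> Arr C"
    and "\<And>f g. \<lbrakk>f \<in> Arr C; g \<in> Arr C; Dom C f = Dom C g; Cod C f = Dom C m; Cod C g = Dom C m;
      m \<cdot> f = m \<cdot> g\<rbrakk> \<Longrightarrow> f = g"
  shows "mono_arr C m"
  using assms unfolding mono_arr_def by blast

lemma epi_arrI:
  assumes "e \<in> Arr C"
    and "\<And>f g. \<lbrakk>f \<in> Arr C; g \<in> Arr C; Cod C f = Cod C g; Dom C f = Cod C e; Dom C g = Cod C e;
      f \<cdot> e = g \<cdot> e\<rbrakk> \<Longrightarrow> f = g"
  shows "epi_arr C e"
  using assms unfolding epi_arr_def by blast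

lemma mono_of_Comp:
  assumes "mono_arr C (m \<cdot> k)" "m \<in> Arr C" "k \<in> Arr C" "Cod C k = Dom C m"
  shows "mono_arr C k"
proof (rule mono_arrI)
  fix f g assume fg: "f \<in> Arr C" "g \<in> Arr C" "Dom C f = Dom C g" "Cod C f = Dom C k"
    "Cod C g = Dom C k" "k \<cdot> f = k \<cdot> g"
  have "(m \<cdot> k) \<cdot> f = (m \<cdot> k) \<cdot> g" using assms(2-4) fg by simp
  from mono_cancel[OF assms(1) this] show "f = g" using fg(1-5) assms(2-4) by simp
qed fact

lemma epi_of_Comp:
  assumes "epi_arr C (e \<cdot> d)" "e \<in> Arr C" "d \<in> Arr C" "Cod C d = Dom C e"
  shows "epi_arr C e"
proof (rule epi_arrI)
  fix f g assume fg: "f \<in> Arr C" "g \<in> Arr C" "Cod C f = Cod C g" "Dom C f = Cod C e"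
    "Dom C g = Cod C e" "f \<cdot> e = g \<cdot> e"
  have "(f \<cdot> e) \<cdot> d = (g \<cdot> e) \<cdot> d" using fg(6) by simp
  then have "f \<cdot> (e \<cdot> d) = g \<cdot> (e \<cdot> d)"
    using Comp_assoc_Arr[of d e f] Comp_assoc_Arr[of d e g] assms(2-4) fg(1-5) by simp
  from epi_cancel[OF assms(1) this] show "f = g" using fg(1-5) assms(2-4) by simp
qed fact

lemma mono_Comp:
  assumes "mono_arr C m" "mono_arr C k" "Cod C k = Dom C m"
  shows "mono_arr C (m \<cdot> k)"
proof (rule mono_arrI)
  have a: "m \<in> Arr C" "k \<in> Arr C" using assms mono_ArrD by auto
  show "m \<cdot> k \<in> Arr C" using a assms by simp
  fix f g assume fg: "f \<in> Arr C" "g \<in> Arr C" "Dom C f = Dom C g" "Cod C f = Dom C (m \<cdot> k)"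
    "Cod C g = Dom C (m \<cdot> k)" "(m \<cdot> k) \<cdot> f = (m \<cdot> k) \<cdot> g"
  have d: "Cod C f = Dom C k" "Cod C g = Dom C k" using fg(4,5) a assms(3) by simp_all
  have "m \<cdot> (k \<cdot> f) = m \<cdot> (k \<cdot> g)" using fg(1,2,6) d a assms(3) by simp
  from mono_cancel[OF assms(1) this] have "k \<cdot> f = k \<cdot> g" using fg(1-3) d a assms(3) by simp
  from mono_cancel[OF assms(2) this] show "f = g" using fg(1-3) d by simp
qed

lemma Id_mono: "A \<in> Obj C \<Longrightarrow> mono_arr C (Id C A)"
  by (rule mono_arrI) (simp, metis Id_Arr(2) Id_Comp)

lemma Id_epi: "A \<in> Obj C \<Longrightarrow> epi_arr C (Id C A)"
  by (rule epi_arrI) (simp, metis Id_Arr(3) Comp_Id)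

lemma iso_arrE:
  assumes "iso_arr C f"
  obtains g where "f \<in> Arr C" "g \<in> Arr C" "Dom C g = Cod C f" "Cod C g = Dom C f"
    "g \<cdot> f = Id C (Dom C f)" "f \<cdot> g = Id C (Cod C f)"
  using assms by (auto simp: iso_arr_def inverse_arrs_def Hom_iff)

lemma iso_arrI:
  assumes "f \<in> Arr C" "g \<in> Arr C" "Dom C g = Cod C f" "Cod C g = Dom C f"
    "g \<cdot> f = Id C (Dom C f)" "f \<cdot> g = Id C (Cod C f)"
  shows "iso_arr C f"
  using assms by (auto simp: iso_arr_def inverse_arrs_def Hom_iff)

lemma inverse_arrs_inv_arr:
  assumes "iso_arr C f"
  shows "inverse_arrs C f (inv_arr C f)"
proof -
  obtain g where g: "inverse_arrs C f g" using assms by (auto simp: iso_arr_def)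
  have "h = g" if "inverse_arrs C f h" for h
  proof -
    have "h = h \<cdot> (f \<cdot> g)" using that g by (simp add: inverse_arrs_def Hom_iff)
    also have "\<dots> = (h \<cdot> f) \<cdot> g"
      using that g by (subst Comp_assoc_Arr) (simp_all add: inverse_arrs_def Hom_iff)
    also have "\<dots> = g" using that g by (simp add: inverse_arrs_def Hom_iff)
    finally show ?thesis .
  qed
  with g show ?thesis unfolding inv_arr_def by (rule_tac theI) auto
qed

lemma inv_arr [simp]:
  assumes "iso_arr C f"
  shows "inv_arr C f \<in> Arr C" "Dom C (inv_arr C f) = Cod C f" "Cod C (inv_arr C f) = Dom C f"
    "inv_arr C f \<cdot> f = Id C (Dom C f)" "f \<cdot> inv_arr C f = Id C (Cod C f)"
  using inverse_arrs_inv_arr[OF assms] by (auto simp: inverse_arrs_def Hom_iff)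

lemma inv_arr_Comp [simp]:
  assumes "iso_arr C f" "f \<in> Arr C" "x \<in> Arr C"
  shows "Cod C x = Dom C f \<Longrightarrow> inv_arr C f \<cdot> f \<cdot> x = x"
    "Cod C x = Cod C f \<Longrightarrow> f \<cdot> inv_arr C f \<cdot> x = x"
  using assms by (auto simp: Comp_rewrite[OF inv_arr(4)] Comp_rewrite[OF inv_arr(5)])

lemma iso_inv_arr: "\<lbrakk>iso_arr C f; f \<in> Arr C\<rbrakk> \<Longrightarrow> iso_arr C (inv_arr C f)"
  by (rule iso_arrI[of _ f]) auto

lemma inv_arr_inv_arr: 
  assumes "iso_arr C f" "f \<in> Arr C"
  shows "inv_arr C (inv_arr C f) = f"
proof -
  let ?g = "inv_arr C f"
  have i: "iso_arr C ?g" using assms by (rule iso_inv_arr)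
  have "inv_arr C ?g = inv_arr C ?g \<cdot> (?g \<cdot> f)" using i assms by simp
  also have "\<dots> = f" using i assms by (intro inv_arr_Comp) auto
  finally show ?thesis .
qed

lemma iso_imp_mono: "iso_arr C f \<Longrightarrow> mono_arr C f"
  by (metis Id_mono mono_of_Comp iso_arrE Dom_Obj)

lemma iso_imp_epi: "iso_arr C f \<Longrightarrow> epi_arr C f"
  by (metis Id_epi epi_of_Comp iso_arrE Cod_Obj)

lemma isomorphicI: "iso_arr C f \<Longrightarrow> f \<in> Arr C \<Longrightarrow> isomorphic C (Dom C f) (Cod C f)"
  unfolding isomorphic_def by (rule bexI[of _ f]) (auto simp: Hom_iff)

lemma isomorphic_sym: "isomorphic C A B \<Longrightarrow> isomorphic C B A"
  unfolding isomorphic_def Hom_def using iso_inv_arr inv_arr(1-3) by fast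

lemma isomorphic_trans:
  assumes "isomorphic C A B" "isomorphic C B D"
  shows "isomorphic C A D"
proof -
  obtain f where f: "f \<in> Arr C" "Dom C f = A" "Cod C f = B" "iso_arr C f"
    using assms(1) by (auto simp: isomorphic_def Hom_iff)
  obtain g where g: "g \<in> Arr C" "Dom C g = B" "Cod C g = D" "iso_arr C g"
    using assms(2) by (auto simp: isomorphic_def Hom_iff)
  have "iso_arr C (g \<cdot> f)"
    by (rule iso_arrI[of _ "inv_arr C f \<cdot> inv_arr C g"]) (use f g in auto)
  then show ?thesis unfolding isomorphic_def Hom_iff using f g by (intro bexI[of _ "g \<cdot> f"]) (auto simp: Hom_iff)
qed

end

context linear_category
begin

lemma Zero_Arr [simp]:
  assumes "A \<in> Obj C" "B \<in> Obj C"
  shows "Zero C A B \<in> Arr C" "Dom C (Zero C A B) = A" "Cod C (Zero C A B) = B"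
  using Zero_Hom[OF assms] by (auto simp: Hom_iff)

lemma Add_cancel_zero:
  assumes "f \<in> Hom C A B" "g \<in> Hom C A B" "Add C f g = f"
  shows "g = Zero C A B"
proof -
  obtain n where n: "n \<in> Hom C A B" "Add C f n = Zero C A B" using Add_inverse assms by blast
  have AB: "A \<in> Obj C" "B \<in> Obj C" using assms(1) by (auto simp: Hom_iff)
  have "g = Add C (Add C n f) g"
    using n assms AB Add_commute Add_Zero Zero_Hom by metis
  also have "\<dots> = Add C n f" using Add_assoc n assms by metis
  finally show ?thesis using n assms Add_commute by metis
qed

lemma Scale_zero: "f \<in> Hom C A B \<Longrightarrow> Scale C 0 f = Zero C A B"
  using Add_cancel_zero[of "Scale C 0 f" A B "Scale C 0 f"] Scale_Hom Scale_add_left[of f A B 0 0]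
  by simp

lemma Comp_Zero [simp]:
  assumes "f \<in> Arr C" "A \<in> Obj C" "Dom C f = B"
  shows "f \<cdot> Zero C A B = Zero C A (Cod C f)"
proof -
  have z: "Zero C A B \<in> Hom C A B" using assms by (auto simp: Hom_iff)
  have f: "f \<in> Hom C B (Cod C f)" using assms by (auto simp: Hom_iff)
  show ?thesis
    using Comp_Scale_right[OF z f, of 0] Scale_zero[OF z] Scale_zero[OF Comp_Hom[OF z f]] by simp
qed

lemma Zero_Comp [simp]:
  assumes "f \<in> Arr C" "B \<in> Obj C" "Cod C f = A"
  shows "Zero C A B \<cdot> f = Zero C (Dom C f) B"
proof -
  have z: "Zero C A B \<in> Hom C A B" using assms by (auto simp: Hom_iff)
  have f: "f \<in> Hom C (Dom C f) A" using assms by (auto simp: Hom_iff)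
  show ?thesis
    using Comp_Scale_left[OF f z, of 0] Scale_zero[OF z] Scale_zero[OF Comp_Hom[OF f z]] by simp
qed

text \<open>
  The arrow \<open>d\<close> is the difference \<open>f - g\<close>. It reduces cancellation of \<open>f\<close> against \<open>g\<close> to the
  question which arrows are zero.
\<close>

lemma difference_arrow:
  assumes "f \<in> Hom C A B" "g \<in> Hom C A B"
  defines "d \<equiv> Add C f (Scale C (-1) g)"
  shows "d \<in> Hom C A B" "d = Zero C A B \<longleftrightarrow> f = g"
    "m \<in> Hom C B D \<Longrightarrow> m \<cdot> f = m \<cdot> g \<Longrightarrow> m \<cdot> d = Zero C A D"
    "e \<in> Hom C D A \<Longrightarrow> f \<cdot> e = g \<cdot> e \<Longrightarrow> d \<cdot> e = Zero C D B"
proof -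
  have neg: "Add C h (Scale C (-1) h) = Zero C X Y" if "h \<in> Hom C X Y" for h X Y
    using Scale_add_left[OF that, of 1 "-1"] Scale_one[OF that] Scale_zero[OF that] by simp
  have s: "Scale C (-1) g \<in> Hom C A B" using assms by (intro Scale_Hom)
  show d: "d \<in> Hom C A B" unfolding d_def using assms s by (intro Add_Hom)
  have "f = g" if "d = Zero C A B"
  proof -
    have "f = Add C f (Add C (Scale C (-1) g) g)"
      using neg[OF assms(2)] Add_commute[OF assms(2) s] Add_Zero[OF assms(1)] by simp
    also have "\<dots> = Add C d g"
      unfolding d_def using Add_assoc[OF assms(1) s assms(2)] by simp
    also have "\<dots> = g" using that Add_Zero Add_commute assms d by metis
    finally show ?thesis .
  qed
  then show "d = Zero C A B \<longleftrightarrow> f = g" using neg assms by (auto simp: d_def)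
  show "m \<cdot> d = Zero C A D" if m: "m \<in> Hom C B D" and e: "m \<cdot> f = m \<cdot> g"
    unfolding d_def using Comp_Add_right[OF assms(1) s m] Comp_Scale_right[OF assms(2) m] e
      neg[OF Comp_Hom[OF assms(2) m]] by simp
  show "d \<cdot> e = Zero C D B" if e: "e \<in> Hom C D A" and q: "f \<cdot> e = g \<cdot> e"
    unfolding d_def using Comp_Add_left[OF e assms(1) s] Comp_Scale_left[OF e assms(2)] q
      neg[OF Comp_Hom[OF e assms(2)]] by simp
qed

lemma mono_zeroI:
  assumes "m \<in> Arr C"
    and "\<And>f. \<lbrakk>f \<in> Arr C; Cod C f = Dom C m; m \<cdot> f = Zero C (Dom C f) (Cod C m)\<rbrakk>
      \<Longrightarrow> f = Zero C (Dom C f) (Dom C m)"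
  shows "mono_arr C m"
proof (rule mono_arrI)
  fix f g assume fg: "f \<in> Arr C" "g \<in> Arr C" "Dom C f = Dom C g" "Cod C f = Dom C m"
    "Cod C g = Dom C m" "m \<cdot> f = m \<cdot> g"
  have "f \<in> Hom C (Dom C g) (Dom C m)" "g \<in> Hom C (Dom C g) (Dom C m)"
    "m \<in> Hom C (Dom C m) (Cod C m)" using fg(1-5) assms(1) by (simp_all add: Hom_iff)
  from difference_arrow(1-2)[OF this(1,2)] difference_arrow(3)[OF this(1-3) fg(6)] assms(2)
  show "f = g" by (metis Hom_iff)
qed fact

lemma epi_zeroI:
  assumes "e \<in> Arr C"
    and "\<And>f. \<lbrakk>f \<in> Arr C; Dom C f = Cod C e; f \<cdot> e = Zero C (Dom C e) (Cod C f)\<rbrakk>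
      \<Longrightarrow> f = Zero C (Cod C e) (Cod C f)"
  shows "epi_arr C e"
proof (rule epi_arrI)
  fix f g assume fg: "f \<in> Arr C" "g \<in> Arr C" "Cod C f = Cod C g" "Dom C f = Cod C e"
    "Dom C g = Cod C e" "f \<cdot> e = g \<cdot> e"
  have "f \<in> Hom C (Cod C e) (Cod C g)" "g \<in> Hom C (Cod C e) (Cod C g)"
    "e \<in> Hom C (Dom C e) (Cod C e)" using fg(1-5) assms(1) by (simp_all add: Hom_iff)
  from difference_arrow(1-2)[OF this(1,2)] difference_arrow(4)[OF this(1-3) fg(6)] assms(2)
  show "f = g" by (metis Hom_iff)
qed fact

lemma mono_zeroD:
  assumes "mono_arr C m" "m \<cdot> f = Zero C (Dom C f) (Cod C m)" "f \<in> Arr C" "Cod C f = Dom C m"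
  shows "f = Zero C (Dom C f) (Dom C m)"
proof -
  have m: "m \<in> Arr C" using assms(1) by (rule mono_ArrD)
  then have "m \<cdot> f = m \<cdot> Zero C (Dom C f) (Dom C m)" using assms(2,3) by simp
  from mono_cancel[OF assms(1) this] show ?thesis using assms(3,4) m by simp
qed

lemma epi_zeroD:
  assumes "epi_arr C e" "f \<cdot> e = Zero C (Dom C e) (Cod C f)" "f \<in> Arr C" "Dom C f = Cod C e"
  shows "f = Zero C (Cod C e) (Cod C f)"
proof -
  have e: "e \<in> Arr C" using assms(1) by (rule epi_ArrD)
  then have "f \<cdot> e = Zero C (Cod C e) (Cod C f) \<cdot> e" using assms(2,3) by simp
  from epi_cancel[OF assms(1) this] show ?thesis using assms(3,4) e by simp
qed

lemma zero_obj_iff_Id: "zero_obj C Z \<longleftrightarrow> Z \<in> Obj C \<and> Id C Z = Zero C Z Z"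
proof (intro iffI conjI)
  assume z: "zero_obj C Z"
  then show "Z \<in> Obj C" by (simp add: zero_obj_def)
  then show "Id C Z = Zero C Z Z" using z Id_Hom Zero_Hom unfolding zero_obj_def by blast
next
  assume z: "Z \<in> Obj C \<and> Id C Z = Zero C Z Z"
  have "f = Zero C Z A" if "f \<in> Hom C Z A" for f A
    using that Comp_Id[of f Z] z by (auto simp: Hom_iff simp del: Comp_Id)
  moreover have "f = Zero C A Z" if "f \<in> Hom C A Z" for f A
    using that Id_Comp[of f Z] z by (auto simp: Hom_iff simp del: Id_Comp)
  ultimately show "zero_obj C Z" using z Zero_Hom unfolding zero_obj_def by metis
qed

lemma zero_obj_Obj: "zero_obj C Z \<Longrightarrow> Z \<in> Obj C"
  by (simp add: zero_obj_def)

lemma Zero_of_zero_Dom: "\<lbrakk>zero_obj C (Dom C f); f \<in> Arr C\<rbrakk> \<Longrightarrow> f = Zero C (Dom C f) (Cod C f)"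
  by (metis Comp_Id Comp_Zero Dom_Obj zero_obj_iff_Id)

lemma Zero_of_zero_Cod: "\<lbrakk>zero_obj C (Cod C f); f \<in> Arr C\<rbrakk> \<Longrightarrow> f = Zero C (Dom C f) (Cod C f)"
  by (metis Id_Comp Zero_Comp Cod_Obj zero_obj_iff_Id)

lemma zero_obj_of_mono: 
  assumes "mono_arr C m" "zero_obj C (Cod C m)"
  shows "zero_obj C (Dom C m)"
proof -
  have m: "m \<in> Arr C" using assms by (simp add: mono_arr_def)
  have "Id C (Dom C m) = Zero C (Dom C m) (Dom C m)"
    using mono_zeroD[OF assms(1), of "Id C (Dom C m)"] Zero_of_zero_Cod[OF assms(2) m] m by simp
  then show ?thesis using m by (simp add: zero_obj_iff_Id)
qed

lemma zero_obj_of_epi: 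
  assumes "epi_arr C e" "zero_obj C (Dom C e)"
  shows "zero_obj C (Cod C e)"
proof -
  have m: "e \<in> Arr C" using assms by (simp add: epi_arr_def)
  have "Id C (Cod C e) = Zero C (Cod C e) (Cod C e)"
    using epi_zeroD[OF assms(1), of "Id C (Cod C e)"] Zero_of_zero_Dom[OF assms(2) m] m by simp
  then show ?thesis using m by (simp add: zero_obj_iff_Id)
qed

lemma zero_Dom_mono:
  assumes "zero_obj C (Dom C f)" "f \<in> Arr C"
  shows "mono_arr C f"
  using assms by (intro mono_zeroI) (auto, metis Zero_of_zero_Cod)

end

text \<open>
  The defining equation has \<open>f\<close> on both sides; the predicate keeps it from being used for
  rewriting.
\<close>

definition null_arr :: "('o, 'm, 'k, 'z) lincat_scheme \<Rightarrow> 'm \<Rightarrow> bool" where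
  "null_arr C f \<longleftrightarrow> f \<in> Arr C \<and> f = Zero C (Dom C f) (Cod C f)"

context linear_category
begin

lemma null_arr_Zero [simp]: "\<lbrakk>A \<in> Obj C; B \<in> Obj C\<rbrakk> \<Longrightarrow> null_arr C (Zero C A B)"
  by (simp add: null_arr_def)

lemma null_arr_unique:
  "\<lbrakk>null_arr C f; null_arr C g; Dom C f = Dom C g; Cod C f = Cod C g\<rbrakk> \<Longrightarrow> f = g"
  unfolding null_arr_def by metis

lemma null_arr_Comp_right:
  assumes "null_arr C f" "g \<in> Arr C" "Cod C f = Dom C g"
  shows "null_arr C (g \<cdot> f)"
proof -
  have f: "f \<in> Arr C" "f = Zero C (Dom C f) (Dom C g)"
    using assms by (auto simp: null_arr_def)
  have "g \<cdot> f = Zero C (Dom C f) (Cod C g)" by (subst f(2)) (use f(1) assms(2) in simp)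
  then show ?thesis using f(1) assms(2) by simp
qed

lemma null_arr_Comp_left:
  assumes "null_arr C g" "f \<in> Arr C" "Cod C f = Dom C g"
  shows "null_arr C (g \<cdot> f)"
proof -
  have g: "g \<in> Arr C" "g = Zero C (Dom C g) (Cod C g)"
    using assms by (auto simp: null_arr_def)
  have "g \<cdot> f = Zero C (Dom C f) (Cod C g)" by (subst g(2)) (use g(1) assms(2,3) in simp)
  then show ?thesis using g(1) assms(2) by simp
qed

lemma mono_null_arr:
  assumes "mono_arr C m" "null_arr C (m \<cdot> f)" "f \<in> Arr C" "Cod C f = Dom C m"
  shows "null_arr C f"
proof -
  have "m \<in> Arr C" using assms(1) by (rule mono_ArrD)
  then have "m \<cdot> f = Zero C (Dom C f) (Cod C m)"
    using assms by (metis null_arr_def Comp_Arr(2,3))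
  from mono_zeroD[OF assms(1) this assms(3,4)] show ?thesis
    using assms(3,4) unfolding null_arr_def by metis
qed

lemma epi_null_arr:
  assumes "epi_arr C e" "null_arr C (f \<cdot> e)" "f \<in> Arr C" "Dom C f = Cod C e"
  shows "null_arr C f"
proof -
  have "e \<in> Arr C" using assms(1) by (rule epi_ArrD)
  then have "f \<cdot> e = Zero C (Dom C e) (Cod C f)"
    using assms by (metis null_arr_def Comp_Arr(2,3))
  from epi_zeroD[OF assms(1) this assms(3,4)] show ?thesis
    using assms(3,4) unfolding null_arr_def by metis
qed

lemma mono_null_arrI:
  assumes "m \<in> Arr C"
    and "\<And>f. \<lbrakk>f \<in> Arr C; Cod C f = Dom C m; null_arr C (m \<cdot> f)\<rbrakk> \<Longrightarrow> null_arr C f"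
  shows "mono_arr C m"
  using assms by (intro mono_zeroI) (metis null_arr_def Comp_Arr)+

lemma epi_null_arrI:
  assumes "e \<in> Arr C"
    and "\<And>f. \<lbrakk>f \<in> Arr C; Dom C f = Cod C e; null_arr C (f \<cdot> e)\<rbrakk> \<Longrightarrow> null_arr C f"
  shows "epi_arr C e"
  using assms by (intro epi_zeroI) (metis null_arr_def Comp_Arr)+

lemma zero_obj_iff_null: "zero_obj C Z \<longleftrightarrow> Z \<in> Obj C \<and> null_arr C (Id C Z)"
  unfolding zero_obj_iff_Id null_arr_def by (metis Id_Arr)

lemma null_arr_of_zero_Dom: "\<lbrakk>zero_obj C (Dom C f); f \<in> Arr C\<rbrakk> \<Longrightarrow> null_arr C f"
  unfolding null_arr_def using Zero_of_zero_Dom by metis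

lemma null_arr_of_zero_Cod: "\<lbrakk>zero_obj C (Cod C f); f \<in> Arr C\<rbrakk> \<Longrightarrow> null_arr C f"
  unfolding null_arr_def using Zero_of_zero_Cod by metis

lemma zero_Dom_of_null_mono:
  assumes "mono_arr C m" "null_arr C m"
  shows "zero_obj C (Dom C m)"
proof -
  have "m \<in> Arr C" using assms(1) by (rule mono_ArrD)
  then show ?thesis
    using mono_null_arr[OF assms(1), of "Id C (Dom C m)"] assms(2) by (simp add: zero_obj_iff_null)
qed

lemma zero_Cod_of_null_epi:
  assumes "epi_arr C e" "null_arr C e"
  shows "zero_obj C (Cod C e)"
proof -
  have "e \<in> Arr C" using assms(1) by (rule epi_ArrD)
  then show ?thesis
    using epi_null_arr[OF assms(1), of "Id C (Cod C e)"] assms(2) by (simp add: zero_obj_iff_null)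
qed

section \<open>Kernels, cokernels and short exact sequences\<close>

lemma kernel_Arr:
  assumes "is_kernel C k f"
  shows "f \<in> Arr C" "k \<in> Arr C" "Cod C k = Dom C f" "null_arr C (f \<cdot> k)"
proof -
  show a: "f \<in> Arr C" "k \<in> Arr C" "Cod C k = Dom C f" using assms by (auto simp: is_kernel_def)
  have "f \<cdot> k = Zero C (Dom C k) (Cod C f)" using assms by (simp add: is_kernel_def)
  then show "null_arr C (f \<cdot> k)" using a by simp
qed

lemma cokernel_Arr:
  assumes "is_cokernel C c f"
  shows "f \<in> Arr C" "c \<in> Arr C" "Dom C c = Cod C f" "null_arr C (c \<cdot> f)"
proof -
  show a: "f \<in> Arr C" "c \<in> Arr C" "Dom C c = Cod C f" using assms by (auto simp: is_cokernel_def)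
  have "c \<cdot> f = Zero C (Dom C f) (Cod C c)" using assms by (simp add: is_cokernel_def)
  then show "null_arr C (c \<cdot> f)" using a by simp
qed

lemma kernel_lift:
  assumes "is_kernel C k f" "null_arr C (f \<cdot> h)" "h \<in> Arr C" "Cod C h = Dom C f"
  obtains u where "u \<in> Arr C" "Dom C u = Dom C h" "Cod C u = Dom C k" "k \<cdot> u = h"
proof -
  have "f \<cdot> h = Zero C (Dom C h) (Cod C f)"
    using assms kernel_Arr[OF assms(1)] by (metis null_arr_def Comp_Arr(2,3))
  then have "\<exists>!u. u \<in> Hom C (Dom C h) (Dom C k) \<and> k \<cdot> u = h"
    using assms(1,3,4) unfolding is_kernel_def by blast
  then show ?thesis using that unfolding Hom_iff by blast
qed

lemma cokernel_lift:
  assumes "is_cokernel C c f" "null_arr C (h \<cdot> f)" "h \<in> Arr C" "Dom C h = Cod C f"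
  obtains u where "u \<in> Arr C" "Dom C u = Cod C c" "Cod C u = Cod C h" "u \<cdot> c = h"
proof -
  have "h \<cdot> f = Zero C (Dom C f) (Cod C h)"
    using assms cokernel_Arr[OF assms(1)] by (metis null_arr_def Comp_Arr(2,3))
  then have "\<exists>!u. u \<in> Hom C (Cod C c) (Cod C h) \<and> u \<cdot> c = h"
    using assms(1,3,4) unfolding is_cokernel_def by blast
  then show ?thesis using that unfolding Hom_iff by blast
qed

lemma kernel_mono:
  assumes "is_kernel C k f"
  shows "mono_arr C k"
proof (rule mono_arrI)
  note a = kernel_Arr[OF assms]
  show "k \<in> Arr C" by (rule a)
  fix g h assume gh: "g \<in> Arr C" "h \<in> Arr C" "Dom C g = Dom C h" "Cod C g = Dom C k"
    "Cod C h = Dom C k" "k \<cdot> g = k \<cdot> h"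
  have n: "null_arr C ((f \<cdot> k) \<cdot> h)" by (rule null_arr_Comp_left) (use a gh in auto)
  have "f \<cdot> (k \<cdot> h) = Zero C (Dom C (k \<cdot> h)) (Cod C f)"
    using n a gh(2,5) unfolding null_arr_def by simp
  moreover have "k \<cdot> h \<in> Arr C" "Cod C (k \<cdot> h) = Dom C f" using a gh(2,5) by auto
  ultimately have "\<exists>!u. u \<in> Hom C (Dom C (k \<cdot> h)) (Dom C k) \<and> k \<cdot> u = k \<cdot> h"
    using assms unfolding is_kernel_def by blast
  moreover have "g \<in> Hom C (Dom C (k \<cdot> h)) (Dom C k)" "h \<in> Hom C (Dom C (k \<cdot> h)) (Dom C k)"
    using gh(1-5) a by (auto simp: Hom_iff)
  ultimately show "g = h" using gh(6) by blast
qed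

lemma cokernel_epi:
  assumes "is_cokernel C c f"
  shows "epi_arr C c"
proof (rule epi_arrI)
  note a = cokernel_Arr[OF assms]
  show "c \<in> Arr C" by (rule a)
  fix g h assume gh: "g \<in> Arr C" "h \<in> Arr C" "Cod C g = Cod C h" "Dom C g = Cod C c"
    "Dom C h = Cod C c" "g \<cdot> c = h \<cdot> c"
  have n: "null_arr C (h \<cdot> c \<cdot> f)" by (rule null_arr_Comp_right) (use a gh in auto)
  have "(h \<cdot> c) \<cdot> f = Zero C (Dom C f) (Cod C (h \<cdot> c))"
    using n a gh(2,5) unfolding null_arr_def by simp
  moreover have "h \<cdot> c \<in> Arr C" "Dom C (h \<cdot> c) = Cod C f" using a gh(2,5) by auto
  ultimately have "\<exists>!u. u \<in> Hom C (Cod C c) (Cod C (h \<cdot> c)) \<and> u \<cdot> c = h \<cdot> c"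
    using assms unfolding is_cokernel_def by blast
  moreover have "g \<in> Hom C (Cod C c) (Cod C (h \<cdot> c))" "h \<in> Hom C (Cod C c) (Cod C (h \<cdot> c))"
    using gh(1-5) a by (auto simp: Hom_iff)
  ultimately show "g = h" using gh(6) by blast
qed

lemma is_kernelI:
  assumes "mono_arr C k" "f \<in> Arr C" "Cod C k = Dom C f" "null_arr C (f \<cdot> k)"
    and "\<And>h. \<lbrakk>h \<in> Arr C; Cod C h = Dom C f; null_arr C (f \<cdot> h)\<rbrakk>
      \<Longrightarrow> \<exists>u\<in>Arr C. Dom C u = Dom C h \<and> Cod C u = Dom C k \<and> k \<cdot> u = h"
  shows "is_kernel C k f"
  unfolding is_kernel_def
proof (intro conjI ballI impI)
  show k: "k \<in> Arr C" using assms(1) by (rule mono_ArrD)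
  show "f \<cdot> k = Zero C (Dom C k) (Cod C f)" using assms(2-4) k unfolding null_arr_def by simp
  fix h assume h: "h \<in> Arr C"
    and e: "Cod C h = Dom C f \<and> f \<cdot> h = Zero C (Dom C h) (Cod C f)"
  then have "null_arr C (f \<cdot> h)" using h assms(2) by simp
  then obtain u where u: "u \<in> Arr C" "Dom C u = Dom C h" "Cod C u = Dom C k" "k \<cdot> u = h"
    using assms(5)[OF h] e by blast
  show "\<exists>!u. u \<in> Hom C (Dom C h) (Dom C k) \<and> k \<cdot> u = h"
  proof (rule ex1I)
    show "u \<in> Hom C (Dom C h) (Dom C k) \<and> k \<cdot> u = h" using u by (simp add: Hom_iff)
    fix v assume v: "v \<in> Hom C (Dom C h) (Dom C k) \<and> k \<cdot> v = h"
    then have "k \<cdot> v = k \<cdot> u" using u by simp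
    from mono_cancel[OF assms(1) this] show "v = u" using u(1-3) v by (simp add: Hom_iff)
  qed
qed (use assms in auto)

lemma is_cokernelI:
  assumes "epi_arr C c" "f \<in> Arr C" "Dom C c = Cod C f" "null_arr C (c \<cdot> f)"
    and "\<And>h. \<lbrakk>h \<in> Arr C; Dom C h = Cod C f; null_arr C (h \<cdot> f)\<rbrakk>
      \<Longrightarrow> \<exists>u\<in>Arr C. Dom C u = Cod C c \<and> Cod C u = Cod C h \<and> u \<cdot> c = h"
  shows "is_cokernel C c f"
  unfolding is_cokernel_def
proof (intro conjI ballI impI)
  show c: "c \<in> Arr C" using assms(1) by (rule epi_ArrD)
  show "c \<cdot> f = Zero C (Dom C f) (Cod C c)" using assms(2-4) c unfolding null_arr_def by simp
  fix h assume h: "h \<in> Arr C"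
    and e: "Dom C h = Cod C f \<and> h \<cdot> f = Zero C (Dom C f) (Cod C h)"
  then have "null_arr C (h \<cdot> f)" using h assms(2) by simp
  then obtain u where u: "u \<in> Arr C" "Dom C u = Cod C c" "Cod C u = Cod C h" "u \<cdot> c = h"
    using assms(5)[OF h] e by blast
  show "\<exists>!u. u \<in> Hom C (Cod C c) (Cod C h) \<and> u \<cdot> c = h"
  proof (rule ex1I)
    show "u \<in> Hom C (Cod C c) (Cod C h) \<and> u \<cdot> c = h" using u by (simp add: Hom_iff)
    fix v assume v: "v \<in> Hom C (Cod C c) (Cod C h) \<and> v \<cdot> c = h"
    then have "v \<cdot> c = u \<cdot> c" using u by simp
    from epi_cancel[OF assms(1) this] show "v = u" using u(1-3) v by (simp add: Hom_iff)
  qed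
qed (use assms in auto)

end

context abelian_category
begin

text \<open>
  The arrow \<open>m\<close> is a kernel of some \<open>f\<close>, and \<open>f\<close> factors through the cokernel of \<open>m\<close>, so whatever
  is killed by the cokernel is killed by \<open>f\<close>.
\<close>

lemma mono_kernel_of_cokernel:
  assumes "mono_arr C m" "is_cokernel C c m"
  shows "is_kernel C m c"
proof (rule is_kernelI[OF assms(1)])
  note c = cokernel_Arr[OF assms(2)]
  show "c \<in> Arr C" "Cod C m = Dom C c" "null_arr C (c \<cdot> m)" using c by auto
  obtain f where f: "is_kernel C m f" using mono_normal assms(1) by blast
  note fm = kernel_Arr[OF f]
  obtain u where u: "u \<in> Arr C" "Dom C u = Cod C c" "Cod C u = Cod C f" "u \<cdot> c = f"
    using cokernel_lift[OF assms(2) fm(4,1)] fm(3) by auto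
  fix h assume h: "h \<in> Arr C" "Cod C h = Dom C c" "null_arr C (c \<cdot> h)"
  have "null_arr C (u \<cdot> c \<cdot> h)" by (rule null_arr_Comp_right) (use u h c in auto)
  then have "null_arr C (f \<cdot> h)" using Comp_rewrite[OF u(4)] u h c by simp
  then show "\<exists>u\<in>Arr C. Dom C u = Dom C h \<and> Cod C u = Dom C m \<and> m \<cdot> u = h"
    using kernel_lift[OF f] h c fm by metis
qed

lemma epi_cokernel_of_kernel:
  assumes "epi_arr C e" "is_kernel C k e"
  shows "is_cokernel C e k"
proof (rule is_cokernelI[OF assms(1)])
  note k = kernel_Arr[OF assms(2)]
  show "k \<in> Arr C" "Dom C e = Cod C k" "null_arr C (e \<cdot> k)" using k by auto
  obtain f where f: "is_cokernel C e f" using epi_normal assms(1) by blast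
  note fe = cokernel_Arr[OF f]
  obtain u where u: "u \<in> Arr C" "Dom C u = Dom C f" "Cod C u = Dom C k" "k \<cdot> u = f"
    using kernel_lift[OF assms(2) fe(4,1)] fe(3) by auto
  fix h assume h: "h \<in> Arr C" "Dom C h = Cod C k" "null_arr C (h \<cdot> k)"
  have "null_arr C ((h \<cdot> k) \<cdot> u)" by (rule null_arr_Comp_left) (use u h k in auto)
  then have "null_arr C (h \<cdot> f)" using u h k by simp
  then show "\<exists>u\<in>Arr C. Dom C u = Cod C e \<and> Cod C u = Cod C h \<and> u \<cdot> e = h"
    using cokernel_lift[OF f] h k fe by metis
qed

lemma short_exact_of_mono:
  assumes "mono_arr C m"
  obtains c where "short_exact C m c"
proof -
  obtain c where "is_cokernel C c m" using ex_cokernel mono_ArrD[OF assms] by blast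
  then show ?thesis using that mono_kernel_of_cokernel[OF assms] by (auto simp: short_exact_def)
qed

lemma short_exact_of_kernel: "\<lbrakk>epi_arr C e; is_kernel C k e\<rbrakk> \<Longrightarrow> short_exact C k e"
  by (simp add: short_exact_def epi_cokernel_of_kernel)

lemma short_exact_of_epi:
  assumes "epi_arr C e"
  obtains k where "short_exact C k e"
  using ex_kernel[OF epi_ArrD[OF assms]] short_exact_of_kernel[OF assms] by blast

lemma short_exactD:
  assumes "short_exact C i p"
  shows "i \<in> Arr C" "p \<in> Arr C" "Cod C i = Dom C p" "mono_arr C i" "epi_arr C p"
    "null_arr C (p \<cdot> i)" "is_kernel C i p" "is_cokernel C p i"
proof -
  show k: "is_kernel C i p" "is_cokernel C p i" using assms by (simp_all add: short_exact_def)
  show "i \<in> Arr C" "p \<in> Arr C" "Cod C i = Dom C p" "null_arr C (p \<cdot> i)"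
    using kernel_Arr[OF k(1)] by auto
  show "mono_arr C i" "epi_arr C p" using k kernel_mono cokernel_epi by blast+
qed

lemma mono_epi_iso:
  assumes "mono_arr C f" "epi_arr C f"
  shows "iso_arr C f"
proof -
  obtain c where c: "short_exact C f c" using short_exact_of_mono assms(1) .
  note d = short_exactD[OF c]
  have n: "null_arr C c" by (rule epi_null_arr[OF assms(2)]) (use d in auto)
  have "null_arr C (c \<cdot> Id C (Cod C f))" using n d by simp
  from kernel_lift[OF d(7) this] obtain u where
    u: "u \<in> Arr C" "Dom C u = Cod C f" "Cod C u = Dom C f" "f \<cdot> u = Id C (Cod C f)"
    using d by auto
  have "f \<cdot> (u \<cdot> f) = f \<cdot> Id C (Dom C f)"
    using Comp_rewrite[OF u(4), of f] u(1-3) d(1) by simp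
  from mono_cancel[OF assms(1) this] have "u \<cdot> f = Id C (Dom C f)" using u d(1) by simp
  then show ?thesis using u d(1) by (intro iso_arrI[of _ u])
qed

text \<open>
  Schur: the kernel of \<open>f\<close> is a proper subobject of a simple object, hence zero.
\<close>

lemma simple_mono:
  assumes "simple_obj C (Dom C f)" "f \<in> Arr C" "\<not> null_arr C f"
  shows "mono_arr C f"
proof (rule mono_null_arrI)
  obtain k where k: "is_kernel C k f" using ex_kernel assms by blast
  note a = kernel_Arr[OF k]
  have "\<not> iso_arr C k"
  proof
    assume "iso_arr C k"
    then have "null_arr C f" using epi_null_arr[OF iso_imp_epi, of k f] a by simp
    then show False using assms by simp
  qed
  then have z: "zero_obj C (Dom C k)"
    using assms(1) kernel_mono[OF k] a(3) unfolding simple_obj_def by metis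
  fix h assume h: "h \<in> Arr C" "Cod C h = Dom C f" "null_arr C (f \<cdot> h)"
  obtain u where u: "u \<in> Arr C" "Dom C u = Dom C h" "Cod C u = Dom C k" "k \<cdot> u = h"
    using kernel_lift[OF k h(3,1,2)] .
  have "null_arr C (k \<cdot> u)"
    by (rule null_arr_Comp_right[OF null_arr_of_zero_Cod]) (use u z a in auto)
  then show "null_arr C h" using u by simp
qed fact

text \<open>
  Schur: the kernel \<open>k\<close> of the cokernel of \<open>f\<close>, through which \<open>f\<close> factors, is a nonzero subobject
  of a simple object, hence everything.
\<close>

lemma simple_epi:
  assumes "simple_obj C (Cod C f)" "f \<in> Arr C" "\<not> null_arr C f"
  shows "epi_arr C f"
proof -
  obtain c where c: "is_cokernel C c f" using ex_cokernel assms by blast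
  note a = cokernel_Arr[OF c]
  obtain k where k: "is_kernel C k c" using ex_kernel a by blast
  note b = kernel_Arr[OF k]
  obtain u where u: "u \<in> Arr C" "Dom C u = Dom C f" "Cod C u = Dom C k" "k \<cdot> u = f"
    using kernel_lift[OF k a(4,1)] a by auto
  have "\<not> zero_obj C (Dom C k)"
  proof
    assume z: "zero_obj C (Dom C k)"
    have "null_arr C (k \<cdot> u)"
      by (rule null_arr_Comp_right[OF null_arr_of_zero_Cod]) (use u z b in auto)
    then show False using u assms by simp
  qed
  moreover have "Cod C k = Cod C f" using a b by simp
  ultimately have "iso_arr C k"
    using assms(1) kernel_mono[OF k] unfolding simple_obj_def by metis
  then have n: "null_arr C c" using epi_null_arr[OF iso_imp_epi, of k c] b by simp
  show ?thesis
  proof (rule epi_null_arrI)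
    fix h assume h: "h \<in> Arr C" "Dom C h = Cod C f" "null_arr C (h \<cdot> f)"
    obtain v where v: "v \<in> Arr C" "Dom C v = Cod C c" "Cod C v = Cod C h" "v \<cdot> c = h"
      using cokernel_lift[OF c h(3,1,2)] .
    have "null_arr C (v \<cdot> c)" by (rule null_arr_Comp_right) (use n v in auto)
    then show "null_arr C h" using v by simp
  qed fact
qed

end

section \<open>Composition series and additive functions\<close>

context abelian_category
begin

lemma composition_series_Obj: "composition_series C X Fs \<Longrightarrow> X \<in> Obj C"
  by (induction rule: composition_series.induct) (auto simp: zero_obj_Obj Hom_iff)

lemma composition_series_simple:
  "composition_series C X Fs \<Longrightarrow> T \<in> set Fs \<Longrightarrow> simple_obj C T"
  by (induction rule: composition_series.induct) auto

lemma simple_not_null_epi: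
  assumes "simple_obj C (Cod C p)" "epi_arr C p"
  shows "\<not> null_arr C p"
  using assms zero_Cod_of_null_epi unfolding simple_obj_def by blast

lemma composition_series_zero_obj:
  assumes "composition_series C X Fs" "zero_obj C X"
  shows "Fs = []"
  using assms
proof (cases rule: composition_series.cases)
  case (step Y Fs' i p S)
  have "zero_obj C S"
    using zero_obj_of_epi[of p] short_exactD(5)[OF step(5)] step(4) assms(2) by (simp add: Hom_iff)
  then show ?thesis using step(6) by (simp add: simple_obj_def)
qed simp

text \<open>
  The heart of the Jordan--Hoelder theorem: a subobject \<open>A\<close> of \<open>X\<close> meets the last step
  \<open>Y \<rightarrow> X \<rightarrow> S\<close> of a series in one of two ways. If \<open>A\<close> lies in \<open>Y\<close>, then \<open>S\<close> is the top factor
  of \<open>B = X / A\<close>, and \<open>Y / A\<close> is the kernel of \<open>B \<rightarrow> S\<close>; otherwise \<open>S\<close> is the top factor of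
  \<open>A\<close>, and \<open>Y / (A \<inter> Y)\<close> is isomorphic to \<open>B\<close>.
\<close>

lemma composition_series_split:
  assumes "composition_series C X Fs" "short_exact C a b" "Cod C a = X"
  shows "\<exists>As Bs. composition_series C (Dom C a) As \<and> composition_series C (Cod C b) Bs \<and>
    mset Fs = mset As + mset Bs"
  using assms
proof (induction arbitrary: a b rule: composition_series.induct)
  case (zero X)
  note ab = short_exactD[OF zero(2)]
  have "zero_obj C (Dom C a)" "zero_obj C (Cod C b)"
    using zero_obj_of_mono[OF ab(4)] zero_obj_of_epi[OF ab(5)] zero ab(3) by auto
  then show ?case using composition_series.zero by fastforce
next
  case (step Y Fs i X p S)
  note ab = short_exactD[OF step.prems(1)]
  note ip = short_exactD[OF step.hyps(4)]
  have io: "Dom C i = Y" "Cod C i = X" "Dom C p = X" "Cod C p = S"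
    using step.hyps(2,3) by (auto simp: Hom_iff)
  have xa: "Cod C a = X" "Dom C b = X" using step.prems(2) ab by auto
  show ?case
  proof (cases "null_arr C (p \<cdot> a)")
    case True
    obtain y where y: "y \<in> Arr C" "Dom C y = Dom C a" "Cod C y = Y" "i \<cdot> y = a"
      using kernel_lift[OF ip(7) True] ab xa io by auto
    have "null_arr C (p \<cdot> a)" by fact
    then obtain r where r: "r \<in> Arr C" "Dom C r = Cod C b" "Cod C r = S" "r \<cdot> b = p"
      using cokernel_lift[OF ab(8)] ip(2) xa io by metis
    have "epi_arr C (r \<cdot> b)" using r ip by simp
    then have re: "epi_arr C r" using epi_of_Comp r(1,2) ab by metis
    obtain k where "short_exact C k r" using short_exact_of_epi[OF re] .
    note kr = short_exactD[OF this] and k = this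
    have ka: "Cod C k = Cod C b" using kr r by simp
    have rbi: "null_arr C (r \<cdot> b \<cdot> i)"
      using Comp_rewrite[OF r(4), of i] r ab ip io xa by simp
    \<comment> \<open>\<open>c\<close> will be the quotient map from \<open>Y\<close> to \<open>Y / A\<close>, the kernel of \<open>r\<close>.\<close>
    obtain c where c: "c \<in> Arr C" "Dom C c = Y" "Cod C c = Dom C k" "k \<cdot> c = b \<cdot> i"
      using kernel_lift[OF kr(7) rbi] r ab ip io xa by auto
    have cy: "is_kernel C y c"
    proof (rule is_kernelI)
      have "mono_arr C (i \<cdot> y)" using y ab by simp
      then show "mono_arr C y" using mono_of_Comp ip(1) y io by metis
      have "null_arr C (k \<cdot> (c \<cdot> y))"
      proof -
        have "k \<cdot> (c \<cdot> y) = (b \<cdot> i) \<cdot> y" using Comp_rewrite[OF c(4), of y] c y kr by simp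
        also have "\<dots> = b \<cdot> a" using y ab ip io xa by simp
        finally show ?thesis using ab by simp
      qed
      then show "null_arr C (c \<cdot> y)"
        by (rule mono_null_arr[OF kr(4)]) (use c y in auto)
      fix h assume h: "h \<in> Arr C" "Cod C h = Dom C c" "null_arr C (c \<cdot> h)"
      have "null_arr C (k \<cdot> (c \<cdot> h))"
        by (rule null_arr_Comp_right) (use h c kr in auto)
      moreover have "k \<cdot> (c \<cdot> h) = b \<cdot> (i \<cdot> h)"
        using Comp_rewrite[OF c(4), of h] h c kr ab ip io xa by simp
      ultimately have "null_arr C (b \<cdot> (i \<cdot> h))" by simp
      then obtain v where v: "v \<in> Arr C" "Dom C v = Dom C h" "Cod C v = Dom C a" "a \<cdot> v = i \<cdot> h"
        using kernel_lift[OF ab(7), of "i \<cdot> h"] h c ip io xa by auto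
      have "i \<cdot> (y \<cdot> v) = i \<cdot> h" using Comp_rewrite[OF y(4), of v] v y ip(1) io by simp
      from mono_cancel[OF ip(4) this] have "y \<cdot> v = h" using v y h c io by simp
      then show "\<exists>u\<in>Arr C. Dom C u = Dom C h \<and> Cod C u = Dom C y \<and> y \<cdot> u = h"
        using v y by auto
    qed (use c y in auto)
    have ce: "epi_arr C c"
    proof -
      \<comment> \<open>Every arrow killing \<open>k \<cdot> m\<close>, for the image \<open>m\<close> of \<open>c\<close>, also kills \<open>k\<close>. A monomorphism being
        the kernel of its cokernel, \<open>k\<close> factors through \<open>k \<cdot> m\<close>, so the image of \<open>c\<close> is everything.\<close>
      obtain z where z: "is_cokernel C z c" using ex_cokernel c by blast
      note za = cokernel_Arr[OF z]
      obtain m where m: "is_kernel C m z" using ex_kernel za by blast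
      note ma = kernel_Arr[OF m]
      obtain e where e: "e \<in> Arr C" "Dom C e = Y" "Cod C e = Dom C m" "m \<cdot> e = c"
        using kernel_lift[OF m za(4,1)] za(3) c by auto
      have km: "mono_arr C (k \<cdot> m)" using mono_Comp[OF kr(4) kernel_mono[OF m]] ma za c by simp
      obtain d where "short_exact C (k \<cdot> m) d" using short_exact_of_mono[OF km] .
      note d = short_exactD[OF this]
      have da: "Dom C d = Cod C b" using d ka ma za c kr by simp
      have "null_arr C ((d \<cdot> (k \<cdot> m)) \<cdot> e)"
        by (rule null_arr_Comp_left) (use d e ma za c kr in auto)
      moreover have "(d \<cdot> (k \<cdot> m)) \<cdot> e = d \<cdot> (b \<cdot> i)"
        using d(2) da e ma(1-3) za(1-3) c kr(1) ka by simp
      ultimately have "null_arr C ((d \<cdot> b) \<cdot> i)" using d(2) da ab xa ip io by simp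
      then obtain w where w: "w \<in> Arr C" "Dom C w = S" "Cod C w = Cod C d" "w \<cdot> p = d \<cdot> b"
        using cokernel_lift[OF ip(8), of "d \<cdot> b"] d(2) da ab xa ip io by auto
      have "(w \<cdot> r) \<cdot> b = d \<cdot> b" using w r ab ip io by simp
      from epi_cancel[OF ab(5) this] have wr: "w \<cdot> r = d" using w r d(2) da ab by simp
      have "null_arr C (w \<cdot> (r \<cdot> k))" by (rule null_arr_Comp_right) (use w r kr in auto)
      moreover have "w \<cdot> (r \<cdot> k) = d \<cdot> k" using Comp_rewrite[OF wr] w r kr by simp
      ultimately have "null_arr C (d \<cdot> k)" by simp
      then obtain n where n: "n \<in> Arr C" "Dom C n = Dom C k" "Cod C n = Dom C m"
        "(k \<cdot> m) \<cdot> n = k"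
        using kernel_lift[OF d(7)] kr(1) ka da c za(1-3) ma(1-3) by auto
      have "k \<cdot> (m \<cdot> n) = k \<cdot> Id C (Dom C k)" using n kr(1) c za(1-3) ma(1-3) by simp
      from mono_cancel[OF kr(4) this] have mn: "m \<cdot> n = Id C (Dom C k)"
        using n kr(1) c za(1-3) ma(1-3) by simp
      have "null_arr C ((z \<cdot> m) \<cdot> n)" by (rule null_arr_Comp_left) (use n ma in auto)
      then have zn: "null_arr C z" using mn n ma(1-3) za(1-3) c by simp
      show ?thesis
      proof (rule epi_null_arrI)
        fix h assume h: "h \<in> Arr C" "Dom C h = Cod C c" "null_arr C (h \<cdot> c)"
        obtain v where v: "v \<in> Arr C" "Dom C v = Cod C z" "Cod C v = Cod C h" "v \<cdot> z = h"
          using cokernel_lift[OF z h(3,1,2)] .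
        have "null_arr C (v \<cdot> z)" by (rule null_arr_Comp_right) (use zn v in auto)
        then show "null_arr C h" using v by simp
      qed fact
    qed
    have "short_exact C y c" using short_exact_of_kernel[OF ce cy] .
    with step.IH[OF this] y c obtain As Ks where
      IH: "composition_series C (Dom C a) As" "composition_series C (Dom C k) Ks"
        "mset Fs = mset As + mset Ks" by auto
    have "composition_series C (Cod C b) (Ks @ [S])"
      by (rule composition_series.step[OF IH(2) _ _ k step.hyps(5)]) (use kr ka r in \<open>auto simp: Hom_iff\<close>)
    then show ?thesis using IH by (intro exI[of _ As] exI[of _ "Ks @ [S]"]) auto
  next
    case False
    have pa: "epi_arr C (p \<cdot> a)"
      by (rule simple_epi) (use False step.hyps(5) ab ip io xa in auto)
    obtain k where k: "short_exact C k (p \<cdot> a)" using short_exact_of_epi[OF pa] .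
    note kp = short_exactD[OF k]
    have ka: "Cod C k = Dom C a" using kp ab ip io xa by simp
    have "null_arr C (p \<cdot> (a \<cdot> k))" using kp(6) kp(1) ka ab ip io xa by simp
    then obtain y where y: "y \<in> Arr C" "Dom C y = Dom C k" "Cod C y = Y" "i \<cdot> y = a \<cdot> k"
      using kernel_lift[OF ip(7), of "a \<cdot> k"] kp(1) ka ab ip io xa by auto
    have bi: "epi_arr C (b \<cdot> i)"
    proof (rule epi_null_arrI)
      show "b \<cdot> i \<in> Arr C" using ab ip io xa by simp
      fix h assume h: "h \<in> Arr C" "Dom C h = Cod C (b \<cdot> i)" "null_arr C (h \<cdot> (b \<cdot> i))"
      have hd: "Dom C h = Cod C b" using h ab ip io xa by simp
      have "null_arr C ((h \<cdot> b) \<cdot> i)" using h hd ab ip io xa by simp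
      then obtain w where w: "w \<in> Arr C" "Dom C w = S" "Cod C w = Cod C h" "w \<cdot> p = h \<cdot> b"
        using cokernel_lift[OF ip(8), of "h \<cdot> b"] h hd ab xa ip io by auto
      have "null_arr C (h \<cdot> (b \<cdot> a))" by (rule null_arr_Comp_right) (use h hd ab in auto)
      moreover have "h \<cdot> (b \<cdot> a) = w \<cdot> (p \<cdot> a)"
        using Comp_rewrite[OF w(4), of a] w h hd ab ip io xa by simp
      ultimately have "null_arr C (w \<cdot> (p \<cdot> a))" by simp
      then have "null_arr C w" by (rule epi_null_arr[OF pa]) (use w ab ip io xa in auto)
      then have "null_arr C (w \<cdot> p)" by (rule null_arr_Comp_left) (use w ip io in auto)
      then have "null_arr C (h \<cdot> b)" using w by simp
      then show "null_arr C h" by (rule epi_null_arr[OF ab(5)]) (use h hd in auto)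
    qed
    have "is_kernel C y (b \<cdot> i)"
    proof (rule is_kernelI)
      have "mono_arr C (i \<cdot> y)" using y mono_Comp[OF ab(4) kp(4)] ka by simp
      then show "mono_arr C y" using mono_of_Comp ip(1) y io by metis
      show "b \<cdot> i \<in> Arr C" "Cod C y = Dom C (b \<cdot> i)" using ab ip io xa y by auto
      have "null_arr C ((b \<cdot> a) \<cdot> k)" by (rule null_arr_Comp_left) (use kp ka ab in auto)
      then show "null_arr C ((b \<cdot> i) \<cdot> y)" using y kp ka ab ip io xa by simp
      fix h assume h: "h \<in> Arr C" "Cod C h = Dom C (b \<cdot> i)" "null_arr C ((b \<cdot> i) \<cdot> h)"
      have hd: "Cod C h = Y" using h ab ip io xa by simp
      have "null_arr C (b \<cdot> (i \<cdot> h))" using h(1,3) hd ab ip io xa by simp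
      then obtain v where v: "v \<in> Arr C" "Dom C v = Dom C h" "Cod C v = Dom C a" "a \<cdot> v = i \<cdot> h"
        using kernel_lift[OF ab(7), of "i \<cdot> h"] h(1) hd ip io xa by auto
      have "null_arr C ((p \<cdot> i) \<cdot> h)"
        by (rule null_arr_Comp_left) (use ip hd h(1) io in auto)
      moreover have "(p \<cdot> a) \<cdot> v = (p \<cdot> i) \<cdot> h" using v h(1) hd ab(1) ip(1,2) io xa by simp
      ultimately have pav: "null_arr C ((p \<cdot> a) \<cdot> v)" by simp
      obtain u where u: "u \<in> Arr C" "Dom C u = Dom C h" "Cod C u = Dom C k" "k \<cdot> u = v"
        using kernel_lift[OF kp(7) pav v(1)] v(2,3) ab(1) ip(2) io xa by auto
      have "i \<cdot> (y \<cdot> u) = i \<cdot> h"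
        using Comp_rewrite[OF y(4), of u] u v y kp(1) ka ab(1) ip(1) io by simp
      from mono_cancel[OF ip(4) this] have "y \<cdot> u = h" using u y h(1) hd io by simp
      then show "\<exists>u\<in>Arr C. Dom C u = Dom C h \<and> Cod C u = Dom C y \<and> y \<cdot> u = h"
        using u y by auto
    qed
    then have "short_exact C y (b \<cdot> i)" using short_exact_of_kernel[OF bi] by blast
    from step.IH[OF this] y ab ip io xa obtain Ks Bs where
      IH: "composition_series C (Dom C k) Ks" "composition_series C (Cod C b) Bs"
        "mset Fs = mset Ks + mset Bs" by auto
    have "composition_series C (Dom C a) (Ks @ [S])"
      by (rule composition_series.step[OF IH(1) _ _ k step.hyps(5)])
        (use kp ka ab ip io xa in \<open>auto simp: Hom_iff\<close>)
    then show ?thesis using IH by (intro exI[of _ "Ks @ [S]"] exI[of _ Bs]) auto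
  qed
qed

lemma composition_series_of_simple:
  assumes "composition_series C S Fs" "simple_obj C S"
  shows "\<exists>T. Fs = [T] \<and> isomorphic C S T"
  using assms(1)
proof (cases rule: composition_series.cases)
  case zero
  then show ?thesis using assms(2) by (simp add: simple_obj_def)
next
  case (step Y Gs i p T)
  note ip = short_exactD[OF step(5)]
  have io: "Dom C i = Y" "Cod C i = S" "Dom C p = S" "Cod C p = T"
    using step(3-4) by (auto simp: Hom_iff)
  have np: "\<not> null_arr C p" using simple_not_null_epi ip(5) step(6) io by simp
  have "\<not> iso_arr C i"
    using epi_null_arr[OF iso_imp_epi ip(6)] np ip by auto
  then have "zero_obj C Y" using assms(2) ip io unfolding simple_obj_def by metis
  moreover have "iso_arr C p"
    using mono_epi_iso[OF _ ip(5)] simple_mono[of p] assms(2) ip np io by simp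
  ultimately show ?thesis
    using step(1,2,4) composition_series_zero_obj unfolding isomorphic_def by auto
qed

text \<open>
  Summing an arbitrary isomorphism-invariant weight covers the length and all multiplicities at
  once.
\<close>

lemma jordan_hoelder:
  assumes "composition_series C X Gs" "composition_series C X Fs"
    and "\<And>A B. isomorphic C A B \<Longrightarrow> w A = (w B :: nat)"
  shows "sum_list (map w Fs) = sum_list (map w Gs)"
  using assms(1,2)
proof (induction arbitrary: Fs rule: composition_series.induct)
  case (zero X)
  then show ?case using composition_series_zero_obj by fastforce
next
  case (step Y Gs i X p S)
  from step.hyps(2,3) have io: "Dom C i = Y" "Cod C i = X" "Cod C p = S" by (auto simp: Hom_iff)
  obtain As Bs where s: "composition_series C Y As" "composition_series C S Bs"
    "mset Fs = mset As + mset Bs"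
    using composition_series_split[OF step.prems step.hyps(4)] io by auto
  obtain T where T: "Bs = [T]" "isomorphic C S T"
    using composition_series_of_simple[OF s(2) step.hyps(5)] by blast
  have "sum_list (map w Fs) = sum_list (map w As) + sum_list (map w Bs)"
    using s(3) by (metis mset_append mset_map sum_mset_sum_list map_append sum_list_append)
  then show ?case using step.IH[OF s(1)] T assms(3)[OF T(2)] by simp
qed

definition additive :: "('o \<Rightarrow> nat) \<Rightarrow> bool" where
  "additive \<phi> \<longleftrightarrow> (\<forall>i p. short_exact C i p \<longrightarrow> \<phi> (Dom C p) = \<phi> (Dom C i) + \<phi> (Cod C p))"

lemma short_exact_iso:
  assumes "iso_arr C f" "zero_obj C Z"
  shows "short_exact C f (Zero C (Cod C f) Z)"
proof -
  obtain g where g: "f \<in> Arr C" "g \<in> Arr C" "Dom C g = Cod C f" "Cod C g = Dom C f"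
    "g \<cdot> f = Id C (Dom C f)" "f \<cdot> g = Id C (Cod C f)" using iso_arrE[OF assms(1)] .
  have Z: "Z \<in> Obj C" using assms zero_obj_Obj by blast
  have e: "epi_arr C (Zero C (Cod C f) Z)"
  proof (rule epi_null_arrI)
    fix h assume "h \<in> Arr C" "Dom C h = Cod C (Zero C (Cod C f) Z)"
    then show "null_arr C h" using null_arr_of_zero_Dom assms(2) g Z by simp
  qed (use g Z in simp)
  have "is_kernel C f (Zero C (Cod C f) Z)"
  proof (rule is_kernelI[OF iso_imp_mono[OF assms(1)]])
    fix h assume h: "h \<in> Arr C" "Cod C h = Dom C (Zero C (Cod C f) Z)"
    then have hc: "Cod C h = Cod C f" using g Z by simp
    have "f \<cdot> (g \<cdot> h) = h" using Comp_rewrite[OF g(6), of h] g(1-4) h(1) hc by simp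
    then show "\<exists>u\<in>Arr C. Dom C u = Dom C h \<and> Cod C u = Dom C f \<and> f \<cdot> u = h"
      using g(1-4) h(1) hc by (intro bexI[of _ "g \<cdot> h"]) auto
  qed (use g Z in auto)
  with e show ?thesis by (rule short_exact_of_kernel)
qed

lemma additive_zero_obj:
  assumes "additive \<phi>" "zero_obj C Z"
  shows "\<phi> Z = 0"
proof -
  have Z: "Z \<in> Obj C" using assms zero_obj_Obj by blast
  then have "iso_arr C (Id C Z)" by (intro iso_arrI[of _ "Id C Z"]) auto
  from short_exact_iso[OF this assms(2)] assms(1) have "\<phi> Z = \<phi> Z + \<phi> Z"
    unfolding additive_def using Z by fastforce
  then show ?thesis by simp
qed

lemma additive_isomorphic:
  assumes "additive \<phi>" "isomorphic C A B"
  shows "\<phi> A = \<phi> B"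
proof -
  obtain f where f: "f \<in> Arr C" "Dom C f = A" "Cod C f = B" "iso_arr C f"
    using assms(2) by (auto simp: isomorphic_def Hom_iff)
  obtain Z where Z: "zero_obj C Z" using ex_zero_obj by blast
  have "\<phi> B = \<phi> A + \<phi> Z"
    using short_exact_iso[OF f(4) Z] assms(1) f Z zero_obj_Obj[OF Z]
    unfolding additive_def by fastforce
  then show ?thesis using additive_zero_obj[OF assms(1) Z] by simp
qed

text \<open>
  Additive functions are determined by their values on simple objects. Applied to the length or a
  multiplicity after tensoring, this turns the tensor product of two filtrations into a sum.
\<close>

lemma additive_eq_sum_list:
  assumes "additive \<phi>" "composition_series C X Fs"
  shows "\<phi> X = sum_list (map \<phi> Fs)"
  using assms(2)
proof (induction rule: composition_series.induct)
  case (zero X)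
  then show ?case using additive_zero_obj[OF assms(1)] by simp
next
  case (step Y Fs i X p S)
  then have "\<phi> X = \<phi> Y + \<phi> S" using assms(1) unfolding additive_def Hom_iff by metis
  then show ?case using step by simp
qed

end

context artinian_category
begin

lemma comp_factors: "X \<in> Obj C \<Longrightarrow> composition_series C X (comp_factors C X)"
  using obj_finite_length unfolding finite_length_def comp_factors_def by (metis someI_ex)

lemma additive_comp_factors:
  "\<lbrakk>additive \<phi>; X \<in> Obj C\<rbrakk> \<Longrightarrow> \<phi> X = sum_list (map \<phi> (comp_factors C X))"
  using additive_eq_sum_list comp_factors by blast

lemma additive_weight:
  assumes "\<And>A B. isomorphic C A B \<Longrightarrow> w A = (w B :: nat)"
  shows "additive (\<lambda>X. sum_list (map w (comp_factors C X)))"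
  unfolding additive_def
proof (intro allI impI)
  fix i p assume ip: "short_exact C i p"
  note d = short_exactD[OF ip]
  have o: "Dom C i \<in> Obj C" "Dom C p \<in> Obj C" "Cod C p \<in> Obj C" using d by auto
  obtain As Bs where s: "composition_series C (Dom C i) As" "composition_series C (Cod C p) Bs"
    "mset (comp_factors C (Dom C p)) = mset As + mset Bs"
    using composition_series_split[OF comp_factors[OF o(2)] ip d(3)] by blast
  have "sum_list (map w (comp_factors C (Dom C p))) = sum_list (map w As) + sum_list (map w Bs)"
    using s(3) by (metis mset_append mset_map sum_mset_sum_list map_append sum_list_append)
  also have "sum_list (map w As) = sum_list (map w (comp_factors C (Dom C i)))"
    using jordan_hoelder[OF comp_factors[OF o(1)] s(1)] assms by blast
  also have "sum_list (map w Bs) = sum_list (map w (comp_factors C (Cod C p)))"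
    using jordan_hoelder[OF comp_factors[OF o(3)] s(2)] assms by blast
  finally show "sum_list (map w (comp_factors C (Dom C p)))
    = sum_list (map w (comp_factors C (Dom C i))) + sum_list (map w (comp_factors C (Cod C p)))" .
qed

lemma obj_length_additive: "additive (obj_length C)"
  using additive_weight[of "\<lambda>_. 1"] by (simp add: sum_list_triv obj_length_def[abs_def])

lemma multiplicity_in_eq_sum_list:
  "multiplicity_in C X S = sum_list (map (\<lambda>T. if isomorphic C S T then 1 else 0) (comp_factors C X))"
proof -
  have "length (filter P Fs) = sum_list (map (\<lambda>T. if P T then 1 else 0) Fs)" for P Fs
    by (induction Fs) auto
  then show ?thesis by (simp add: multiplicity_in_def)
qed

lemma multiplicity_in_additive: "additive (\<lambda>X. multiplicity_in C X S)"
  unfolding multiplicity_in_eq_sum_list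
  by (rule additive_weight) (metis isomorphic_sym isomorphic_trans)

lemma obj_length_eq_0: "X \<in> Obj C \<Longrightarrow> obj_length C X = 0 \<Longrightarrow> zero_obj C X"
  using comp_factors[of X] by (auto simp: obj_length_def elim: composition_series.cases)

lemma obj_length_composition_series: 
  "composition_series C X Fs \<Longrightarrow> obj_length C X = length Fs"
  using jordan_hoelder[OF comp_factors, of X Fs "\<lambda>_. 1"] composition_series_Obj[of X Fs]
  by (simp add: sum_list_triv obj_length_def)

lemma obj_length_mono_iso:
  assumes "mono_arr C m" "obj_length C (Cod C m) \<le> obj_length C (Dom C m)"
  shows "iso_arr C m"
proof -
  obtain c where c: "short_exact C m c" using short_exact_of_mono[OF assms(1)] .
  note d = short_exactD[OF c]
  have "obj_length C (Cod C c) = 0"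
    using c d assms(2) obj_length_additive unfolding additive_def by (metis add_le_same_cancel1 le_0_eq)
  then have z: "zero_obj C (Cod C c)" using obj_length_eq_0 d by simp
  then have "null_arr C c" using null_arr_of_zero_Cod d by simp
  have "epi_arr C m"
  proof (rule epi_null_arrI)
    fix h assume h: "h \<in> Arr C" "Dom C h = Cod C m" "null_arr C (h \<cdot> m)"
    obtain v where v: "v \<in> Arr C" "Dom C v = Cod C c" "Cod C v = Cod C h" "v \<cdot> c = h"
      using cokernel_lift[OF d(8) h(3,1,2)] .
    have "null_arr C (v \<cdot> c)" by (rule null_arr_Comp_right) (use \<open>null_arr C c\<close> v in auto)
    then show "null_arr C h" using v by simp
  qed fact
  then show ?thesis using mono_epi_iso assms by blast
qed

lemma multiplicity_in_simple_subobject: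
  assumes "mono_arr C m" "simple_obj C (Dom C m)"
  shows "multiplicity_in C (Cod C m) (Dom C m) \<ge> 1"
proof -
  obtain c where c: "short_exact C m c" using short_exact_of_mono[OF assms(1)] .
  have "Dom C m \<in> Obj C" using assms(2) by (simp add: simple_obj_def)
  then obtain T where "comp_factors C (Dom C m) = [T]" "isomorphic C (Dom C m) T"
    using composition_series_of_simple[OF comp_factors assms(2)] by blast
  then have "multiplicity_in C (Dom C m) (Dom C m) = 1" by (simp add: multiplicity_in_def)
  with c short_exactD[OF c] multiplicity_in_additive[of "Dom C m"] show ?thesis
    unfolding additive_def by (metis le_add1)
qed

lemma multiplicity_in_simple:
  assumes "simple_obj C S"
  shows "multiplicity_in C S S = 1"
proof -
  have "S \<in> Obj C" using assms by (simp add: simple_obj_def)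
  then obtain T where "comp_factors C S = [T]" "isomorphic C S T"
    using composition_series_of_simple[OF comp_factors assms] by blast
  then show ?thesis by (simp add: multiplicity_in_def)
qed

lemma multiplicity_in_pos: "0 < multiplicity_in C X S \<longleftrightarrow> (\<exists>T\<in>set (comp_factors C X). isomorphic C S T)"
  unfolding multiplicity_in_def by (auto simp: filter_empty_conv)

end

section \<open>Loewy length\<close>

context abelian_category
begin

lemma factors_throughI:
  "\<lbrakk>u \<in> Arr C; Dom C u = Dom C t; Cod C u = Dom C s; s \<cdot> u = t\<rbrakk> \<Longrightarrow> factors_through C t s"
  unfolding factors_through_def by (rule bexI[of _ u]) (simp_all add: Hom_iff)

lemma factors_throughE:
  assumes "factors_through C t s"
  obtains u where "u \<in> Arr C" "Dom C u = Dom C t" "Cod C u = Dom C s" "s \<cdot> u = t"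
  using assms unfolding factors_through_def Hom_def by blast

lemma null_factors_through:
  assumes "null_arr C t" "s \<in> Arr C" "Cod C s = Cod C t"
  shows "factors_through C t s"
proof (rule factors_throughI)
  have t: "t \<in> Arr C" using assms by (simp add: null_arr_def)
  show "Zero C (Dom C t) (Dom C s) \<in> Arr C" "Dom C (Zero C (Dom C t) (Dom C s)) = Dom C t"
    "Cod C (Zero C (Dom C t) (Dom C s)) = Dom C s" using assms t by auto
  show "s \<cdot> Zero C (Dom C t) (Dom C s) = t"
    by (rule null_arr_unique) (use assms t in auto)
qed

lemma factors_through_null:
  assumes "factors_through C t s" "null_arr C (c \<cdot> s)" "c \<in> Arr C" "s \<in> Arr C" "Dom C c = Cod C s"
  shows "null_arr C (c \<cdot> t)"
proof -
  obtain u where u: "u \<in> Arr C" "Dom C u = Dom C t" "Cod C u = Dom C s" "s \<cdot> u = t"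
    using factors_throughE[OF assms(1)] .
  have "null_arr C ((c \<cdot> s) \<cdot> u)" by (rule null_arr_Comp_left) (use assms u in auto)
  then show ?thesis using u assms by simp
qed

lemma joint_kernel:
  assumes "U \<in> Obj C" "\<And>f. f \<in> set fs \<Longrightarrow> f \<in> Arr C \<and> Dom C f = U"
  shows "\<exists>u. mono_arr C u \<and> Cod C u = U \<and> (\<forall>f\<in>set fs. null_arr C (f \<cdot> u)) \<and>
    (\<forall>t\<in>Arr C. Cod C t = U \<and> (\<forall>f\<in>set fs. null_arr C (f \<cdot> t)) \<longrightarrow> factors_through C t u)"
  using assms(2)
proof (induction fs)
  case Nil
  show ?case
    using assms(1) Id_mono by (intro exI[of _ "Id C U"]) (auto intro: factors_throughI)
next
  case (Cons f fs)
  then obtain u where u: "mono_arr C u" "Cod C u = U" "\<forall>f\<in>set fs. null_arr C (f \<cdot> u)"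
    "\<And>t. \<lbrakk>t \<in> Arr C; Cod C t = U; \<forall>f\<in>set fs. null_arr C (f \<cdot> t)\<rbrakk> \<Longrightarrow> factors_through C t u"
    by auto
  have uA: "u \<in> Arr C" using u(1) by (rule mono_ArrD)
  have f: "f \<in> Arr C" "Dom C f = U" using Cons.prems by auto
  obtain k where k: "is_kernel C k (f \<cdot> u)" using ex_kernel f u(2) uA by fastforce
  note ka = kernel_Arr[OF k]
  have kd: "Cod C k = Dom C u" using ka f u uA by simp
  show ?case
  proof (intro exI[of _ "u \<cdot> k"] conjI ballI impI)
    show "mono_arr C (u \<cdot> k)" using mono_Comp[OF u(1) kernel_mono[OF k] kd] .
    show "Cod C (u \<cdot> k) = U" using ka kd uA u by simp
    fix g assume g: "g \<in> set (f # fs)"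
    show "null_arr C (g \<cdot> u \<cdot> k)"
    proof (cases "g = f")
      case True
      then show ?thesis using ka(4) f uA u(2) ka(2) kd by simp
    next
      case False
      then have "null_arr C ((g \<cdot> u) \<cdot> k)"
        by (rule_tac null_arr_Comp_left) (use g u uA ka kd Cons.prems[OF g] in auto)
      then show ?thesis using uA u(2) ka(2) kd Cons.prems[OF g] by simp
    qed
  next
    fix t assume t: "t \<in> Arr C" "Cod C t = U \<and> (\<forall>f\<in>set (f # fs). null_arr C (f \<cdot> t))"
    then have "factors_through C t u" using u(4) by simp
    then obtain v where v: "v \<in> Arr C" "Dom C v = Dom C t" "Cod C v = Dom C u" "u \<cdot> v = t"
      by (rule factors_throughE)
    have n: "null_arr C ((f \<cdot> u) \<cdot> v)" using t v f u(2) uA by simp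
    obtain w where w: "w \<in> Arr C" "Dom C w = Dom C v" "Cod C w = Dom C k" "k \<cdot> w = v"
      using kernel_lift[OF k n v(1)] v f u(2) uA by auto
    show "factors_through C t (u \<cdot> k)"
      by (rule factors_throughI[of w]) (use w v ka(2) kd uA in auto)
  qed
qed

text \<open>
  If finitely many maps from \<open>U\<close> to simple objects have zero common kernel, then \<open>U\<close> is
  semisimple, so every map out of \<open>U\<close> lands in the socle. The lemma says this for the quotient of
  \<open>U\<close> by the common kernel, without forming the quotient. In the inductive step, let \<open>g\<close> be one of
  the maps and \<open>L\<close> the common kernel of the others. If \<open>g\<close> vanishes on \<open>L\<close>, it can be left out.
  Otherwise \<open>g\<close> maps \<open>L\<close> onto its simple target, so that \<open>U\<close> is spanned by \<open>L\<close> and the kernel of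
  \<open>g\<close>, and it suffices that both are mapped to the socle.
\<close>

lemma semisimple_factors_through_socle:
  assumes "length gs = n" "\<And>g. g \<in> set gs \<Longrightarrow> g \<in> Arr C \<and> Dom C g = Dom C h \<and>
      (simple_obj C (Cod C g) \<or> zero_obj C (Cod C g))"
    and "h \<in> Arr C" "contains_simples C (Cod C h) s"
    and "\<And>t. \<lbrakk>t \<in> Arr C; Cod C t = Dom C h; \<And>g. g \<in> set gs \<Longrightarrow> null_arr C (g \<cdot> t)\<rbrakk>
      \<Longrightarrow> null_arr C (h \<cdot> t)"
  shows "factors_through C h s"
  using assms
proof (induction n arbitrary: gs h)
  case 0
  have s: "s \<in> Arr C" "Cod C s = Cod C h"
    using "0.prems"(4) mono_ArrD by (auto simp: contains_simples_def)
  have "null_arr C (h \<cdot> Id C (Dom C h))" by (rule "0.prems"(5)) (use 0 in auto)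
  then have "null_arr C h" using 0 by simp
  then show ?case using s by (rule null_factors_through)
next
  case (Suc n)
  obtain g gs' where gs: "gs = g # gs'" "length gs' = n" using Suc.prems(1) by (cases gs) auto
  have gA: "g \<in> Arr C" "Dom C g = Dom C h" "simple_obj C (Cod C g) \<or> zero_obj C (Cod C g)"
    using Suc.prems(2) gs by auto
  have gs'A: "f \<in> Arr C \<and> Dom C f = Dom C h \<and> (simple_obj C (Cod C f) \<or> zero_obj C (Cod C f))"
    if "f \<in> set gs'" for f using that Suc.prems(2) gs by auto
  note hA = Suc.prems(3)
  have drop: "factors_through C h s"
    if "\<And>t. \<lbrakk>t \<in> Arr C; Cod C t = Dom C h; \<And>f. f \<in> set gs' \<Longrightarrow> null_arr C (f \<cdot> t)\<rbrakk>
      \<Longrightarrow> null_arr C (g \<cdot> t)"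
  proof (rule Suc.IH[OF gs(2) gs'A hA Suc.prems(4)])
    fix t assume t: "t \<in> Arr C" "Cod C t = Dom C h" "\<And>f. f \<in> set gs' \<Longrightarrow> null_arr C (f \<cdot> t)"
    show "null_arr C (h \<cdot> t)"
      by (rule Suc.prems(5)[OF t(1,2)]) (use that[OF t] t(3) gs(1) in auto)
  qed
  show ?case
  proof (cases "null_arr C g")
    case True
    show ?thesis by (rule drop, rule null_arr_Comp_left[OF True]) (use gA in auto)
  next
    case False
    have sg: "simple_obj C (Cod C g)" using False gA null_arr_of_zero_Cod by blast
    have eg: "epi_arr C g" using simple_epi[OF sg gA(1) False] .
    have ms: "mono_arr C s" "Cod C s = Cod C h" using Suc.prems(4) by (auto simp: contains_simples_def)
    obtain c where "short_exact C s c" using short_exact_of_mono[OF ms(1)] .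
    note sc = short_exactD[OF this]
    have cd: "Dom C c = Cod C h" using sc ms by simp
    obtain k where "short_exact C k g" using short_exact_of_epi[OF eg] .
    note kg = short_exactD[OF this]
    have kd: "Cod C k = Dom C h" using kg gA by simp
    have "factors_through C (h \<cdot> k) s"
    proof (rule Suc.IH[of "map (\<lambda>f. f \<cdot> k) gs'"])
      show "length (map (\<lambda>f. f \<cdot> k) gs') = n" using gs by simp
      show "f \<in> Arr C \<and> Dom C f = Dom C (h \<cdot> k) \<and> (simple_obj C (Cod C f) \<or> zero_obj C (Cod C f))"
        if "f \<in> set (map (\<lambda>f. f \<cdot> k) gs')" for f
      proof -
        obtain f' where f': "f' \<in> set gs'" "f = f' \<cdot> k" using \<open>f \<in> _\<close> by auto
        show ?thesis using gs'A[OF f'(1)] f'(2) kg(1) kd hA by simp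
      qed
      show "h \<cdot> k \<in> Arr C" "contains_simples C (Cod C (h \<cdot> k)) s" using hA kg kd Suc.prems(4) by auto
      fix t assume t: "t \<in> Arr C" "Cod C t = Dom C (h \<cdot> k)"
        and tn: "\<And>f. f \<in> set (map (\<lambda>f. f \<cdot> k) gs') \<Longrightarrow> null_arr C (f \<cdot> t)"
      have td: "Cod C t = Dom C k" using t(2) hA kg(1) kd by simp
      have "null_arr C (h \<cdot> (k \<cdot> t))"
      proof (rule Suc.prems(5))
        show "k \<cdot> t \<in> Arr C" "Cod C (k \<cdot> t) = Dom C h" using t td kg kd by auto
        fix f assume f: "f \<in> set gs"
        show "null_arr C (f \<cdot> (k \<cdot> t))"
        proof (cases "f = g")
          case True
          have "null_arr C ((g \<cdot> k) \<cdot> t)" by (rule null_arr_Comp_left) (use kg t td in auto)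
          then show ?thesis using True kg(1-3) t(1) td by simp
        next
          case False
          then have f': "f \<in> set gs'" using f gs by simp
          have "null_arr C ((f \<cdot> k) \<cdot> t)" using tn f' by simp
          then show ?thesis using gs'A[OF f'] kg(1) t(1) td kd by simp
        qed
      qed
      then show "null_arr C ((h \<cdot> k) \<cdot> t)" using hA kg(1) kd t(1) td by simp
    qed
    then have "null_arr C (c \<cdot> (h \<cdot> k))" by (rule factors_through_null) (use sc in auto)
    then have "null_arr C ((c \<cdot> h) \<cdot> k)" using hA kg(1) kd sc(2) cd by simp
    \<comment> \<open>Modulo the socle \<open>s\<close>, the map \<open>h\<close> factors as \<open>w\<close> after \<open>g\<close>; it remains to see that \<open>w\<close> is zero.\<close>
    then obtain w where w: "w \<in> Arr C" "Dom C w = Cod C g" "Cod C w = Cod C c" "w \<cdot> g = c \<cdot> h"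
      using cokernel_lift[OF kg(8), of "c \<cdot> h"] hA sc(2) cd kd by auto
    have "\<exists>u. mono_arr C u \<and> Cod C u = Dom C h \<and> (\<forall>f\<in>set gs'. null_arr C (f \<cdot> u)) \<and>
      (\<forall>t\<in>Arr C. Cod C t = Dom C h \<and> (\<forall>f\<in>set gs'. null_arr C (f \<cdot> t)) \<longrightarrow> factors_through C t u)"
      using hA gs'A by (intro joint_kernel) auto
    then obtain l where l: "mono_arr C l" "Cod C l = Dom C h" "\<forall>f\<in>set gs'. null_arr C (f \<cdot> l)"
      "\<And>t. \<lbrakk>t \<in> Arr C; Cod C t = Dom C h; \<And>f. f \<in> set gs' \<Longrightarrow> null_arr C (f \<cdot> t)\<rbrakk>
        \<Longrightarrow> factors_through C t l" by blast
    have lA: "l \<in> Arr C" using l(1) by (rule mono_ArrD)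
    show ?thesis
    proof (cases "null_arr C (g \<cdot> l)")
      case True
      show ?thesis
        by (rule drop, rule factors_through_null[OF l(4) True]) (use lA l(2) gA in auto)
    next
      case False
      have egl: "epi_arr C (g \<cdot> l)"
        by (rule simple_epi) (use sg False lA l(2) gA in auto)
      obtain j where "short_exact C j (g \<cdot> l)" using short_exact_of_epi[OF egl] .
      note j = short_exactD[OF this]
      have jd: "Cod C j = Dom C l" using j lA l(2) gA by simp
      have "null_arr C (h \<cdot> (l \<cdot> j))"
      proof (rule Suc.prems(5))
        show "l \<cdot> j \<in> Arr C" "Cod C (l \<cdot> j) = Dom C h" using lA j(1) jd l(2) by auto
        fix f assume f: "f \<in> set gs"
        show "null_arr C (f \<cdot> (l \<cdot> j))"
        proof (cases "f = g")
          case True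
          then show ?thesis using j(6) gA lA l(2) j(1) jd by simp
        next
          case False
          then have f': "f \<in> set gs'" using f gs by simp
          have "null_arr C ((f \<cdot> l) \<cdot> j)"
            by (rule null_arr_Comp_left) (use l f' gs'A[OF f'] lA j(1) jd in auto)
          then show ?thesis using gs'A[OF f'] lA l(2) j(1) jd by simp
        qed
      qed
      then have "null_arr C ((h \<cdot> l) \<cdot> j)" using hA lA l(2) j(1) jd by simp
      then obtain v where v: "v \<in> Arr C" "Dom C v = Cod C g" "Cod C v = Cod C h"
        "v \<cdot> (g \<cdot> l) = h \<cdot> l"
        using cokernel_lift[OF j(8), of "h \<cdot> l"] hA lA l(2) gA jd by auto
      have "null_arr C (c \<cdot> v)"
      proof (cases "null_arr C v")
        case True
        then show ?thesis by (rule null_arr_Comp_right) (use sc cd v in auto)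
      next
        case False
        have "mono_arr C v" by (rule simple_mono) (use False sg v in auto)
        then have "factors_through C v s"
          using Suc.prems(4) v sg unfolding contains_simples_def by auto
        then show ?thesis by (rule factors_through_null) (use sc in auto)
      qed
      then have "null_arr C ((c \<cdot> v) \<cdot> (g \<cdot> l))"
        by (rule null_arr_Comp_left) (use v sc(2) cd lA l(2) gA in auto)
      moreover have "(c \<cdot> v) \<cdot> (g \<cdot> l) = c \<cdot> (h \<cdot> l)" using v sc(2) cd lA l(2) gA by simp
      moreover have "w \<cdot> (g \<cdot> l) = c \<cdot> (h \<cdot> l)"
        using Comp_rewrite[OF w(4), of l] w(1-3) lA l(2) gA hA sc(2) cd by simp
      ultimately have "null_arr C (w \<cdot> (g \<cdot> l))" by simp
      then have "null_arr C w" by (rule epi_null_arr[OF egl]) (use w lA l(2) gA in auto)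
      then have "null_arr C (w \<cdot> g)" by (rule null_arr_Comp_left) (use w gA in auto)
      then have "null_arr C (c \<cdot> h)" using w(4) by simp
      then obtain u where "u \<in> Arr C" "Dom C u = Dom C h" "Cod C u = Dom C s" "s \<cdot> u = h"
        using kernel_lift[OF sc(7) _ hA] cd by auto
      then show ?thesis by (rule factors_throughI)
    qed
  qed
qed

end

context artinian_category
begin

text \<open>
  Subobjects containing all simple subobjects are closed under intersection, so one of least
  length lies in every other one.
\<close>

lemma ex_socle:
  assumes "X \<in> Obj C"
  shows "\<exists>s. is_socle C X s"
proof -
  have "factors_through C t (Id C X)" if "t \<in> Arr C" "Cod C t = X" for t
    by (rule factors_throughI[of t]) (use that in auto)
  then have "contains_simples C X (Id C X)"
    unfolding contains_simples_def using assms Id_mono mono_ArrD by simp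
  then obtain s where s: "contains_simples C X s"
    and least: "\<And>s'. contains_simples C X s' \<Longrightarrow> obj_length C (Dom C s) \<le> obj_length C (Dom C s')"
    using ex_has_least_nat[of "contains_simples C X" _ "\<lambda>s. obj_length C (Dom C s)"] by blast
  have ms: "mono_arr C s" "Cod C s = X" using s by (auto simp: contains_simples_def)
  have sA: "s \<in> Arr C" using ms by (auto dest: mono_ArrD)
  have "factors_through C s s'" if s': "contains_simples C X s'" for s'
  proof -
    have ms': "mono_arr C s'" "Cod C s' = X" using s' by (auto simp: contains_simples_def)
    obtain c where "short_exact C s' c" using short_exact_of_mono[OF ms'(1)] .
    note c = short_exactD[OF this]
    have cs: "c \<cdot> s \<in> Arr C" "Dom C (c \<cdot> s) = Dom C s" using c(1-3) ms' ms sA by auto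
    obtain k where k: "is_kernel C k (c \<cdot> s)" using ex_kernel cs by blast
    note ka = kernel_Arr[OF k]
    have kd: "Cod C k = Dom C s" using ka cs by simp
    have "contains_simples C X (s \<cdot> k)"
      unfolding contains_simples_def
    proof (intro conjI allI impI)
      show "mono_arr C (s \<cdot> k)" using mono_Comp[OF ms(1) kernel_mono[OF k] kd] .
      show "Cod C (s \<cdot> k) = X" using ms sA ka(2) kd by simp
      fix t assume t: "mono_arr C t \<and> Cod C t = X \<and> simple_obj C (Dom C t)"
      then have tA: "t \<in> Arr C" by (auto dest: mono_ArrD)
      obtain u where u: "u \<in> Arr C" "Dom C u = Dom C t" "Cod C u = Dom C s" "s \<cdot> u = t"
        using s t unfolding contains_simples_def by (blast elim: factors_throughE)
      have "factors_through C t s'" using s' t unfolding contains_simples_def by blast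
      then have "null_arr C (c \<cdot> t)" by (rule factors_through_null) (use c in auto)
      then have n: "null_arr C ((c \<cdot> s) \<cdot> u)" using u c(1-3) ms' ms sA by simp
      obtain v where v: "v \<in> Arr C" "Dom C v = Dom C u" "Cod C v = Dom C k" "k \<cdot> v = u"
        using kernel_lift[OF k n u(1)] u cs by auto
      show "factors_through C t (s \<cdot> k)"
        by (rule factors_throughI[of v]) (use v u ka(2) kd sA in auto)
    qed
    from least[OF this] have "obj_length C (Cod C k) \<le> obj_length C (Dom C k)"
      using ka(2) kd sA by simp
    then have ik: "iso_arr C k" using obj_length_mono_iso kernel_mono[OF k] by blast
    have "null_arr C (c \<cdot> s)" using epi_null_arr[OF iso_imp_epi[OF ik] ka(4)] cs kd by simp
    then obtain u where "u \<in> Arr C" "Dom C u = Dom C s" "Cod C u = Dom C s'" "s' \<cdot> u = s"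
      using kernel_lift[OF c(7) _ sA] ms ms' c(3) by auto
    then show ?thesis by (rule factors_throughI)
  qed
  with s show ?thesis unfolding is_socle_def by blast
qed

lemma socle_series_mono:
  assumes "socle_series C X n s" "X \<in> Obj C"
  shows "mono_arr C s \<and> Cod C s = X"
  using assms(1)
proof (induction rule: socle_series.induct)
  case (zero Z s)
  then show ?case using zero_Dom_mono by (auto simp: Hom_iff)
next
  case (Suc n s q t c s')
  have "Cod C s' = Dom C (c \<cdot> q)" using kernel_Arr[OF Suc.hyps(5)] by simp
  also have "\<dots> = X"
    using cokernel_Arr[OF Suc.hyps(2)] cokernel_Arr[OF Suc.hyps(4)] Suc.IH Suc.hyps(3)
    by (simp add: is_socle_def contains_simples_def)
  finally show ?case using kernel_mono[OF Suc.hyps(5)] by blast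
qed

lemma ex_socle_series:
  assumes "X \<in> Obj C"
  shows "\<exists>s. socle_series C X n s"
proof (induction n)
  case 0
  obtain Z where "zero_obj C Z" using ex_zero_obj by blast
  then show ?case
    using socle_series.zero[of C Z "Zero C Z X" X] Zero_Hom zero_obj_Obj assms by blast
next
  case (Suc n)
  then obtain s where s: "socle_series C X n s" by blast
  then have m: "mono_arr C s" "Cod C s = X" using socle_series_mono assms by auto
  obtain q where q: "is_cokernel C q s" using ex_cokernel m mono_ArrD by blast
  note qa = cokernel_Arr[OF q]
  obtain t where t: "is_socle C (Cod C q) t" using ex_socle[OF Cod_Obj[OF qa(2)]] by blast
  then have tA: "t \<in> Arr C" "Cod C t = Cod C q"
    using mono_ArrD by (auto simp: is_socle_def contains_simples_def)
  obtain c where c: "is_cokernel C c t" using ex_cokernel tA by blast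
  note ca = cokernel_Arr[OF c]
  have "c \<cdot> q \<in> Arr C" using ca qa tA by simp
  then obtain s' where "is_kernel C s' (c \<cdot> q)" using ex_kernel by blast
  then show ?case using socle_series.Suc[OF s q t c] by blast
qed

text \<open>
  A zero object, which has no maximal subobject, is covered by allowing a zero quotient.
\<close>

lemma ex_maximal_subobject:
  assumes "E \<in> Obj C" "obj_length C E \<le> Suc n"
  shows "\<exists>i p. is_kernel C i p \<and> Dom C p = E \<and> (simple_obj C (Cod C p) \<or> zero_obj C (Cod C p)) \<and>
    obj_length C (Dom C i) \<le> n"
  using comp_factors[OF assms(1)]
proof (cases rule: composition_series.cases)
  case zero
  have i: "iso_arr C (Id C E)" by (rule iso_arrI[of _ "Id C E"]) (use assms in auto)
  from short_exactD(7)[OF short_exact_iso[OF i zero(2)]] zero assms(1) show ?thesis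
    by (intro exI[of _ "Id C E"] exI[of _ "Zero C E E"]) (simp add: obj_length_def)
next
  case (step Y Fs i p S)
  have "obj_length C (Dom C i) \<le> n"
    using obj_length_composition_series[OF step(2)] step(1,3) assms(2)
    by (simp add: obj_length_def Hom_iff)
  then show ?thesis
    using step(4,6) short_exactD(7)[OF step(5)] by (auto simp: Hom_iff)
qed

text \<open>
  If \<open>U\<close> embeds into a finite product of objects of length at most \<open>n\<close>, then every map
  \<open>t : U \<rightarrow> X\<close> lands in \<open>soc\<^sup>n X\<close>. Maximal subobjects of the factors cut out a subobject \<open>u\<close> of
  \<open>U\<close> with semisimple quotient to which the induction hypothesis applies; modulo \<open>soc\<^sup>n X\<close> the map
  \<open>t\<close> thus factors through a semisimple object.
\<close>

lemma factors_through_socle_series: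
  assumes "socle_series C X n s" "X \<in> Obj C" "t \<in> Arr C" "Cod C t = X"
    and "\<And>f. f \<in> set fs \<Longrightarrow> f \<in> Arr C \<and> Dom C f = Dom C t \<and> obj_length C (Cod C f) \<le> n"
    and "\<And>v. \<lbrakk>v \<in> Arr C; Cod C v = Dom C t; \<And>f. f \<in> set fs \<Longrightarrow> null_arr C (f \<cdot> v)\<rbrakk> \<Longrightarrow> null_arr C v"
  shows "factors_through C t s"
  using assms
proof (induction arbitrary: t fs rule: socle_series.induct)
  case (zero Z s)
  have "null_arr C (Id C (Dom C t))"
  proof (rule zero.prems(5))
    fix f assume f: "f \<in> set fs"
    then have "zero_obj C (Cod C f)" using zero.prems(4)[OF f] obj_length_eq_0 by simp
    then show "null_arr C (f \<cdot> Id C (Dom C t))"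
      using zero.prems(4)[OF f] null_arr_of_zero_Cod by simp
  qed (use zero in auto)
  from null_arr_Comp_right[OF this zero.prems(2)] have "null_arr C t" using zero by simp
  then show ?case by (rule null_factors_through) (use zero in \<open>auto simp: Hom_iff\<close>)
next
  case (Suc n s q r c s')
  note sm = socle_series_mono[OF Suc.hyps(1) Suc.prems(1)]
  note qa = cokernel_Arr[OF Suc.hyps(2)]
  note ca = cokernel_Arr[OF Suc.hyps(4)]
  note tA = Suc.prems(2,3)
  have rA: "contains_simples C (Cod C q) r" using Suc.hyps(3) by (simp add: is_socle_def)
  then have rd: "Cod C r = Cod C q" "r \<in> Arr C"
    using mono_ArrD by (auto simp: contains_simples_def)
  have qd: "Dom C q = X" "Dom C c = Cod C q" using qa sm ca rd by auto
  define cut where "cut E ip \<longleftrightarrow> is_kernel C (fst ip) (snd ip) \<and> Dom C (snd ip) = E \<and>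
    (simple_obj C (Cod C (snd ip)) \<or> zero_obj C (Cod C (snd ip))) \<and> obj_length C (Dom C (fst ip)) \<le> n"
    for E ip
  have "\<exists>ip. cut (Cod C f) ip" if "f \<in> set fs" for f
    using ex_maximal_subobject[of "Cod C f" n] Suc.prems(4)[OF that] unfolding cut_def by auto
  then obtain ip where ip: "\<And>f. f \<in> set fs \<Longrightarrow> cut (Cod C f) (ip f)" by metis
  define i where "i f = fst (ip f)" for f
  define p where "p f = snd (ip f)" for f
  have k: "is_kernel C (i f) (p f)" "Dom C (p f) = Cod C f"
    "simple_obj C (Cod C (p f)) \<or> zero_obj C (Cod C (p f))" "obj_length C (Dom C (i f)) \<le> n"
    if "f \<in> set fs" for f using ip[OF that] unfolding cut_def i_def p_def by auto
  let ?gs = "map (\<lambda>f. p f \<cdot> f) fs"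
  have gs: "g \<in> Arr C \<and> Dom C g = Dom C t \<and> (simple_obj C (Cod C g) \<or> zero_obj C (Cod C g))"
    if g: "g \<in> set ?gs" for g
  proof -
    obtain f where f: "f \<in> set fs" "g = p f \<cdot> f" using g by auto
    show ?thesis using k[OF f(1)] kernel_Arr[OF k(1)[OF f(1)]] Suc.prems(4)[OF f(1)] f(2) by simp
  qed
  have "\<exists>u. mono_arr C u \<and> Cod C u = Dom C t \<and> (\<forall>f\<in>set ?gs. null_arr C (f \<cdot> u)) \<and>
      (\<forall>v\<in>Arr C. Cod C v = Dom C t \<and> (\<forall>f\<in>set ?gs. null_arr C (f \<cdot> v)) \<longrightarrow> factors_through C v u)"
    by (rule joint_kernel) (use tA gs in auto)
  then obtain u where u: "mono_arr C u" "Cod C u = Dom C t"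
    "\<And>g. g \<in> set ?gs \<Longrightarrow> null_arr C (g \<cdot> u)"
    "\<And>v. \<lbrakk>v \<in> Arr C; Cod C v = Dom C t; \<And>g. g \<in> set ?gs \<Longrightarrow> null_arr C (g \<cdot> v)\<rbrakk>
      \<Longrightarrow> factors_through C v u" by blast
  have uA: "u \<in> Arr C" using u(1) by (rule mono_ArrD)
  have "\<exists>f'. f' \<in> Arr C \<and> Dom C f' = Dom C u \<and> Cod C f' = Dom C (i f) \<and> i f \<cdot> f' = f \<cdot> u"
    if f: "f \<in> set fs" for f
  proof -
    note ka = kernel_Arr[OF k(1)[OF f]]
    have "null_arr C ((p f \<cdot> f) \<cdot> u)" using u(3) f by simp
    then have "null_arr C (p f \<cdot> (f \<cdot> u))" using uA u(2) Suc.prems(4)[OF f] k(2)[OF f] ka by simp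
    then show ?thesis
      using kernel_lift[OF k(1)[OF f], of "f \<cdot> u"] uA u(2) Suc.prems(4)[OF f] k(2)[OF f] by auto
  qed
  then obtain F where F: "\<And>f. f \<in> set fs \<Longrightarrow> F f \<in> Arr C \<and> Dom C (F f) = Dom C u \<and>
      Cod C (F f) = Dom C (i f) \<and> i f \<cdot> F f = f \<cdot> u" by metis
  have "factors_through C (t \<cdot> u) s"
  proof (rule Suc.IH[of _ "map F fs"])
    show "X \<in> Obj C" "t \<cdot> u \<in> Arr C" "Cod C (t \<cdot> u) = X" using Suc.prems uA u by auto
    show "f \<in> Arr C \<and> Dom C f = Dom C (t \<cdot> u) \<and> obj_length C (Cod C f) \<le> n"
      if "f \<in> set (map F fs)" for f using that F k(4) tA uA u(2) by auto
    fix v assume v: "v \<in> Arr C" "Cod C v = Dom C (t \<cdot> u)"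
      and vn: "\<And>f. f \<in> set (map F fs) \<Longrightarrow> null_arr C (f \<cdot> v)"
    have vd: "Cod C v = Dom C u" using v(2) tA uA u(2) by simp
    have "null_arr C (u \<cdot> v)"
    proof (rule Suc.prems(5))
      fix f assume f: "f \<in> set fs"
      note Ff = F[OF f] and ka = kernel_Arr[OF k(1)[OF f]]
      have "null_arr C (i f \<cdot> (F f \<cdot> v))"
        by (rule null_arr_Comp_right[OF vn]) (use f Ff ka v(1) vd in auto)
      then show "null_arr C (f \<cdot> (u \<cdot> v))"
        using Comp_rewrite[of "i f" "F f" "f \<cdot> u" v] Ff ka v(1) vd uA u(2) Suc.prems(4)[OF f] by simp
    qed (use v(1) vd uA u in auto)
    then show "null_arr C v" by (rule mono_null_arr[OF u(1)]) (use v(1) vd in auto)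
  qed
  then have "null_arr C (q \<cdot> (t \<cdot> u))" by (rule factors_through_null) (use qa in auto)
  then have qtu: "null_arr C ((q \<cdot> t) \<cdot> u)" using qa(2) qd tA uA u(2) by simp
  have "factors_through C (q \<cdot> t) r"
  proof (rule semisimple_factors_through_socle[of ?gs, OF refl])
    show "q \<cdot> t \<in> Arr C" "contains_simples C (Cod C (q \<cdot> t)) r" using qa qd tA rA by auto
    show "g \<in> Arr C \<and> Dom C g = Dom C (q \<cdot> t) \<and> (simple_obj C (Cod C g) \<or> zero_obj C (Cod C g))"
      if "g \<in> set ?gs" for g using gs[OF that] qa qd tA by simp
    fix v assume v: "v \<in> Arr C" "Cod C v = Dom C (q \<cdot> t)"
      "\<And>g. g \<in> set ?gs \<Longrightarrow> null_arr C (g \<cdot> v)"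
    have "factors_through C v u" by (rule u(4)) (use v qa qd tA in auto)
    then show "null_arr C ((q \<cdot> t) \<cdot> v)"
      by (rule factors_through_null) (use qtu qa qd tA uA u(2) in auto)
  qed
  then have "null_arr C (c \<cdot> (q \<cdot> t))" by (rule factors_through_null) (use ca rd in auto)
  then have n: "null_arr C ((c \<cdot> q) \<cdot> t)" using ca(2) qa(2) qd tA by simp
  obtain w where "w \<in> Arr C" "Dom C w = Dom C t" "Cod C w = Dom C s'" "s' \<cdot> w = t"
    using kernel_lift[OF Suc.hyps(5) n tA(1)] tA ca(2) qa(2) qd by auto
  then show ?case by (rule factors_throughI)
qed

lemma loewy_length_le:
  assumes "X \<in> Obj C"
    and "\<And>f. f \<in> set fs \<Longrightarrow> f \<in> Arr C \<and> Dom C f = X \<and> obj_length C (Cod C f) \<le> N"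
    and "\<And>v. \<lbrakk>v \<in> Arr C; Cod C v = X; \<And>f. f \<in> set fs \<Longrightarrow> null_arr C (f \<cdot> v)\<rbrakk> \<Longrightarrow> null_arr C v"
  shows "loewy_length C X \<le> N"
proof -
  obtain s where s: "socle_series C X N s" using ex_socle_series assms(1) by blast
  note m = socle_series_mono[OF s assms(1)]
  have sA: "s \<in> Arr C" using m mono_ArrD by blast
  have "factors_through C (Id C X) s"
    by (rule factors_through_socle_series[OF s, of _ fs]) (use assms in auto)
  then obtain u where u: "u \<in> Arr C" "Dom C u = X" "Cod C u = Dom C s" "s \<cdot> u = Id C X"
    using assms(1) by (auto elim: factors_throughE)
  have "epi_arr C (s \<cdot> u)" using u Id_epi assms(1) by simp
  then have "epi_arr C s" using epi_of_Comp[OF _ sA u(1,3)] by blast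
  then have "iso_arr C s" using m mono_epi_iso by blast
  with s show ?thesis unfolding loewy_length_def by (intro Least_le) blast
qed

end

section \<open>Injective objects\<close>

context abelian_category
begin

lemma injective_extend:
  assumes "injective_obj C J" "mono_arr C m" "f \<in> Arr C" "Dom C f = Dom C m" "Cod C f = J"
  obtains g where "g \<in> Arr C" "Dom C g = Cod C m" "Cod C g = J" "g \<cdot> m = f"
proof -
  have "f \<in> Hom C (Dom C m) J" using assms by (simp add: Hom_iff)
  then have "\<exists>g\<in>Hom C (Cod C m) J. g \<cdot> m = f"
    using assms(1,2) unfolding injective_obj_def by blast
  then show ?thesis using that unfolding Hom_def by blast
qed

text \<open>
  The factor \<open>T\<close> is a quotient of a subobject of \<open>X\<close>; the composite from that subobject to \<open>J\<close>
  extends to \<open>X\<close>.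
\<close>

lemma nonzero_to_injective:
  assumes "composition_series C X Fs" "T \<in> set Fs" "injective_obj C J"
    and "f \<in> Arr C" "Dom C f = T" "Cod C f = J" "\<not> null_arr C f"
  shows "\<exists>g\<in>Arr C. Dom C g = X \<and> Cod C g = J \<and> \<not> null_arr C g"
  using assms(1,2)
proof (induction rule: composition_series.induct)
  case (step Y Fs i X p S)
  note ip = short_exactD[OF step.hyps(4)]
  have io: "Dom C i = Y" "Cod C i = X" "Dom C p = X" "Cod C p = S"
    using step.hyps(2,3) by (auto simp: Hom_iff)
  show ?case
  proof (cases "T = S")
    case True
    have "\<not> null_arr C (f \<cdot> p)" using epi_null_arr[OF ip(5), of f] assms True io by auto
    then show ?thesis using ip io assms True by (intro bexI[of _ "f \<cdot> p"]) auto
  next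
    case False
    then obtain g where g: "g \<in> Arr C" "Dom C g = Y" "Cod C g = J" "\<not> null_arr C g"
      using step.IH step.prems by auto
    obtain h where h: "h \<in> Arr C" "Dom C h = X" "Cod C h = J" "h \<cdot> i = g"
      using injective_extend[OF assms(3) ip(4) g(1)] g io by auto
    have "\<not> null_arr C h" using null_arr_Comp_left[of h i] g(4) h ip io by auto
    then show ?thesis using h by blast
  qed
qed simp

text \<open>
  An object embeds into the product of injective objects containing its composition factors, one
  for each factor: maps from a subobject \<open>Y\<close> extend to \<open>X\<close>, and \<open>X / Y\<close> needs one more map.
\<close>

lemma ex_joint_mono_to_injectives:
  assumes "\<And>S. simple_obj C S \<Longrightarrow> \<exists>m. mono_arr C m \<and> Dom C m = S \<and> injective_obj C (Cod C m) \<and> P (Cod C m)"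
    and "composition_series C X Fs"
  shows "\<exists>fs. (\<forall>f\<in>set fs. f \<in> Arr C \<and> Dom C f = X \<and> injective_obj C (Cod C f) \<and> P (Cod C f)) \<and>
    (\<forall>v\<in>Arr C. Cod C v = X \<and> (\<forall>f\<in>set fs. null_arr C (f \<cdot> v)) \<longrightarrow> null_arr C v)"
  using assms(2)
proof (induction rule: composition_series.induct)
  case (zero X)
  then show ?case using null_arr_of_zero_Cod by (intro exI[of _ "[]"]) auto
next
  case (step Y Fs i X p S)
  note ip = short_exactD[OF step.hyps(4)]
  have io: "Dom C i = Y" "Cod C i = X" "Dom C p = X" "Cod C p = S"
    using step.hyps(2,3) by (auto simp: Hom_iff)
  from step.IH obtain fs where
    fs: "\<And>f. f \<in> set fs \<Longrightarrow> f \<in> Arr C \<and> Dom C f = Y \<and> injective_obj C (Cod C f) \<and> P (Cod C f)"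
    "\<And>v. \<lbrakk>v \<in> Arr C; Cod C v = Y; \<And>f. f \<in> set fs \<Longrightarrow> null_arr C (f \<cdot> v)\<rbrakk> \<Longrightarrow> null_arr C v" by blast
  obtain m where m: "mono_arr C m" "Dom C m = S" "injective_obj C (Cod C m)" "P (Cod C m)"
    using assms(1) step.hyps(5) by blast
  have mA: "m \<in> Arr C" using m(1) by (rule mono_ArrD)
  have "\<exists>g. g \<in> Arr C \<and> Dom C g = X \<and> Cod C g = Cod C f \<and> g \<cdot> i = f" if "f \<in> set fs" for f
    using injective_extend[OF _ ip(4), of "Cod C f" f] fs(1)[OF that] io by metis
  then obtain G where G: "\<And>f. f \<in> set fs \<Longrightarrow>
    G f \<in> Arr C \<and> Dom C (G f) = X \<and> Cod C (G f) = Cod C f \<and> G f \<cdot> i = f" by metis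
  have "null_arr C v" if v: "v \<in> Arr C" "Cod C v = X"
    "\<And>f. f \<in> set ((m \<cdot> p) # map G fs) \<Longrightarrow> null_arr C (f \<cdot> v)" for v
  proof -
    have "null_arr C ((m \<cdot> p) \<cdot> v)" by (rule v(3)) simp
    then have "null_arr C (m \<cdot> (p \<cdot> v))" using v(1,2) ip(2) io m mA by simp
    then have "null_arr C (p \<cdot> v)" by (rule mono_null_arr[OF m(1)]) (use v(1,2) ip io m in auto)
    then obtain u where u: "u \<in> Arr C" "Dom C u = Dom C v" "Cod C u = Y" "i \<cdot> u = v"
      using kernel_lift[OF ip(7)] v io by metis
    have "null_arr C u"
    proof (rule fs(2))
      fix f assume f: "f \<in> set fs"
      have "null_arr C (G f \<cdot> v)" by (rule v(3)) (use f in simp)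
      then show "null_arr C (f \<cdot> u)"
        using Comp_rewrite[of "G f" i f u] G[OF f] u ip(1) io by simp
    qed (use u in auto)
    then have "null_arr C (i \<cdot> u)" by (rule null_arr_Comp_right) (use ip u io in auto)
    then show "null_arr C v" using u by simp
  qed
  then show ?case
    using fs(1) G m mA ip(2) io by (intro exI[of _ "(m \<cdot> p) # map G fs"]) auto
qed

end

context artinian_category
begin

text \<open>
  The object \<open>X\<close> embeds into a finite product of the given injective objects, and the Loewy length
  of a product is the largest one among its factors.
\<close>

lemma loewy_length_le_of_injectives:
  assumes "\<And>S. simple_obj C S \<Longrightarrow>
      \<exists>m. mono_arr C m \<and> Dom C m = S \<and> injective_obj C (Cod C m) \<and> obj_length C (Cod C m) \<le> N"
    and "X \<in> Obj C"
  shows "loewy_length C X \<le> N"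
proof -
  obtain fs where fs: "\<And>f. f \<in> set fs \<Longrightarrow>
      f \<in> Arr C \<and> Dom C f = X \<and> injective_obj C (Cod C f) \<and> obj_length C (Cod C f) \<le> N"
    "\<And>v. \<lbrakk>v \<in> Arr C; Cod C v = X; \<And>f. f \<in> set fs \<Longrightarrow> null_arr C (f \<cdot> v)\<rbrakk> \<Longrightarrow> null_arr C v"
    using ex_joint_mono_to_injectives[of "\<lambda>J. obj_length C J \<le> N", OF _ comp_factors[OF assms(2)]]
      assms(1) by blast
  show ?thesis by (rule loewy_length_le[of _ fs]) (use assms(2) fs in auto)
qed

end

section \<open>Duals and adjunctions\<close>

context category
begin

lemma inv_arr_square:
  assumes "iso_arr C a" "iso_arr C b" "b \<cdot> x = y \<cdot> a" "a \<in> Arr C" "b \<in> Arr C" "x \<in> Arr C" "y \<in> Arr C"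
    "Dom C x = Dom C a" "Dom C y = Cod C a" "Cod C x = Dom C b" "Cod C y = Cod C b"
  shows "inv_arr C b \<cdot> y = x \<cdot> inv_arr C a"
proof -
  have "inv_arr C b \<cdot> y = inv_arr C b \<cdot> ((y \<cdot> a) \<cdot> inv_arr C a)" using assms by simp
  also have "\<dots> = inv_arr C b \<cdot> ((b \<cdot> x) \<cdot> inv_arr C a)" using assms(3) by simp
  also have "\<dots> = x \<cdot> inv_arr C a" using assms(1,2,4-) by simp
  finally show ?thesis .
qed

end

context monoidal_category
begin

lemma TensO_in_Obj [simp]: "\<lbrakk>A \<in> Obj C; B \<in> Obj C\<rbrakk> \<Longrightarrow> A \<otimes> B \<in> Obj C"
  by (rule TensO_Obj)

lemma TensA_Arr [simp]:
  assumes "f \<in> Arr C" "g \<in> Arr C"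
  shows "f \<boxtimes> g \<in> Arr C" "Dom C (f \<boxtimes> g) = Dom C f \<otimes> Dom C g" "Cod C (f \<boxtimes> g) = Cod C f \<otimes> Cod C g"
  using TensA_Hom[of f "Dom C f" "Cod C f" g "Dom C g" "Cod C g"] assms by (auto simp: Hom_iff)

lemma TensA_Comp_Arr:
  assumes "f \<in> Arr C" "f' \<in> Arr C" "g \<in> Arr C" "g' \<in> Arr C" "Cod C f = Dom C f'" "Cod C g = Dom C g'"
  shows "(f' \<boxtimes> g') \<cdot> (f \<boxtimes> g) = (f' \<cdot> f) \<boxtimes> (g' \<cdot> g)"
  using TensA_Comp[of f "Dom C f" "Cod C f" f' "Cod C f'" g "Dom C g" "Cod C g" g' "Cod C g'"] assms
  by (simp add: Hom_iff)

lemmas [simp] = TensA_Id Unit_Obj Assoc_iso LUnit_iso RUnit_iso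

lemma Assoc_Arr [simp]:
  assumes "A \<in> Obj C" "B \<in> Obj C" "D \<in> Obj C"
  shows "Assoc C A B D \<in> Arr C" "Dom C (Assoc C A B D) = (A \<otimes> B) \<otimes> D"
    "Cod C (Assoc C A B D) = A \<otimes> (B \<otimes> D)"
  using Assoc_Hom[OF assms] by (auto simp: Hom_iff)

lemma LUnit_Arr [simp]:
  assumes "A \<in> Obj C"
  shows "LUnit C A \<in> Arr C" "Dom C (LUnit C A) = Unit C \<otimes> A" "Cod C (LUnit C A) = A"
  using LUnit_Hom[OF assms] by (auto simp: Hom_iff)

lemma RUnit_Arr [simp]:
  assumes "A \<in> Obj C"
  shows "RUnit C A \<in> Arr C" "Dom C (RUnit C A) = A \<otimes> Unit C" "Cod C (RUnit C A) = A"
  using RUnit_Hom[OF assms] by (auto simp: Hom_iff)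

lemma Assoc_natural_Arr:
  assumes "f \<in> Arr C" "g \<in> Arr C" "h \<in> Arr C"
  shows "Assoc C (Cod C f) (Cod C g) (Cod C h) \<cdot> ((f \<boxtimes> g) \<boxtimes> h)
    = (f \<boxtimes> (g \<boxtimes> h)) \<cdot> Assoc C (Dom C f) (Dom C g) (Dom C h)"
  using assms by (intro Assoc_natural) (auto simp: Hom_iff)

lemma TensA_iso:
  assumes "iso_arr C f" "f \<in> Arr C" "iso_arr C g" "g \<in> Arr C"
  shows "iso_arr C (f \<boxtimes> g)"
  by (rule iso_arrI[of _ "inv_arr C f \<boxtimes> inv_arr C g"]) (use assms in \<open>auto simp: TensA_Comp_Arr\<close>)

text \<open>
  Kelly's coherence law follows from the pentagon for \<open>A, B, \<one>, \<one>\<close> and the triangles at both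
  ends, since tensoring with \<open>\<one>\<close> is faithful.
\<close>

lemma RUnit_TensO:
  assumes A: "A \<in> Obj C" and B: "B \<in> Obj C"
  shows "RUnit C (A \<otimes> B) = (Id C A \<boxtimes> RUnit C B) \<cdot> Assoc C A B (Unit C)"
proof -
  let ?U = "Unit C" and ?a = "Assoc C"
  note [simp] = A B
  have "?a A B ?U \<cdot> (RUnit C (A \<otimes> B) \<boxtimes> Id C ?U)
      = ?a A B ?U \<cdot> ((Id C (A \<otimes> B) \<boxtimes> LUnit C ?U) \<cdot> ?a (A \<otimes> B) ?U ?U)"
    using triangle[of "A \<otimes> B" ?U] by simp
  also have "\<dots> = (?a A B ?U \<cdot> (Id C (A \<otimes> B) \<boxtimes> LUnit C ?U)) \<cdot> ?a (A \<otimes> B) ?U ?U" by simp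
  also have "?a A B ?U \<cdot> (Id C (A \<otimes> B) \<boxtimes> LUnit C ?U)
      = (Id C A \<boxtimes> (Id C B \<boxtimes> LUnit C ?U)) \<cdot> ?a A B (?U \<otimes> ?U)"
    using Assoc_natural_Arr[of "Id C A" "Id C B" "LUnit C ?U"] by simp
  also have "((Id C A \<boxtimes> (Id C B \<boxtimes> LUnit C ?U)) \<cdot> ?a A B (?U \<otimes> ?U)) \<cdot> ?a (A \<otimes> B) ?U ?U
      = (Id C A \<boxtimes> (Id C B \<boxtimes> LUnit C ?U)) \<cdot> (?a A B (?U \<otimes> ?U) \<cdot> ?a (A \<otimes> B) ?U ?U)" by simp
  also have "?a A B (?U \<otimes> ?U) \<cdot> ?a (A \<otimes> B) ?U ?U
      = (Id C A \<boxtimes> ?a B ?U ?U) \<cdot> ?a A (B \<otimes> ?U) ?U \<cdot> (?a A B ?U \<boxtimes> Id C ?U)"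
    using pentagon[of A B ?U ?U] by simp
  also have "(Id C A \<boxtimes> (Id C B \<boxtimes> LUnit C ?U)) \<cdot> \<dots>
      = ((Id C A \<boxtimes> (Id C B \<boxtimes> LUnit C ?U)) \<cdot> (Id C A \<boxtimes> ?a B ?U ?U)) \<cdot>
        ?a A (B \<otimes> ?U) ?U \<cdot> (?a A B ?U \<boxtimes> Id C ?U)" by simp
  also have "(Id C A \<boxtimes> (Id C B \<boxtimes> LUnit C ?U)) \<cdot> (Id C A \<boxtimes> ?a B ?U ?U)
      = Id C A \<boxtimes> (RUnit C B \<boxtimes> Id C ?U)"
    using triangle[of B ?U] by (simp add: TensA_Comp_Arr)
  also have "\<dots> \<cdot> ?a A (B \<otimes> ?U) ?U \<cdot> (?a A B ?U \<boxtimes> Id C ?U)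
      = (\<dots> \<cdot> ?a A (B \<otimes> ?U) ?U) \<cdot> (?a A B ?U \<boxtimes> Id C ?U)" by simp
  also have "(Id C A \<boxtimes> (RUnit C B \<boxtimes> Id C ?U)) \<cdot> ?a A (B \<otimes> ?U) ?U
      = ?a A B ?U \<cdot> ((Id C A \<boxtimes> RUnit C B) \<boxtimes> Id C ?U)"
    using Assoc_natural_Arr[of "Id C A" "RUnit C B" "Id C ?U"] by simp
  also have "\<dots> \<cdot> (?a A B ?U \<boxtimes> Id C ?U)
      = ?a A B ?U \<cdot> (((Id C A \<boxtimes> RUnit C B) \<cdot> ?a A B ?U) \<boxtimes> Id C ?U)"
    by (simp add: TensA_Comp_Arr)
  finally have "?a A B ?U \<cdot> (RUnit C (A \<otimes> B) \<boxtimes> Id C ?U)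
      = ?a A B ?U \<cdot> (((Id C A \<boxtimes> RUnit C B) \<cdot> ?a A B ?U) \<boxtimes> Id C ?U)" .
  from mono_cancel[OF iso_imp_mono[OF Assoc_iso] this]
  have eq: "RUnit C (A \<otimes> B) \<boxtimes> Id C ?U = ((Id C A \<boxtimes> RUnit C B) \<cdot> ?a A B ?U) \<boxtimes> Id C ?U" by simp
  have nat: "f \<cdot> RUnit C ((A \<otimes> B) \<otimes> ?U) = RUnit C (A \<otimes> B) \<cdot> (f \<boxtimes> Id C ?U)"
    if "f \<in> Arr C" "Dom C f = (A \<otimes> B) \<otimes> ?U" "Cod C f = A \<otimes> B" for f
    using RUnit_natural[of f "(A \<otimes> B) \<otimes> ?U" "A \<otimes> B"] that by (simp add: Hom_iff)
  have "RUnit C (A \<otimes> B) \<cdot> RUnit C ((A \<otimes> B) \<otimes> ?U)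
      = ((Id C A \<boxtimes> RUnit C B) \<cdot> ?a A B ?U) \<cdot> RUnit C ((A \<otimes> B) \<otimes> ?U)"
    by (subst (1 2) nat) (simp_all add: eq del: Comp_assoc_Arr)
  from epi_cancel[OF iso_imp_epi[OF RUnit_iso] this] show ?thesis by simp
qed

text \<open>
  The unit and the counit of the adjunction between \<open>- \<otimes> X\<close> and \<open>- \<otimes> D\<close>, for a left dual \<open>D\<close>
  of \<open>X\<close>, are tensor products with \<open>coev\<close> and \<open>ev\<close>; up to coherence, the triangle identities are the
  zigzag equations.
\<close>

lemma left_dual_adjunction:
  assumes "left_dual C X D"
  shows "\<exists>\<eta> \<epsilon>. (\<forall>A\<in>Obj C. \<eta> A \<in> Hom C A ((A \<otimes> X) \<otimes> D)) \<and> (\<forall>A\<in>Obj C. \<epsilon> A \<in> Hom C ((A \<otimes> D) \<otimes> X) A) \<and>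
    (\<forall>f\<in>Arr C. \<eta> (Cod C f) \<cdot> f = ((f \<boxtimes> Id C X) \<boxtimes> Id C D) \<cdot> \<eta> (Dom C f)) \<and>
    (\<forall>f\<in>Arr C. \<epsilon> (Cod C f) \<cdot> ((f \<boxtimes> Id C D) \<boxtimes> Id C X) = f \<cdot> \<epsilon> (Dom C f)) \<and>
    (\<forall>A\<in>Obj C. \<epsilon> (A \<otimes> X) \<cdot> (\<eta> A \<boxtimes> Id C X) = Id C (A \<otimes> X)) \<and>
    (\<forall>A\<in>Obj C. (\<epsilon> A \<boxtimes> Id C D) \<cdot> \<eta> (A \<otimes> D) = Id C (A \<otimes> D))"
proof -
  let ?U = "Unit C" and ?a = "Assoc C"
  from assms obtain ev coev where [simp]: "X \<in> Obj C" "D \<in> Obj C"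
    and e: "ev \<in> Hom C (D \<otimes> X) ?U" and c: "coev \<in> Hom C ?U (X \<otimes> D)"
    and z1: "RUnit C X \<cdot> (Id C X \<boxtimes> ev) \<cdot> ?a X D X \<cdot> (coev \<boxtimes> Id C X) = LUnit C X"
    and z2: "LUnit C D \<cdot> (ev \<boxtimes> Id C D) \<cdot> inv_arr C (?a D X D) \<cdot> (Id C D \<boxtimes> coev) = RUnit C D"
    unfolding left_dual_def by blast
  have [simp]: "ev \<in> Arr C" "Dom C ev = D \<otimes> X" "Cod C ev = ?U"
    "coev \<in> Arr C" "Dom C coev = ?U" "Cod C coev = X \<otimes> D" using e c by (auto simp: Hom_iff)
  define \<eta> where "\<eta> A = inv_arr C (?a A X D) \<cdot> (Id C A \<boxtimes> coev) \<cdot> inv_arr C (RUnit C A)" for A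
  define \<epsilon> where "\<epsilon> A = RUnit C A \<cdot> (Id C A \<boxtimes> ev) \<cdot> ?a A D X" for A
  have \<eta> [simp]: "\<eta> A \<in> Arr C" "Dom C (\<eta> A) = A" "Cod C (\<eta> A) = (A \<otimes> X) \<otimes> D" if "A \<in> Obj C" for A
    using that by (simp_all add: \<eta>_def)
  have \<epsilon> [simp]: "\<epsilon> A \<in> Arr C" "Dom C (\<epsilon> A) = (A \<otimes> D) \<otimes> X" "Cod C (\<epsilon> A) = A" if "A \<in> Obj C" for A
    using that by (simp_all add: \<epsilon>_def)
  have \<eta>_RUnit: "\<eta> A \<cdot> RUnit C A = inv_arr C (?a A X D) \<cdot> (Id C A \<boxtimes> coev)" if "A \<in> Obj C" for A
    using that by (simp add: \<eta>_def)
  have nat\<eta>: "\<eta> (Cod C f) \<cdot> f = ((f \<boxtimes> Id C X) \<boxtimes> Id C D) \<cdot> \<eta> (Dom C f)" if f [simp]: "f \<in> Arr C" for f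
  proof -
    let ?A = "Dom C f" and ?B = "Cod C f"
    have r: "inv_arr C (RUnit C ?B) \<cdot> f = (f \<boxtimes> Id C ?U) \<cdot> inv_arr C (RUnit C ?A)"
      using RUnit_natural[of f ?A ?B] by (intro inv_arr_square) (auto simp: Hom_iff)
    have a: "inv_arr C (?a ?B X D) \<cdot> (f \<boxtimes> Id C (X \<otimes> D))
        = ((f \<boxtimes> Id C X) \<boxtimes> Id C D) \<cdot> inv_arr C (?a ?A X D)"
      using Assoc_natural_Arr[of f "Id C X" "Id C D"] by (intro inv_arr_square) auto
    have m: "(Id C ?B \<boxtimes> coev) \<cdot> (f \<boxtimes> Id C ?U) = (f \<boxtimes> Id C (X \<otimes> D)) \<cdot> (Id C ?A \<boxtimes> coev)"
      by (simp add: TensA_Comp_Arr)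
    have "\<eta> ?B \<cdot> f = inv_arr C (?a ?B X D) \<cdot> (Id C ?B \<boxtimes> coev) \<cdot> (f \<boxtimes> Id C ?U) \<cdot> inv_arr C (RUnit C ?A)"
      by (simp add: \<eta>_def r)
    also have "\<dots> = inv_arr C (?a ?B X D) \<cdot> (f \<boxtimes> Id C (X \<otimes> D)) \<cdot> (Id C ?A \<boxtimes> coev) \<cdot> inv_arr C (RUnit C ?A)"
      by (simp add: Comp_rewrite[OF m] del: TensA_Id)
    also have "\<dots> = ((f \<boxtimes> Id C X) \<boxtimes> Id C D) \<cdot> \<eta> ?A"
      by (simp add: Comp_rewrite[OF a] \<eta>_def del: TensA_Id)
    finally show ?thesis .
  qed
  have nat\<epsilon>: "\<epsilon> (Cod C f) \<cdot> ((f \<boxtimes> Id C D) \<boxtimes> Id C X) = f \<cdot> \<epsilon> (Dom C f)" if f [simp]: "f \<in> Arr C" for f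
  proof -
    let ?A = "Dom C f" and ?B = "Cod C f"
    have r: "RUnit C ?B \<cdot> (f \<boxtimes> Id C ?U) = f \<cdot> RUnit C ?A"
      using RUnit_natural[of f ?A ?B] by (auto simp: Hom_iff)
    have a: "?a ?B D X \<cdot> ((f \<boxtimes> Id C D) \<boxtimes> Id C X) = (f \<boxtimes> Id C (D \<otimes> X)) \<cdot> ?a ?A D X"
      using Assoc_natural_Arr[of f "Id C D" "Id C X"] by simp
    have m: "(Id C ?B \<boxtimes> ev) \<cdot> (f \<boxtimes> Id C (D \<otimes> X)) = (f \<boxtimes> Id C ?U) \<cdot> (Id C ?A \<boxtimes> ev)"
      by (simp add: TensA_Comp_Arr)
    have "\<epsilon> ?B \<cdot> ((f \<boxtimes> Id C D) \<boxtimes> Id C X)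
        = RUnit C ?B \<cdot> (Id C ?B \<boxtimes> ev) \<cdot> (f \<boxtimes> Id C (D \<otimes> X)) \<cdot> ?a ?A D X"
      by (simp add: \<epsilon>_def a)
    also have "\<dots> = RUnit C ?B \<cdot> (f \<boxtimes> Id C ?U) \<cdot> (Id C ?A \<boxtimes> ev) \<cdot> ?a ?A D X"
      by (simp add: Comp_rewrite[OF m])
    also have "\<dots> = f \<cdot> \<epsilon> ?A" by (simp add: Comp_rewrite[OF r] \<epsilon>_def)
    finally show ?thesis .
  qed
  have tri1: "\<epsilon> (A \<otimes> X) \<cdot> (\<eta> A \<boxtimes> Id C X) = Id C (A \<otimes> X)" if A [simp]: "A \<in> Obj C" for A
  proof -
    let ?K = "(Id C A \<boxtimes> coev) \<boxtimes> Id C X"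
    have "(\<eta> A \<boxtimes> Id C X) \<cdot> (RUnit C A \<boxtimes> Id C X) = (inv_arr C (?a A X D) \<boxtimes> Id C X) \<cdot> ?K"
      using \<eta>_RUnit[of A] by (simp add: TensA_Comp_Arr)
    then have "(\<epsilon> (A \<otimes> X) \<cdot> (\<eta> A \<boxtimes> Id C X)) \<cdot> (RUnit C A \<boxtimes> Id C X)
        = RUnit C (A \<otimes> X) \<cdot> (Id C (A \<otimes> X) \<boxtimes> ev) \<cdot> ?a (A \<otimes> X) D X \<cdot> (inv_arr C (?a A X D) \<boxtimes> Id C X) \<cdot> ?K"
      by (simp add: \<epsilon>_def)
    also have "\<dots> = (Id C A \<boxtimes> RUnit C X) \<cdot> (?a A X ?U \<cdot> (Id C (A \<otimes> X) \<boxtimes> ev)) \<cdot>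
        ?a (A \<otimes> X) D X \<cdot> (inv_arr C (?a A X D) \<boxtimes> Id C X) \<cdot> ?K"
      by (simp add: RUnit_TensO)
    also have "?a A X ?U \<cdot> (Id C (A \<otimes> X) \<boxtimes> ev) = (Id C A \<boxtimes> (Id C X \<boxtimes> ev)) \<cdot> ?a A X (D \<otimes> X)"
      using Assoc_natural_Arr[of "Id C A" "Id C X" ev] by simp
    also have "(Id C A \<boxtimes> RUnit C X) \<cdot> ((Id C A \<boxtimes> (Id C X \<boxtimes> ev)) \<cdot> ?a A X (D \<otimes> X)) \<cdot>
        ?a (A \<otimes> X) D X \<cdot> (inv_arr C (?a A X D) \<boxtimes> Id C X) \<cdot> ?K
      = (Id C A \<boxtimes> RUnit C X) \<cdot> (Id C A \<boxtimes> (Id C X \<boxtimes> ev)) \<cdot> (?a A X (D \<otimes> X) \<cdot>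
        ?a (A \<otimes> X) D X) \<cdot> (inv_arr C (?a A X D) \<boxtimes> Id C X) \<cdot> ?K" by simp
    also have "?a A X (D \<otimes> X) \<cdot> ?a (A \<otimes> X) D X
      = (Id C A \<boxtimes> ?a X D X) \<cdot> ?a A (X \<otimes> D) X \<cdot> (?a A X D \<boxtimes> Id C X)"
      using pentagon[of A X D X] by simp
    also have "(Id C A \<boxtimes> RUnit C X) \<cdot> (Id C A \<boxtimes> (Id C X \<boxtimes> ev)) \<cdot> \<dots> \<cdot> (inv_arr C (?a A X D) \<boxtimes> Id C X) \<cdot> ?K
      = (Id C A \<boxtimes> RUnit C X) \<cdot> (Id C A \<boxtimes> (Id C X \<boxtimes> ev)) \<cdot> (Id C A \<boxtimes> ?a X D X) \<cdot> ?a A (X \<otimes> D) X \<cdot>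
        ((?a A X D \<boxtimes> Id C X) \<cdot> (inv_arr C (?a A X D) \<boxtimes> Id C X)) \<cdot> ?K" by simp
    also have "(?a A X D \<boxtimes> Id C X) \<cdot> (inv_arr C (?a A X D) \<boxtimes> Id C X) = Id C ((A \<otimes> (X \<otimes> D)) \<otimes> X)"
      by (simp add: TensA_Comp_Arr)
    also have "(Id C A \<boxtimes> RUnit C X) \<cdot> (Id C A \<boxtimes> (Id C X \<boxtimes> ev)) \<cdot> (Id C A \<boxtimes> ?a X D X) \<cdot>
        ?a A (X \<otimes> D) X \<cdot> Id C ((A \<otimes> (X \<otimes> D)) \<otimes> X) \<cdot> ?K
      = (Id C A \<boxtimes> RUnit C X) \<cdot> (Id C A \<boxtimes> (Id C X \<boxtimes> ev)) \<cdot> (Id C A \<boxtimes> ?a X D X) \<cdot>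
        (?a A (X \<otimes> D) X \<cdot> ?K)" by simp
    also have "?a A (X \<otimes> D) X \<cdot> ?K = (Id C A \<boxtimes> (coev \<boxtimes> Id C X)) \<cdot> ?a A ?U X"
      using Assoc_natural_Arr[of "Id C A" coev "Id C X"] by simp
    also have "(Id C A \<boxtimes> RUnit C X) \<cdot> (Id C A \<boxtimes> (Id C X \<boxtimes> ev)) \<cdot> (Id C A \<boxtimes> ?a X D X) \<cdot> \<dots>
      = ((Id C A \<boxtimes> RUnit C X) \<cdot> (Id C A \<boxtimes> (Id C X \<boxtimes> ev)) \<cdot> (Id C A \<boxtimes> ?a X D X) \<cdot>
        (Id C A \<boxtimes> (coev \<boxtimes> Id C X))) \<cdot> ?a A ?U X" by simp
    also have "(Id C A \<boxtimes> RUnit C X) \<cdot> (Id C A \<boxtimes> (Id C X \<boxtimes> ev)) \<cdot> (Id C A \<boxtimes> ?a X D X) \<cdot>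
        (Id C A \<boxtimes> (coev \<boxtimes> Id C X)) = Id C A \<boxtimes> LUnit C X"
      using z1 by (simp add: TensA_Comp_Arr)
    also have "\<dots> \<cdot> ?a A ?U X = Id C (A \<otimes> X) \<cdot> (RUnit C A \<boxtimes> Id C X)" using triangle[of A X] by simp
    finally have "(\<epsilon> (A \<otimes> X) \<cdot> (\<eta> A \<boxtimes> Id C X)) \<cdot> (RUnit C A \<boxtimes> Id C X)
      = Id C (A \<otimes> X) \<cdot> (RUnit C A \<boxtimes> Id C X)" .
    moreover have "iso_arr C (Id C X)" by (rule iso_arrI[of _ "Id C X"]) auto
    then have "epi_arr C (RUnit C A \<boxtimes> Id C X)" by (intro iso_imp_epi TensA_iso) auto
    ultimately show ?thesis by (rule_tac epi_cancel) auto
  qed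
  have tri2: "(\<epsilon> A \<boxtimes> Id C D) \<cdot> \<eta> (A \<otimes> D) = Id C (A \<otimes> D)" if A [simp]: "A \<in> Obj C" for A
  proof -
    let ?i = "\<lambda>A B D. inv_arr C (?a A B D)"
    have p: "(?a A D X \<boxtimes> Id C D) \<cdot> ?i (A \<otimes> D) X D
      = ?i A (D \<otimes> X) D \<cdot> (Id C A \<boxtimes> ?i D X D) \<cdot> ?a A D (X \<otimes> D)"
    proof -
      let ?P = "(Id C A \<boxtimes> ?a D X D) \<cdot> ?a A (D \<otimes> X) D"
      have c: "?i A (D \<otimes> X) D \<cdot> (Id C A \<boxtimes> ?i D X D) \<cdot> ?P = Id C ((A \<otimes> (D \<otimes> X)) \<otimes> D)"
      proof -
        have e: "(Id C A \<boxtimes> ?i D X D) \<cdot> (Id C A \<boxtimes> ?a D X D) = Id C (A \<otimes> ((D \<otimes> X) \<otimes> D))"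
          by (simp add: TensA_Comp_Arr)
        show ?thesis by (simp add: Comp_rewrite[OF e])
      qed
      have "(?a A D X \<boxtimes> Id C D) \<cdot> ?i (A \<otimes> D) X D
        = (?i A (D \<otimes> X) D \<cdot> (Id C A \<boxtimes> ?i D X D) \<cdot> ?P) \<cdot> (?a A D X \<boxtimes> Id C D) \<cdot> ?i (A \<otimes> D) X D"
        by (subst c) simp
      also have "\<dots> = ?i A (D \<otimes> X) D \<cdot> (Id C A \<boxtimes> ?i D X D) \<cdot>
          ((Id C A \<boxtimes> ?a D X D) \<cdot> ?a A (D \<otimes> X) D \<cdot> (?a A D X \<boxtimes> Id C D)) \<cdot> ?i (A \<otimes> D) X D" by simp
      also have "\<dots> = ?i A (D \<otimes> X) D \<cdot> (Id C A \<boxtimes> ?i D X D) \<cdot>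
          (?a A D (X \<otimes> D) \<cdot> ?a (A \<otimes> D) X D) \<cdot> ?i (A \<otimes> D) X D" by (subst pentagon) simp_all
      also have "\<dots> = ?i A (D \<otimes> X) D \<cdot> (Id C A \<boxtimes> ?i D X D) \<cdot> ?a A D (X \<otimes> D)" by simp
      finally show ?thesis .
    qed
    have n1: "((Id C A \<boxtimes> ev) \<boxtimes> Id C D) \<cdot> ?i A (D \<otimes> X) D = ?i A ?U D \<cdot> (Id C A \<boxtimes> (ev \<boxtimes> Id C D))"
      using Assoc_natural_Arr[of "Id C A" ev "Id C D"] by (intro inv_arr_square[symmetric]) auto
    have n2: "?a A D (X \<otimes> D) \<cdot> (Id C (A \<otimes> D) \<boxtimes> coev) = (Id C A \<boxtimes> (Id C D \<boxtimes> coev)) \<cdot> ?a A D ?U"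
      using Assoc_natural_Arr[of "Id C A" "Id C D" coev] by simp
    have t: "(RUnit C A \<boxtimes> Id C D) \<cdot> ?i A ?U D = Id C A \<boxtimes> LUnit C D"
      by (subst triangle[symmetric]) simp_all
    have z: "(Id C A \<boxtimes> LUnit C D) \<cdot> (Id C A \<boxtimes> (ev \<boxtimes> Id C D)) \<cdot> (Id C A \<boxtimes> ?i D X D) \<cdot>
        (Id C A \<boxtimes> (Id C D \<boxtimes> coev)) = Id C A \<boxtimes> RUnit C D"
      using z2 by (simp add: TensA_Comp_Arr)
    have "(\<epsilon> A \<boxtimes> Id C D) = (RUnit C A \<boxtimes> Id C D) \<cdot> ((Id C A \<boxtimes> ev) \<boxtimes> Id C D) \<cdot> (?a A D X \<boxtimes> Id C D)"
      by (simp add: \<epsilon>_def TensA_Comp_Arr)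
    then have "((\<epsilon> A \<boxtimes> Id C D) \<cdot> \<eta> (A \<otimes> D)) \<cdot> RUnit C (A \<otimes> D)
      = (RUnit C A \<boxtimes> Id C D) \<cdot> ((Id C A \<boxtimes> ev) \<boxtimes> Id C D) \<cdot>
        ((?a A D X \<boxtimes> Id C D) \<cdot> ?i (A \<otimes> D) X D) \<cdot> (Id C (A \<otimes> D) \<boxtimes> coev)"
      by (simp add: \<eta>_RUnit)
    also have "\<dots> = (RUnit C A \<boxtimes> Id C D) \<cdot> (((Id C A \<boxtimes> ev) \<boxtimes> Id C D) \<cdot> ?i A (D \<otimes> X) D) \<cdot>
        (Id C A \<boxtimes> ?i D X D) \<cdot> (?a A D (X \<otimes> D) \<cdot> (Id C (A \<otimes> D) \<boxtimes> coev))"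
      by (subst p) simp
    also have "\<dots> = ((RUnit C A \<boxtimes> Id C D) \<cdot> ?i A ?U D) \<cdot> (Id C A \<boxtimes> (ev \<boxtimes> Id C D)) \<cdot>
        (Id C A \<boxtimes> ?i D X D) \<cdot> (Id C A \<boxtimes> (Id C D \<boxtimes> coev)) \<cdot> ?a A D ?U"
      by (subst n1, subst n2) simp
    also have "\<dots> = ((Id C A \<boxtimes> LUnit C D) \<cdot> (Id C A \<boxtimes> (ev \<boxtimes> Id C D)) \<cdot>
        (Id C A \<boxtimes> ?i D X D) \<cdot> (Id C A \<boxtimes> (Id C D \<boxtimes> coev))) \<cdot> ?a A D ?U"
      by (subst t) simp
    also have "\<dots> = Id C (A \<otimes> D) \<cdot> RUnit C (A \<otimes> D)" by (subst z) (simp add: RUnit_TensO)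
    finally have "((\<epsilon> A \<boxtimes> Id C D) \<cdot> \<eta> (A \<otimes> D)) \<cdot> RUnit C (A \<otimes> D)
      = Id C (A \<otimes> D) \<cdot> RUnit C (A \<otimes> D)" .
    from epi_cancel[OF iso_imp_epi[OF RUnit_iso] this] show ?thesis by simp
  qed
  show ?thesis
    using \<eta> \<epsilon> nat\<eta> nat\<epsilon> tri1 tri2
    by (intro exI[of _ \<eta>] exI[of _ \<epsilon>]) (auto simp: Hom_iff)
qed

end

text \<open>
  Reversing the tensor product exchanges left and right duals, so that tensoring on the left
  needs no separate treatment.
\<close>

definition reversed :: "('o, 'm, 'k, 'z) moncat_scheme \<Rightarrow> ('o, 'm, 'k, 'z) moncat_scheme" where
  "reversed C = C\<lparr>TensO := \<lambda>A B. TensO C B A, TensA := \<lambda>f g. TensA C g f,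
     Assoc := \<lambda>A B D. inv_arr C (Assoc C D B A), LUnit := RUnit C, RUnit := LUnit C\<rparr>"

lemma reversed_simps [simp]:
  "Obj (reversed C) = Obj C" "Arr (reversed C) = Arr C" "Dom (reversed C) = Dom C"
  "Cod (reversed C) = Cod C" "Id (reversed C) = Id C" "Comp (reversed C) = Comp C"
  "TensO (reversed C) A B = TensO C B A" "TensA (reversed C) f g = TensA C g f"
  "Unit (reversed C) = Unit C" "Assoc (reversed C) A B D = inv_arr C (Assoc C D B A)"
  "LUnit (reversed C) = RUnit C" "RUnit (reversed C) = LUnit C"
  by (simp_all add: reversed_def)

lemma reversed_arrows [simp]:
  "Hom (reversed C) = Hom C" "iso_arr (reversed C) = iso_arr C" "inv_arr (reversed C) = inv_arr C"
  by (auto simp: fun_eq_iff Hom_def iso_arr_def inv_arr_def inverse_arrs_def)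

context monoidal_category
begin

lemma reversed_monoidal: "monoidal_category (reversed C)"
proof
  fix A B D F assume o: "A \<in> Obj (reversed C)" "B \<in> Obj (reversed C)" "D \<in> Obj (reversed C)"
    "F \<in> Obj (reversed C)"
  let ?a = "Assoc C" and ?i = "\<lambda>A B D. inv_arr C (Assoc C A B D)"
  from o have [simp]: "A \<in> Obj C" "B \<in> Obj C" "D \<in> Obj C" "F \<in> Obj C" by simp_all
  have e1: "(?a F D B \<boxtimes> Id C A) \<cdot> (?i F D B \<boxtimes> Id C A) = Id C ((F \<otimes> (D \<otimes> B)) \<otimes> A)"
    "(Id C F \<boxtimes> ?a D B A) \<cdot> (Id C F \<boxtimes> ?i D B A) = Id C (F \<otimes> (D \<otimes> (B \<otimes> A)))"
    by (simp_all add: TensA_Comp_Arr)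
  let ?L = "(?i F D B \<boxtimes> Id C A) \<cdot> ?i F (D \<otimes> B) A \<cdot> (Id C F \<boxtimes> ?i D B A)"
  let ?R = "?i (F \<otimes> D) B A \<cdot> ?i F D (B \<otimes> A)"
  have "(?a F D (B \<otimes> A) \<cdot> ?a (F \<otimes> D) B A) \<cdot> ?L
    = ((Id C F \<boxtimes> ?a D B A) \<cdot> ?a F (D \<otimes> B) A \<cdot> (?a F D B \<boxtimes> Id C A)) \<cdot> ?L"
    by (subst pentagon[symmetric]) simp_all
  also have "\<dots> = (Id C F \<boxtimes> ?a D B A) \<cdot> ?a F (D \<otimes> B) A \<cdot> ?i F (D \<otimes> B) A \<cdot> (Id C F \<boxtimes> ?i D B A)"
    by (simp add: Comp_rewrite[OF e1(1)])
  also have "\<dots> = Id C (F \<otimes> (D \<otimes> (B \<otimes> A)))" by (simp add: e1(2))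
  also have "\<dots> = (?a F D (B \<otimes> A) \<cdot> ?a (F \<otimes> D) B A) \<cdot> ?R" by simp
  finally have "(?a F D (B \<otimes> A) \<cdot> ?a (F \<otimes> D) B A) \<cdot> ?L = (?a F D (B \<otimes> A) \<cdot> ?a (F \<otimes> D) B A) \<cdot> ?R" .
  moreover have "mono_arr C (?a F D (B \<otimes> A) \<cdot> ?a (F \<otimes> D) B A)"
    by (rule mono_Comp) (simp_all add: iso_imp_mono)
  ultimately have "?L = ?R" by (rule_tac mono_cancel) auto
  then show "Id (reversed C) A \<boxtimes>\<^bsub>reversed C\<^esub> Assoc (reversed C) B D F \<cdot>\<^bsub>reversed C\<^esub>
      Assoc (reversed C) A (B \<otimes>\<^bsub>reversed C\<^esub> D) F \<cdot>\<^bsub>reversed C\<^esub> (Assoc (reversed C) A B D \<boxtimes>\<^bsub>reversed C\<^esub> Id (reversed C) F)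
    = Assoc (reversed C) A B (D \<otimes>\<^bsub>reversed C\<^esub> F) \<cdot>\<^bsub>reversed C\<^esub> Assoc (reversed C) (A \<otimes>\<^bsub>reversed C\<^esub> B) D F"
    by simp
next
  fix A B assume "A \<in> Obj (reversed C)" "B \<in> Obj (reversed C)"
  then have [simp]: "A \<in> Obj C" "B \<in> Obj C" by simp_all
  have "(RUnit C B \<boxtimes> Id C A) \<cdot> inv_arr C (Assoc C B (Unit C) A) = Id C B \<boxtimes> LUnit C A"
    by (subst triangle[symmetric]) simp_all
  then show "Id (reversed C) A \<boxtimes>\<^bsub>reversed C\<^esub> LUnit (reversed C) B \<cdot>\<^bsub>reversed C\<^esub> Assoc (reversed C) A (Unit (reversed C)) B
    = RUnit (reversed C) A \<boxtimes>\<^bsub>reversed C\<^esub> Id (reversed C) B" by simp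
next
  fix f A A' g B B' h D D'
  assume "f \<in> Hom (reversed C) A A'" "g \<in> Hom (reversed C) B B'" "h \<in> Hom (reversed C) D D'"
  then have [simp]: "f \<in> Arr C" "Dom C f = A" "Cod C f = A'" "g \<in> Arr C" "Dom C g = B" "Cod C g = B'"
    "h \<in> Arr C" "Dom C h = D" "Cod C h = D'" by (auto simp: Hom_iff)
  have [simp]: "A \<in> Obj C" "A' \<in> Obj C" "B \<in> Obj C" "B' \<in> Obj C" "D \<in> Obj C" "D' \<in> Obj C"
    using Dom_Obj[of f] Cod_Obj[of f] Dom_Obj[of g] Cod_Obj[of g] Dom_Obj[of h] Cod_Obj[of h]
    by (simp_all del: Dom_Obj Cod_Obj)
  have "inv_arr C (Assoc C D' B' A') \<cdot> (h \<boxtimes> (g \<boxtimes> f)) = ((h \<boxtimes> g) \<boxtimes> f) \<cdot> inv_arr C (Assoc C D B A)"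
    using Assoc_natural_Arr[of h g f] by (intro inv_arr_square) auto
  then show "Assoc (reversed C) A' B' D' \<cdot>\<^bsub>reversed C\<^esub> ((f \<boxtimes>\<^bsub>reversed C\<^esub> g) \<boxtimes>\<^bsub>reversed C\<^esub> h)
    = f \<boxtimes>\<^bsub>reversed C\<^esub> (g \<boxtimes>\<^bsub>reversed C\<^esub> h) \<cdot>\<^bsub>reversed C\<^esub> Assoc (reversed C) A B D" by simp
qed (auto simp: Hom_iff TensA_Comp_Arr LUnit_natural RUnit_natural iso_inv_arr)

lemma reversed_left_dual:
  assumes "left_dual C X D"
  shows "left_dual (reversed C) D X"
proof -
  have "X \<in> Obj C" "D \<in> Obj C" using assms by (auto simp: left_dual_def)
  then have "inv_arr C (inv_arr C (Assoc C X D X)) = Assoc C X D X" by (intro inv_arr_inv_arr) auto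
  then show ?thesis using assms unfolding left_dual_def by auto
qed

end

text \<open>
  \<open>F\<close> is left adjoint to \<open>G\<close>. The adjunct of \<open>f : F0 A \<rightarrow> B\<close> is \<open>G f \<cdot> unit A\<close>, called sharp below, and
  that of \<open>g : A \<rightarrow> G0 B\<close> is \<open>counit B \<cdot> F g\<close>, called flat.
\<close>

locale adjoint_endofunctors = abelian_category C
  for C :: "('o, 'm, 'k::field, 'z) lincat_scheme" (structure) +
  fixes F :: "'m \<Rightarrow> 'm" and F0 :: "'o \<Rightarrow> 'o" and G :: "'m \<Rightarrow> 'm" and G0 :: "'o \<Rightarrow> 'o"
    and unit :: "'o \<Rightarrow> 'm" and counit :: "'o \<Rightarrow> 'm"
  assumes F_Arr [simp]: "f \<in> Arr C \<Longrightarrow> F f \<in> Arr C" "f \<in> Arr C \<Longrightarrow> Dom C (F f) = F0 (Dom C f)"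
      "f \<in> Arr C \<Longrightarrow> Cod C (F f) = F0 (Cod C f)" "A \<in> Obj C \<Longrightarrow> F0 A \<in> Obj C"
    and G_Arr [simp]: "f \<in> Arr C \<Longrightarrow> G f \<in> Arr C" "f \<in> Arr C \<Longrightarrow> Dom C (G f) = G0 (Dom C f)"
      "f \<in> Arr C \<Longrightarrow> Cod C (G f) = G0 (Cod C f)" "A \<in> Obj C \<Longrightarrow> G0 A \<in> Obj C"
    and F_Comp: "\<lbrakk>f \<in> Arr C; g \<in> Arr C; Cod C f = Dom C g\<rbrakk> \<Longrightarrow> F (g \<cdot> f) = F g \<cdot> F f"
    and G_Comp: "\<lbrakk>f \<in> Arr C; g \<in> Arr C; Cod C f = Dom C g\<rbrakk> \<Longrightarrow> G (g \<cdot> f) = G g \<cdot> G f"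
    and F_null: "null_arr C f \<Longrightarrow> null_arr C (F f)"
    and G_null: "null_arr C f \<Longrightarrow> null_arr C (G f)"
    and unit_Arr [simp]: "A \<in> Obj C \<Longrightarrow> unit A \<in> Arr C" "A \<in> Obj C \<Longrightarrow> Dom C (unit A) = A"
      "A \<in> Obj C \<Longrightarrow> Cod C (unit A) = G0 (F0 A)"
    and counit_Arr [simp]: "A \<in> Obj C \<Longrightarrow> counit A \<in> Arr C" "A \<in> Obj C \<Longrightarrow> Dom C (counit A) = F0 (G0 A)"
      "A \<in> Obj C \<Longrightarrow> Cod C (counit A) = A"
    and unit_natural: "f \<in> Arr C \<Longrightarrow> unit (Cod C f) \<cdot> f = G (F f) \<cdot> unit (Dom C f)"
    and counit_natural: "f \<in> Arr C \<Longrightarrow> counit (Cod C f) \<cdot> F (G f) = f \<cdot> counit (Dom C f)"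
    and counit_F_unit: "A \<in> Obj C \<Longrightarrow> counit (F0 A) \<cdot> F (unit A) = Id C (F0 A)"
    and G_counit_unit: "A \<in> Obj C \<Longrightarrow> G (counit A) \<cdot> unit (G0 A) = Id C (G0 A)"
begin

lemma flat_sharp:
  assumes "f \<in> Arr C" "Dom C f = F0 A" "A \<in> Obj C"
  shows "counit (Cod C f) \<cdot> F (G f \<cdot> unit A) = f"
proof -
  have "counit (Cod C f) \<cdot> F (G f \<cdot> unit A) = (counit (Cod C f) \<cdot> F (G f)) \<cdot> F (unit A)"
    using assms by (simp add: F_Comp)
  also have "\<dots> = f \<cdot> (counit (F0 A) \<cdot> F (unit A))" using assms by (simp add: counit_natural)
  also have "\<dots> = f" using assms by (simp add: counit_F_unit)
  finally show ?thesis .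
qed

lemma sharp_flat:
  assumes "g \<in> Arr C" "Cod C g = G0 B" "B \<in> Obj C"
  shows "G (counit B \<cdot> F g) \<cdot> unit (Dom C g) = g"
proof -
  have "G (counit B \<cdot> F g) \<cdot> unit (Dom C g) = G (counit B) \<cdot> (G (F g) \<cdot> unit (Dom C g))"
    using assms by (simp add: G_Comp)
  also have "\<dots> = (G (counit B) \<cdot> unit (G0 B)) \<cdot> g"
    using assms unit_natural[OF assms(1)] by simp
  also have "\<dots> = g" using assms by (simp add: G_counit_unit)
  finally show ?thesis .
qed

lemma sharp_nonzero:
  assumes "f \<in> Arr C" "Dom C f = F0 A" "A \<in> Obj C" "\<not> null_arr C f"
  shows "\<not> null_arr C (G f \<cdot> unit A)"
proof
  assume "null_arr C (G f \<cdot> unit A)"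
  then have "null_arr C (counit (Cod C f) \<cdot> F (G f \<cdot> unit A))"
    by (rule null_arr_Comp_right[OF F_null]) (use assms in auto)
  then show False using flat_sharp assms by simp
qed

lemma flat_nonzero:
  assumes "g \<in> Arr C" "Cod C g = G0 B" "B \<in> Obj C" "\<not> null_arr C g"
  shows "\<not> null_arr C (counit B \<cdot> F g)"
proof
  assume "null_arr C (counit B \<cdot> F g)"
  then have "null_arr C (G (counit B \<cdot> F g) \<cdot> unit (Dom C g))"
    by (rule null_arr_Comp_left[OF G_null]) (use assms in auto)
  then show False using sharp_flat assms by simp
qed

lemma flat_Comp:
  assumes "m \<in> Arr C" "h \<in> Arr C" "Cod C h = G0 (Dom C m)"
  shows "counit (Cod C m) \<cdot> F (G m \<cdot> h) = m \<cdot> (counit (Dom C m) \<cdot> F h)"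
proof -
  have "counit (Cod C m) \<cdot> F (G m \<cdot> h) = (counit (Cod C m) \<cdot> F (G m)) \<cdot> F h"
    using assms by (simp add: F_Comp)
  also have "\<dots> = m \<cdot> (counit (Dom C m) \<cdot> F h)" using assms by (simp add: counit_natural)
  finally show ?thesis .
qed

lemma sharp_Comp:
  assumes "e \<in> Arr C" "h \<in> Arr C" "Dom C h = F0 (Cod C e)"
  shows "G (h \<cdot> F e) \<cdot> unit (Dom C e) = (G h \<cdot> unit (Cod C e)) \<cdot> e"
  using assms unit_natural[OF assms(1)] by (simp add: G_Comp)

lemma G_mono:
  assumes "mono_arr C m"
  shows "mono_arr C (G m)"
proof (rule mono_null_arrI)
  have m: "m \<in> Arr C" using assms by (rule mono_ArrD)
  then show "G m \<in> Arr C" by simp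
  fix h assume h: "h \<in> Arr C" "Cod C h = Dom C (G m)" "null_arr C (G m \<cdot> h)"
  have hd: "Cod C h = G0 (Dom C m)" using h m by simp
  have "null_arr C (counit (Cod C m) \<cdot> F (G m \<cdot> h))"
    by (rule null_arr_Comp_right[OF F_null[OF h(3)]]) (use m h hd in auto)
  then have "null_arr C (m \<cdot> (counit (Dom C m) \<cdot> F h))" using flat_Comp m h hd by simp
  then have "null_arr C (counit (Dom C m) \<cdot> F h)"
    by (rule mono_null_arr[OF assms]) (use m h hd in auto)
  then show "null_arr C h" using flat_nonzero[OF h(1) hd] m by auto
qed

lemma F_epi:
  assumes "epi_arr C e"
  shows "epi_arr C (F e)"
proof (rule epi_null_arrI)
  have e: "e \<in> Arr C" using assms by (rule epi_ArrD)
  then show "F e \<in> Arr C" by simp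
  fix h assume h: "h \<in> Arr C" "Dom C h = Cod C (F e)" "null_arr C (h \<cdot> F e)"
  have hd: "Dom C h = F0 (Cod C e)" using h e by simp
  have "null_arr C (G (h \<cdot> F e) \<cdot> unit (Dom C e))"
    by (rule null_arr_Comp_left[OF G_null[OF h(3)]]) (use e h hd in auto)
  then have "null_arr C ((G h \<cdot> unit (Cod C e)) \<cdot> e)" using sharp_Comp e h hd by simp
  then have "null_arr C (G h \<cdot> unit (Cod C e))"
    by (rule epi_null_arr[OF assms]) (use e h hd in auto)
  then show "null_arr C h" using sharp_nonzero[OF h(1) hd] e by auto
qed

lemma G_kernel:
  assumes "is_kernel C k f"
  shows "is_kernel C (G k) (G f)"
proof (rule is_kernelI[OF G_mono[OF kernel_mono[OF assms]]])
  note k = kernel_Arr[OF assms]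
  show "G f \<in> Arr C" "Cod C (G k) = Dom C (G f)" using k by auto
  show "null_arr C (G f \<cdot> G k)" using G_null[OF k(4)] k by (simp add: G_Comp)
  fix h assume h: "h \<in> Arr C" "Cod C h = Dom C (G f)" "null_arr C (G f \<cdot> h)"
  have hd: "Cod C h = G0 (Dom C f)" using h k by simp
  have "null_arr C (counit (Cod C f) \<cdot> F (G f \<cdot> h))"
    by (rule null_arr_Comp_right[OF F_null[OF h(3)]]) (use k h hd in auto)
  then have "null_arr C (f \<cdot> (counit (Dom C f) \<cdot> F h))" using flat_Comp k h hd by simp
  then obtain u where u: "u \<in> Arr C" "Dom C u = F0 (Dom C h)" "Cod C u = Dom C k"
    "k \<cdot> u = counit (Dom C f) \<cdot> F h"
    using kernel_lift[OF assms, of "counit (Dom C f) \<cdot> F h"] k h hd by auto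
  have "G k \<cdot> (G u \<cdot> unit (Dom C h)) = G (k \<cdot> u) \<cdot> unit (Dom C h)"
    using u(1-3) k(2) h(1) by (simp add: G_Comp)
  also have "\<dots> = h" using u(4) sharp_flat h hd k by simp
  finally show "\<exists>u\<in>Arr C. Dom C u = Dom C h \<and> Cod C u = Dom C (G k) \<and> G k \<cdot> u = h"
    using u(1-3) k(2) h(1) by (intro bexI[of _ "G u \<cdot> unit (Dom C h)"]) auto
qed

lemma F_cokernel:
  assumes "is_cokernel C c f"
  shows "is_cokernel C (F c) (F f)"
proof (rule is_cokernelI[OF F_epi[OF cokernel_epi[OF assms]]])
  note c = cokernel_Arr[OF assms]
  show "F f \<in> Arr C" "Dom C (F c) = Cod C (F f)" using c by auto
  show "null_arr C (F c \<cdot> F f)" using F_null[OF c(4)] c by (simp add: F_Comp)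
  fix h assume h: "h \<in> Arr C" "Dom C h = Cod C (F f)" "null_arr C (h \<cdot> F f)"
  have hd: "Dom C h = F0 (Cod C f)" using h c by simp
  have "null_arr C (G (h \<cdot> F f) \<cdot> unit (Dom C f))"
    by (rule null_arr_Comp_left[OF G_null[OF h(3)]]) (use c h hd in auto)
  then have n: "null_arr C ((G h \<cdot> unit (Cod C f)) \<cdot> f)" using sharp_Comp c h hd by simp
  obtain u where u: "u \<in> Arr C" "Dom C u = Cod C c" "Cod C u = G0 (Cod C h)"
    "u \<cdot> c = G h \<cdot> unit (Cod C f)"
    using cokernel_lift[OF assms n] c h hd by auto
  have "(counit (Cod C h) \<cdot> F u) \<cdot> F c = counit (Cod C h) \<cdot> F (u \<cdot> c)"
    using u(1-3) c(2) h(1) by (simp add: F_Comp)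
  also have "\<dots> = h" using u(4) flat_sharp h hd c by simp
  finally show "\<exists>u\<in>Arr C. Dom C u = Cod C (F c) \<and> Cod C u = Cod C h \<and> u \<cdot> F c = h"
    using u(1-3) c(2) h(1) by (intro bexI[of _ "counit (Cod C h) \<cdot> F u"]) auto
qed

lemma G_injective:
  assumes "\<And>m. mono_arr C m \<Longrightarrow> mono_arr C (F m)" "injective_obj C J"
  shows "injective_obj C (G0 J)"
  unfolding injective_obj_def
proof (intro conjI allI impI)
  have J: "J \<in> Obj C" using assms by (simp add: injective_obj_def)
  then show "G0 J \<in> Obj C" by simp
  fix m f assume mf: "mono_arr C m \<and> f \<in> Hom C (Dom C m) (G0 J)"
  then have m: "m \<in> Arr C" "mono_arr C m" and f: "f \<in> Arr C" "Dom C f = Dom C m" "Cod C f = G0 J"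
    by (auto simp: Hom_iff dest: mono_ArrD)
  obtain g where g: "g \<in> Arr C" "Dom C g = F0 (Cod C m)" "Cod C g = J" "g \<cdot> F m = counit J \<cdot> F f"
    using injective_extend[OF assms(2) assms(1)[OF m(2)], of "counit J \<cdot> F f"] f m J by auto
  have "(G g \<cdot> unit (Cod C m)) \<cdot> m = G (g \<cdot> F m) \<cdot> unit (Dom C m)"
    using sharp_Comp[OF m(1) g(1,2)] by simp
  also have "\<dots> = f" using g(4) sharp_flat f J by metis
  finally show "\<exists>g\<in>Hom C (Cod C m) (G0 J). g \<cdot> m = f"
    using g(1-3) m by (intro bexI[of _ "G g \<cdot> unit (Cod C m)"]) (auto simp: Hom_iff)
qed

end

section \<open>Exactness of the tensor product\<close>

context tensor_category
begin

lemma TensA_null_left: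
  assumes "null_arr C f" "g \<in> Arr C"
  shows "null_arr C (f \<boxtimes> g)"
proof -
  have f: "f \<in> Hom C (Dom C f) (Cod C f)" and g: "g \<in> Hom C (Dom C g) (Cod C g)"
    using assms by (auto simp: null_arr_def Hom_iff)
  have "Scale C 0 f = f" using Scale_zero[OF f] assms(1) by (metis null_arr_def)
  then have "f \<boxtimes> g = Scale C 0 (f \<boxtimes> g)" using TensA_Scale_left[OF f g, of 0] by simp
  also have "\<dots> = Zero C (Dom C f \<otimes> Dom C g) (Cod C f \<otimes> Cod C g)"
    by (rule Scale_zero[OF TensA_Hom[OF f g]])
  finally show ?thesis using f g by (auto simp: Hom_iff)
qed

lemma TensA_null_right:
  assumes "null_arr C g" "f \<in> Arr C"
  shows "null_arr C (f \<boxtimes> g)"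
proof -
  have f: "f \<in> Hom C (Dom C f) (Cod C f)" and g: "g \<in> Hom C (Dom C g) (Cod C g)"
    using assms by (auto simp: null_arr_def Hom_iff)
  have "Scale C 0 g = g" using Scale_zero[OF g] assms(1) by (metis null_arr_def)
  then have "f \<boxtimes> g = Scale C 0 (f \<boxtimes> g)" using TensA_Scale_right[OF f g, of 0] by simp
  also have "\<dots> = Zero C (Dom C f \<otimes> Dom C g) (Cod C f \<otimes> Cod C g)"
    by (rule Scale_zero[OF TensA_Hom[OF f g]])
  finally show ?thesis using f g by (auto simp: Hom_iff)
qed

lemma tensor_right_adjunction:
  assumes "left_dual C X D"
  shows "\<exists>\<eta> \<epsilon>. adjoint_endofunctors C (\<lambda>f. f \<boxtimes> Id C X) (\<lambda>A. A \<otimes> X) (\<lambda>f. f \<boxtimes> Id C D) (\<lambda>A. A \<otimes> D) \<eta> \<epsilon>"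
proof -
  have [simp]: "X \<in> Obj C" "D \<in> Obj C" using assms by (auto simp: left_dual_def)
  from left_dual_adjunction[OF assms] obtain \<eta> \<epsilon> where
    u: "\<And>A. A \<in> Obj C \<Longrightarrow> \<eta> A \<in> Hom C A ((A \<otimes> X) \<otimes> D)"
    "\<And>A. A \<in> Obj C \<Longrightarrow> \<epsilon> A \<in> Hom C ((A \<otimes> D) \<otimes> X) A"
    "\<And>f. f \<in> Arr C \<Longrightarrow> \<eta> (Cod C f) \<cdot> f = ((f \<boxtimes> Id C X) \<boxtimes> Id C D) \<cdot> \<eta> (Dom C f)"
    "\<And>f. f \<in> Arr C \<Longrightarrow> \<epsilon> (Cod C f) \<cdot> ((f \<boxtimes> Id C D) \<boxtimes> Id C X) = f \<cdot> \<epsilon> (Dom C f)"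
    "\<And>A. A \<in> Obj C \<Longrightarrow> \<epsilon> (A \<otimes> X) \<cdot> (\<eta> A \<boxtimes> Id C X) = Id C (A \<otimes> X)"
    "\<And>A. A \<in> Obj C \<Longrightarrow> (\<epsilon> A \<boxtimes> Id C D) \<cdot> \<eta> (A \<otimes> D) = Id C (A \<otimes> D)" by blast
  have "adjoint_endofunctors C (\<lambda>f. f \<boxtimes> Id C X) (\<lambda>A. A \<otimes> X) (\<lambda>f. f \<boxtimes> Id C D) (\<lambda>A. A \<otimes> D) \<eta> \<epsilon>"
    by unfold_locales (use u in \<open>auto simp: Hom_iff TensA_Comp_Arr TensA_null_left\<close>)
  then show ?thesis by blast
qed

lemma tensor_left_adjunction:
  assumes "left_dual C X D"
  shows "\<exists>\<eta> \<epsilon>. adjoint_endofunctors C (\<lambda>f. Id C D \<boxtimes> f) (\<lambda>A. D \<otimes> A) (\<lambda>f. Id C X \<boxtimes> f) (\<lambda>A. X \<otimes> A) \<eta> \<epsilon>"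
proof -
  have [simp]: "X \<in> Obj C" "D \<in> Obj C" using assms by (auto simp: left_dual_def)
  from monoidal_category.left_dual_adjunction[OF reversed_monoidal reversed_left_dual[OF assms],
    unfolded reversed_simps reversed_arrows]
  obtain \<eta> \<epsilon> where
    u: "\<And>A. A \<in> Obj C \<Longrightarrow> \<eta> A \<in> Hom C A (X \<otimes> (D \<otimes> A))"
    "\<And>A. A \<in> Obj C \<Longrightarrow> \<epsilon> A \<in> Hom C (D \<otimes> (X \<otimes> A)) A"
    "\<And>f. f \<in> Arr C \<Longrightarrow> \<eta> (Cod C f) \<cdot> f = (Id C X \<boxtimes> (Id C D \<boxtimes> f)) \<cdot> \<eta> (Dom C f)"
    "\<And>f. f \<in> Arr C \<Longrightarrow> \<epsilon> (Cod C f) \<cdot> (Id C D \<boxtimes> (Id C X \<boxtimes> f)) = f \<cdot> \<epsilon> (Dom C f)"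
    "\<And>A. A \<in> Obj C \<Longrightarrow> \<epsilon> (D \<otimes> A) \<cdot> (Id C D \<boxtimes> \<eta> A) = Id C (D \<otimes> A)"
    "\<And>A. A \<in> Obj C \<Longrightarrow> (Id C X \<boxtimes> \<epsilon> A) \<cdot> \<eta> (X \<otimes> A) = Id C (X \<otimes> A)" by blast
  have "adjoint_endofunctors C (\<lambda>f. Id C D \<boxtimes> f) (\<lambda>A. D \<otimes> A) (\<lambda>f. Id C X \<boxtimes> f) (\<lambda>A. X \<otimes> A) \<eta> \<epsilon>"
    by unfold_locales (use u in \<open>auto simp: Hom_iff TensA_Comp_Arr TensA_null_right\<close>)
  then show ?thesis by blast
qed

text \<open>
  As \<open>X\<close> has a left and a right dual, tensoring with \<open>X\<close> is a right and a left adjoint.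
\<close>

lemma tensor_right_exact:
  assumes "X \<in> Obj C" "short_exact C i p"
  shows "short_exact C (i \<boxtimes> Id C X) (p \<boxtimes> Id C X)"
proof -
  obtain D where "left_dual C X D" using ex_left_dual assms by blast
  from tensor_right_adjunction[OF this] obtain \<eta> \<epsilon> where
    a: "adjoint_endofunctors C (\<lambda>f. f \<boxtimes> Id C X) (\<lambda>A. A \<otimes> X) (\<lambda>f. f \<boxtimes> Id C D) (\<lambda>A. A \<otimes> D) \<eta> \<epsilon>"
    by blast
  obtain D' where "left_dual C D' X" using ex_right_dual assms by blast
  from tensor_right_adjunction[OF this] obtain \<eta>' \<epsilon>' where
    b: "adjoint_endofunctors C (\<lambda>f. f \<boxtimes> Id C D') (\<lambda>A. A \<otimes> D') (\<lambda>f. f \<boxtimes> Id C X) (\<lambda>A. A \<otimes> X) \<eta>' \<epsilon>'"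
    by blast
  show ?thesis
    using assms(2) adjoint_endofunctors.F_cokernel[OF a] adjoint_endofunctors.G_kernel[OF b]
    unfolding short_exact_def by blast
qed

lemma tensor_left_exact:
  assumes "X \<in> Obj C" "short_exact C i p"
  shows "short_exact C (Id C X \<boxtimes> i) (Id C X \<boxtimes> p)"
proof -
  obtain D where "left_dual C X D" using ex_left_dual assms by blast
  from tensor_left_adjunction[OF this] obtain \<eta> \<epsilon> where
    a: "adjoint_endofunctors C (\<lambda>f. Id C D \<boxtimes> f) (\<lambda>A. D \<otimes> A) (\<lambda>f. Id C X \<boxtimes> f) (\<lambda>A. X \<otimes> A) \<eta> \<epsilon>"
    by blast
  obtain D' where "left_dual C D' X" using ex_right_dual assms by blast
  from tensor_left_adjunction[OF this] obtain \<eta>' \<epsilon>' where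
    b: "adjoint_endofunctors C (\<lambda>f. Id C X \<boxtimes> f) (\<lambda>A. X \<otimes> A) (\<lambda>f. Id C D' \<boxtimes> f) (\<lambda>A. D' \<otimes> A) \<eta>' \<epsilon>'"
    by blast
  show ?thesis
    using assms(2) adjoint_endofunctors.F_cokernel[OF b] adjoint_endofunctors.G_kernel[OF a]
    unfolding short_exact_def by blast
qed

lemma tensor_left_mono:
  assumes "X \<in> Obj C" "mono_arr C m"
  shows "mono_arr C (Id C X \<boxtimes> m)"
proof -
  obtain c where "short_exact C m c" using short_exact_of_mono[OF assms(2)] .
  then show ?thesis using tensor_left_exact[OF assms(1)] short_exactD(4) by blast
qed

text \<open>
  Tensoring with \<open>X\<close> is right adjoint to a functor that preserves monomorphisms.
\<close>

lemma tensor_left_injective: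
  assumes "X \<in> Obj C" "injective_obj C J"
  shows "injective_obj C (X \<otimes> J)"
proof -
  obtain D where D: "left_dual C X D" using ex_left_dual assms by blast
  then have "D \<in> Obj C" by (simp add: left_dual_def)
  from tensor_left_adjunction[OF D] obtain \<eta> \<epsilon> where
    a: "adjoint_endofunctors C (\<lambda>f. Id C D \<boxtimes> f) (\<lambda>A. D \<otimes> A) (\<lambda>f. Id C X \<boxtimes> f) (\<lambda>A. X \<otimes> A) \<eta> \<epsilon>"
    by blast
  show ?thesis
    using adjoint_endofunctors.G_injective[OF a _ assms(2)] tensor_left_mono[OF \<open>D \<in> Obj C\<close>] by blast
qed

lemma nonzero_adjoint_right:
  assumes "left_dual C X D" "f \<in> Arr C" "Dom C f = A \<otimes> X" "A \<in> Obj C" "\<not> null_arr C f"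
  shows "\<exists>g\<in>Arr C. Dom C g = A \<and> Cod C g = Cod C f \<otimes> D \<and> \<not> null_arr C g"
proof -
  have "X \<in> Obj C" "D \<in> Obj C" using assms(1) by (auto simp: left_dual_def)
  from tensor_right_adjunction[OF assms(1)] obtain \<eta> \<epsilon> where
    "adjoint_endofunctors C (\<lambda>f. f \<boxtimes> Id C X) (\<lambda>A. A \<otimes> X) (\<lambda>f. f \<boxtimes> Id C D) (\<lambda>A. A \<otimes> D) \<eta> \<epsilon>" by blast
  then interpret adj: adjoint_endofunctors C "\<lambda>f. f \<boxtimes> Id C X" "\<lambda>A. A \<otimes> X" "\<lambda>f. f \<boxtimes> Id C D" "\<lambda>A. A \<otimes> D" \<eta> \<epsilon> .
  show ?thesis
    using adj.sharp_nonzero[OF assms(2-5)] assms(2-4) adj.unit_Arr[OF assms(4)] \<open>D \<in> Obj C\<close>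
    by (intro bexI[of _ "(f \<boxtimes> Id C D) \<cdot> \<eta> A"]) auto
qed

lemma nonzero_adjoint_left:
  assumes "left_dual C X D" "f \<in> Arr C" "Dom C f = D \<otimes> A" "A \<in> Obj C" "\<not> null_arr C f"
  shows "\<exists>g\<in>Arr C. Dom C g = A \<and> Cod C g = X \<otimes> Cod C f \<and> \<not> null_arr C g"
proof -
  have "X \<in> Obj C" "D \<in> Obj C" using assms(1) by (auto simp: left_dual_def)
  from tensor_left_adjunction[OF assms(1)] obtain \<eta> \<epsilon> where
    "adjoint_endofunctors C (\<lambda>f. Id C D \<boxtimes> f) (\<lambda>A. D \<otimes> A) (\<lambda>f. Id C X \<boxtimes> f) (\<lambda>A. X \<otimes> A) \<eta> \<epsilon>" by blast
  then interpret adj: adjoint_endofunctors C "\<lambda>f. Id C D \<boxtimes> f" "\<lambda>A. D \<otimes> A" "\<lambda>f. Id C X \<boxtimes> f" "\<lambda>A. X \<otimes> A" \<eta> \<epsilon> .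
  show ?thesis
    using adj.sharp_nonzero[OF assms(2-5)] assms(2-4) adj.unit_Arr[OF assms(4)] \<open>X \<in> Obj C\<close>
    by (intro bexI[of _ "(Id C X \<boxtimes> f) \<cdot> \<eta> A"]) auto
qed

lemma additive_tensor_right:
  assumes "additive \<phi>" "X \<in> Obj C"
  shows "additive (\<lambda>A. \<phi> (A \<otimes> X))"
  unfolding additive_def
proof (intro allI impI)
  fix i p assume ip: "short_exact C i p"
  note d = short_exactD[OF ip]
  show "\<phi> (Dom C p \<otimes> X) = \<phi> (Dom C i \<otimes> X) + \<phi> (Cod C p \<otimes> X)"
    using assms(1) tensor_right_exact[OF assms(2) ip] d assms(2) unfolding additive_def by fastforce
qed

lemma additive_tensor_left:
  assumes "additive \<phi>" "X \<in> Obj C"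
  shows "additive (\<lambda>A. \<phi> (X \<otimes> A))"
  unfolding additive_def
proof (intro allI impI)
  fix i p assume ip: "short_exact C i p"
  note d = short_exactD[OF ip]
  show "\<phi> (X \<otimes> Dom C p) = \<phi> (X \<otimes> Dom C i) + \<phi> (X \<otimes> Cod C p)"
    using assms(1) tensor_left_exact[OF assms(2) ip] d assms(2) unfolding additive_def by fastforce
qed

lemma isomorphic_Assoc:
  "\<lbrakk>A \<in> Obj C; B \<in> Obj C; D \<in> Obj C\<rbrakk> \<Longrightarrow> isomorphic C ((A \<otimes> B) \<otimes> D) (A \<otimes> (B \<otimes> D))"
  using isomorphicI[OF Assoc_iso] by simp

lemma isomorphic_RUnit: "A \<in> Obj C \<Longrightarrow> isomorphic C (A \<otimes> Unit C) A"
  using isomorphicI[OF RUnit_iso] by simp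

lemma tensor_power_Obj [simp]: "Y \<in> Obj C \<Longrightarrow> tensor_power C Y n \<in> Obj C"
  by (induction n) auto

section \<open>Multiplicities in tensor products\<close>

lemma embedding_into_tensor:
  assumes "mono_arr C e" "Dom C e = Unit C" "A \<in> Obj C"
  shows "\<exists>m. mono_arr C m \<and> Dom C m = A \<and> Cod C m = A \<otimes> Cod C e"
proof -
  have e: "e \<in> Arr C" using assms(1) by (rule mono_ArrD)
  have "mono_arr C ((Id C A \<boxtimes> e) \<cdot> inv_arr C (RUnit C A))"
    by (rule mono_Comp[OF tensor_left_mono iso_imp_mono[OF iso_inv_arr]]) (use assms e in auto)
  then show ?thesis using assms e by (intro exI[of _ "(Id C A \<boxtimes> e) \<cdot> inv_arr C (RUnit C A)"]) auto
qed

text \<open>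
  Each composition factor \<open>T\<close> of \<open>S \<otimes> X\<close> embeds into the injective object \<open>T \<otimes> E\<close>, so there is a
  nonzero map \<open>S \<otimes> X \<rightarrow> T \<otimes> E\<close>. By duality it gives an embedding of \<open>S\<close> into
  \<open>T \<otimes> E \<otimes> X\<^sup>*\<close>, so every \<open>T\<close> contributes a factor \<open>S\<close> to \<open>S \<otimes> X \<otimes> E \<otimes> X\<^sup>*\<close>.
\<close>

lemma length_tensor_le_multiplicity:
  assumes e: "mono_arr C e" "Dom C e = Unit C" "Cod C e = E" "injective_obj C E"
    and S: "simple_obj C S" and XD: "left_dual C X D"
  shows "obj_length C (S \<otimes> X) \<le> multiplicity_in C (S \<otimes> (X \<otimes> E \<otimes> D)) S"
proof -
  have [simp]: "S \<in> Obj C" "X \<in> Obj C" "D \<in> Obj C" "E \<in> Obj C"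
    using S XD e(4) by (auto simp: simple_obj_def left_dual_def injective_obj_def)
  define \<phi> where "\<phi> A = multiplicity_in C (A \<otimes> E \<otimes> D) S" for A
  have add: "additive \<phi>"
    unfolding \<phi>_def
    by (rule additive_tensor_right[of "\<lambda>A. multiplicity_in C (A \<otimes> D) S" E],
        rule additive_tensor_right) (simp_all add: multiplicity_in_additive)
  have ge: "1 \<le> \<phi> T" if T: "T \<in> set (comp_factors C (S \<otimes> X))" for T
  proof -
    have cs: "composition_series C (S \<otimes> X) (comp_factors C (S \<otimes> X))" by (rule comp_factors) simp
    have sT: "simple_obj C T" using composition_series_simple[OF cs T] .
    then have [simp]: "T \<in> Obj C" by (simp add: simple_obj_def)
    obtain m where m: "mono_arr C m" "Dom C m = T" "Cod C m = T \<otimes> E"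
      using embedding_into_tensor[OF e(1,2), of T] e(3) by auto
    have "\<not> null_arr C m"
      using zero_Dom_of_null_mono[OF m(1)] m(2) sT by (auto simp: simple_obj_def)
    then obtain g where g: "g \<in> Arr C" "Dom C g = S \<otimes> X" "Cod C g = T \<otimes> E" "\<not> null_arr C g"
      using nonzero_to_injective[OF cs T tensor_left_injective[OF _ e(4), of T] mono_ArrD[OF m(1)] m(2,3)]
      by auto
    obtain h where h: "h \<in> Arr C" "Dom C h = S" "Cod C h = T \<otimes> E \<otimes> D" "\<not> null_arr C h"
      using nonzero_adjoint_right[OF XD g(1,2) _ g(4)] g(3) by auto
    have "mono_arr C h" by (rule simple_mono) (use h S in auto)
    from multiplicity_in_simple_subobject[OF this] show ?thesis using h S by (simp add: \<phi>_def)
  qed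
  have "obj_length C (S \<otimes> X) = sum_list (map (\<lambda>_. 1) (comp_factors C (S \<otimes> X)))"
    by (simp add: obj_length_def sum_list_triv)
  also have "\<dots> \<le> sum_list (map \<phi> (comp_factors C (S \<otimes> X)))"
    by (rule sum_list_mono) (rule ge)
  also have "\<dots> = \<phi> (S \<otimes> X)" using additive_comp_factors[OF add] by simp
  also have "\<dots> = multiplicity_in C (S \<otimes> (X \<otimes> E \<otimes> D)) S"
  proof -
    have "multiplicity_in C (S \<otimes> X \<otimes> E \<otimes> D) S = multiplicity_in C (S \<otimes> (X \<otimes> E) \<otimes> D) S"
      by (rule additive_isomorphic[OF additive_tensor_right[OF multiplicity_in_additive]])
        (simp_all add: isomorphic_Assoc)
    also have "\<dots> = multiplicity_in C (S \<otimes> (X \<otimes> E \<otimes> D)) S"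
      by (rule additive_isomorphic[OF multiplicity_in_additive]) (simp add: isomorphic_Assoc)
    finally show ?thesis by (simp add: \<phi>_def)
  qed
  finally show ?thesis .
qed

text \<open>
  Each factor \<open>S\<close> of \<open>A\<close> contributes a subquotient \<open>S \<otimes> Y\<close> of \<open>A \<otimes> Y\<close>.
\<close>

lemma multiplicity_tensor_ge:
  assumes "A \<in> Obj C" "Y \<in> Obj C"
  shows "multiplicity_in C A S * multiplicity_in C (S \<otimes> Y) S \<le> multiplicity_in C (A \<otimes> Y) S"
proof -
  let ?\<phi> = "\<lambda>B. multiplicity_in C (B \<otimes> Y) S"
  have add: "additive ?\<phi>" by (rule additive_tensor_right[OF multiplicity_in_additive assms(2)])
  have "multiplicity_in C A S * ?\<phi> S
    = sum_list (map (\<lambda>T. (if isomorphic C S T then 1 else 0) * ?\<phi> S) (comp_factors C A))"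
    by (simp only: multiplicity_in_eq_sum_list[of A] sum_list_mult_const)
  also have "\<dots> \<le> sum_list (map ?\<phi> (comp_factors C A))"
    by (rule sum_list_mono) (simp add: additive_isomorphic[OF add])
  also have "\<dots> = ?\<phi> A" using additive_comp_factors[OF add assms(1)] by simp
  finally show ?thesis .
qed

lemma multiplicity_tensor_power_ge:
  assumes "simple_obj C S" "Y \<in> Obj C"
  shows "multiplicity_in C (S \<otimes> Y) S ^ n \<le> multiplicity_in C (S \<otimes> tensor_power C Y n) S"
proof (induction n)
  have [simp]: "S \<in> Obj C" using assms by (simp add: simple_obj_def)
  case 0
  have "multiplicity_in C (S \<otimes> Unit C) S = multiplicity_in C S S"
    by (rule additive_isomorphic[OF multiplicity_in_additive]) (simp add: isomorphic_RUnit)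
  then show ?case using multiplicity_in_simple[OF assms(1)] by simp
next
  have [simp]: "S \<in> Obj C" using assms by (simp add: simple_obj_def)
  case (Suc n)
  let ?m = "multiplicity_in C (S \<otimes> Y) S" and ?P = "tensor_power C Y n"
  have "?m ^ Suc n \<le> multiplicity_in C (S \<otimes> ?P) S * ?m" using Suc.IH by simp
  also have "\<dots> \<le> multiplicity_in C ((S \<otimes> ?P) \<otimes> Y) S"
    by (rule multiplicity_tensor_ge) (use assms in auto)
  also have "\<dots> = multiplicity_in C (S \<otimes> (?P \<otimes> Y)) S"
    by (rule additive_isomorphic[OF multiplicity_in_additive]) (simp add: isomorphic_Assoc assms)
  finally show ?case by simp
qed

text \<open>
  By additivity in \<open>Z\<close>, it is enough to bound the multiplicity for simple \<open>Z\<close>. If \<open>S\<close> is a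
  factor of \<open>S \<otimes> Z\<close>, there is a nonzero map from \<open>S \<otimes> Z\<close> to the injective object \<open>S \<otimes> E\<close>, hence an
  embedding of \<open>Z\<close> into \<open>D \<otimes> (S \<otimes> E)\<close> for a right dual \<open>D\<close> of \<open>S\<close>. This leaves finitely many
  isomorphism classes for \<open>Z\<close>.
\<close>

lemma multiplicity_tensor_le_length:
  assumes e: "mono_arr C e" "Dom C e = Unit C" "Cod C e = E" "injective_obj C E"
    and S: "simple_obj C S"
  shows "\<exists>c. \<forall>Z\<in>Obj C. multiplicity_in C (S \<otimes> Z) S \<le> c * obj_length C Z"
proof -
  have [simp]: "S \<in> Obj C" "E \<in> Obj C" using S e(4) by (auto simp: simple_obj_def injective_obj_def)
  obtain D where D: "left_dual C D S" using ex_right_dual[of S] by auto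
  then have [simp]: "D \<in> Obj C" by (simp add: left_dual_def)
  let ?\<phi> = "\<lambda>T. multiplicity_in C (S \<otimes> T) S" and ?J = "D \<otimes> (S \<otimes> E)"
  have add: "additive ?\<phi>" by (rule additive_tensor_left[OF multiplicity_in_additive]) simp
  define c where "c = sum_list (map ?\<phi> (comp_factors C ?J))"
  obtain m where m: "mono_arr C m" "Dom C m = S" "Cod C m = S \<otimes> E"
    using embedding_into_tensor[OF e(1,2), of S] e(3) by auto
  note mA = mono_ArrD[OF m(1)]
  have le: "?\<phi> T \<le> c" if T: "simple_obj C T" for T
  proof (cases "?\<phi> T = 0")
    case False
    have [simp]: "T \<in> Obj C" using T by (simp add: simple_obj_def)
    have cs: "composition_series C (S \<otimes> T) (comp_factors C (S \<otimes> T))" by (rule comp_factors) simp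
    obtain F where F: "F \<in> set (comp_factors C (S \<otimes> T))" "isomorphic C S F"
      using False multiplicity_in_pos[of "S \<otimes> T" S] by auto
    then obtain f where f: "f \<in> Arr C" "Dom C f = F" "Cod C f = S" "iso_arr C f"
      using isomorphic_sym[OF F(2)] by (auto simp: isomorphic_def Hom_iff)
    have mf: "mono_arr C (m \<cdot> f)" using mono_Comp[OF m(1) iso_imp_mono[OF f(4)]] f m by simp
    have "simple_obj C F" using composition_series_simple[OF cs F(1)] .
    then have "\<not> null_arr C (m \<cdot> f)"
      using zero_Dom_of_null_mono[OF mf] f m mA by (auto simp: simple_obj_def)
    then obtain g where g: "g \<in> Arr C" "Dom C g = S \<otimes> T" "Cod C g = S \<otimes> E" "\<not> null_arr C g"
      using nonzero_to_injective[OF cs F(1) tensor_left_injective[OF _ e(4), of S], of "m \<cdot> f"] f m mA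
      by auto
    obtain h where h: "h \<in> Arr C" "Dom C h = T" "Cod C h = ?J" "\<not> null_arr C h"
      using nonzero_adjoint_left[OF D g(1,2) _ g(4)] g(3) by auto
    have "mono_arr C h" by (rule simple_mono) (use h T in auto)
    from multiplicity_in_simple_subobject[OF this] have "0 < multiplicity_in C ?J T"
      using h T by simp
    then obtain F' where F': "F' \<in> set (comp_factors C ?J)" "isomorphic C T F'"
      using multiplicity_in_pos by blast
    have "?\<phi> T = ?\<phi> F'" by (rule additive_isomorphic[OF add F'(2)])
    also have "\<dots> \<le> c" unfolding c_def by (rule member_le_sum_list) (use F' in auto)
    finally show ?thesis .
  qed simp
  have "?\<phi> Z \<le> c * obj_length C Z" if Z: "Z \<in> Obj C" for Z
  proof -
    have "?\<phi> Z = sum_list (map ?\<phi> (comp_factors C Z))" by (rule additive_comp_factors[OF add Z])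
    also have "\<dots> \<le> sum_list (map (\<lambda>_. c) (comp_factors C Z))"
      using composition_series_simple[OF comp_factors[OF Z]] by (intro sum_list_mono le) blast
    also have "\<dots> = c * obj_length C Z" by (simp add: obj_length_def sum_list_triv)
    finally show ?thesis .
  qed
  then show ?thesis by blast
qed

end

section \<open>Growth and the bound on the Loewy length\<close>

lemma growth_rate_le:
  fixes m K c :: real and a :: "nat \<Rightarrow> real"
  assumes "\<And>n. m ^ n \<le> c * a n" "\<forall>\<^sub>F n in sequentially. a n \<le> K ^ n" "1 \<le> K" "0 \<le> c"
  shows "m \<le> K"
proof (rule ccontr)
  assume "\<not> m \<le> K"
  then have x: "1 < m / K" using assms(3) by simp
  obtain N where N: "\<And>n. n \<ge> N \<Longrightarrow> a n \<le> K ^ n"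
    using assms(2) unfolding eventually_sequentially by blast
  obtain k where k: "c < (m / K) ^ k" using real_arch_pow[OF x] by blast
  let ?n = "max N k"
  have "m ^ ?n \<le> c * K ^ ?n"
    using assms(1)[of ?n] N[of ?n] mult_left_mono[OF _ assms(4), of "a ?n" "K ^ ?n"] by simp
  then have "(m / K) ^ ?n \<le> c" using assms(3) by (simp add: power_divide divide_le_eq)
  moreover have "(m / K) ^ k \<le> (m / K) ^ ?n" using x by (intro power_increasing) auto
  ultimately show False using k by simp
qed

lemma sum_list_by_index:
  fixes r :: "'i \<Rightarrow> real"
  assumes "finite J" "\<And>T. T \<in> set Fs \<Longrightarrow> idx T \<in> J"
  shows "sum_list (map (\<lambda>T. r (idx T)) Fs) = (\<Sum>i\<in>J. real (length (filter (\<lambda>T. idx T = i) Fs)) * r i)"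
  using assms(2)
proof (induction Fs)
  case (Cons T Fs)
  have "(\<Sum>i\<in>J. real (length (filter (\<lambda>T. idx T = i) (T # Fs))) * r i)
    = (\<Sum>i\<in>J. (if idx T = i then r i else 0) + real (length (filter (\<lambda>T. idx T = i) Fs)) * r i)"
    by (intro sum.cong) (auto simp: algebra_simps)
  also have "\<dots> = r (idx T) + (\<Sum>i\<in>J. real (length (filter (\<lambda>T. idx T = i) Fs)) * r i)"
    using assms(1) Cons.prems by (simp add: sum.distrib)
  finally show ?case using Cons by simp
qed simp

context tensor_category
begin

text \<open>
  The powers of \<open>[S \<otimes> Y : S]\<close> are bounded by \<open>[S \<otimes> Y\<^sup>n : S]\<close>, which exceeds the length of
  \<open>Y\<^sup>n\<close> by at most a factor not depending on \<open>n\<close>.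
\<close>

lemma multiplicity_le_spectral_radius:
  assumes e: "mono_arr C e" "Dom C e = Unit C" "Cod C e = E" "injective_obj C E"
    and S: "simple_obj C S" and Y: "Y \<in> Obj C" and growth: "subexponential_growth C"
  shows "real (multiplicity_in C (S \<otimes> Y) S) \<le> spectral_radius C Y"
  unfolding spectral_radius_def
proof (rule cInf_greatest)
  show "growth_bounds C Y \<noteq> {}" using growth Y by (simp add: subexponential_growth_def)
  fix K assume K: "K \<in> growth_bounds C Y"
  obtain c where c: "\<And>Z. Z \<in> Obj C \<Longrightarrow> multiplicity_in C (S \<otimes> Z) S \<le> c * obj_length C Z"
    using multiplicity_tensor_le_length[OF e S] by blast
  have "multiplicity_in C (S \<otimes> Y) S ^ n \<le> c * obj_length C (tensor_power C Y n)" for n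
    using multiplicity_tensor_power_ge[OF S Y, of n] c[of "tensor_power C Y n"] Y by simp
  then have "real (multiplicity_in C (S \<otimes> Y) S) ^ n
      \<le> real c * real (obj_length C (tensor_power C Y n))" for n
    by (metis of_nat_le_iff of_nat_mult of_nat_power)
  then show "real (multiplicity_in C (S \<otimes> Y) S) \<le> K"
    by (rule growth_rate_le) (use K in \<open>auto simp: growth_bounds_def\<close>)
qed

text \<open>
  The length of \<open>T \<otimes> F\<close>, added over the composition factors \<open>F\<close> of \<open>E\<close>, is the length of
  \<open>T \<otimes> E\<close>, and each summand is bounded independently of \<open>T\<close>.
\<close>

lemma length_tensor_injective_le:
  assumes e: "mono_arr C e" "Dom C e = Unit C" "Cod C e = E" "injective_obj C E"
    and T: "simple_obj C T" and growth: "subexponential_growth C"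
    and reps: "simple_representatives C I S"
    and dual: "\<And>i. i \<in> I \<Longrightarrow> left_dual C (S i) (S_dual i)"
  shows "real (obj_length C (T \<otimes> E))
    \<le> (\<Sum>\<^sub>\<infinity>i\<in>I. real (multiplicity_in C E (S i)) * spectral_radius C (S i \<otimes> E \<otimes> S_dual i))"
proof -
  have [simp]: "T \<in> Obj C" "E \<in> Obj C" using T e(4) by (auto simp: simple_obj_def injective_obj_def)
  let ?Fs = "comp_factors C E"
  let ?r = "\<lambda>i. spectral_radius C (S i \<otimes> E \<otimes> S_dual i)"
  have cs: "composition_series C E ?Fs" by (rule comp_factors) simp
  have "\<exists>i. i \<in> I \<and> isomorphic C F (S i)" if "F \<in> set ?Fs" for F
    using reps composition_series_simple[OF cs that] unfolding simple_representatives_def by blast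
  then obtain idx where idx: "\<And>F. F \<in> set ?Fs \<Longrightarrow> idx F \<in> I \<and> isomorphic C F (S (idx F))" by metis
  have idx_iff: "idx F = i \<longleftrightarrow> isomorphic C (S i) F" if "F \<in> set ?Fs" "i \<in> I" for F i
  proof
    assume "isomorphic C (S i) F"
    then have "isomorphic C (S i) (S (idx F))" using idx[OF that(1)] isomorphic_trans by blast
    then show "idx F = i"
      using reps idx[OF that(1)] that(2) unfolding simple_representatives_def by metis
  qed (use idx[OF that(1)] isomorphic_sym in blast)
  \<comment> \<open>The sum over \<open>I\<close> has only finitely many nonzero terms, those with index in \<open>J\<close>.\<close>
  define J where "J = idx ` set ?Fs"
  have J: "finite J" "J \<subseteq> I" using idx by (auto simp: J_def)
  have mult: "multiplicity_in C E (S i) = length (filter (\<lambda>F. idx F = i) ?Fs)" if "i \<in> I" for i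
    unfolding multiplicity_in_def
    by (rule arg_cong[of _ _ length], rule filter_cong) (use idx_iff that in auto)
  have bound: "real (obj_length C (T \<otimes> F)) \<le> ?r (idx F)" if F: "F \<in> set ?Fs" for F
  proof -
    let ?i = "idx F"
    have i: "?i \<in> I" "isomorphic C F (S ?i)" using idx[OF F] by auto
    have [simp]: "S ?i \<in> Obj C" "S_dual ?i \<in> Obj C" using dual[OF i(1)] by (auto simp: left_dual_def)
    have "obj_length C (T \<otimes> F) = obj_length C (T \<otimes> S ?i)"
      by (rule additive_isomorphic[OF additive_tensor_left[OF obj_length_additive] i(2)]) simp
    also have "\<dots> \<le> multiplicity_in C (T \<otimes> (S ?i \<otimes> E \<otimes> S_dual ?i)) T"
      by (rule length_tensor_le_multiplicity[OF e T dual[OF i(1)]])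
    finally have "real (obj_length C (T \<otimes> F)) \<le> real (multiplicity_in C (T \<otimes> (S ?i \<otimes> E \<otimes> S_dual ?i)) T)"
      by simp
    also have "\<dots> \<le> ?r ?i" by (rule multiplicity_le_spectral_radius[OF e T _ growth]) simp
    finally show ?thesis .
  qed
  have "obj_length C (T \<otimes> E) = sum_list (map (\<lambda>F. obj_length C (T \<otimes> F)) ?Fs)"
    by (rule additive_comp_factors[OF additive_tensor_left[OF obj_length_additive]]) simp_all
  then have "real (obj_length C (T \<otimes> E)) = sum_list (map (\<lambda>F. real (obj_length C (T \<otimes> F))) ?Fs)"
    by (simp add: sum_list_of_nat[symmetric] o_def)
  also have "\<dots> \<le> sum_list (map (\<lambda>F. ?r (idx F)) ?Fs)" by (intro sum_list_mono bound)
  also have "\<dots> = (\<Sum>i\<in>J. real (length (filter (\<lambda>F. idx F = i) ?Fs)) * ?r i)"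
    by (rule sum_list_by_index[OF J(1)]) (simp add: J_def)
  also have "\<dots> = (\<Sum>i\<in>J. real (multiplicity_in C E (S i)) * ?r i)"
    by (intro sum.cong) (use mult J in auto)
  also have "\<dots> = (\<Sum>\<^sub>\<infinity>i\<in>J. real (multiplicity_in C E (S i)) * ?r i)" using J by simp
  also have "\<dots> = (\<Sum>\<^sub>\<infinity>i\<in>I. real (multiplicity_in C E (S i)) * ?r i)"
  proof (rule infsum_cong_neutral)
    fix i assume "i \<in> I - J"
    then have "multiplicity_in C E (S i) = 0" using mult by (auto simp: J_def filter_empty_conv)
    then show "real (multiplicity_in C E (S i)) * ?r i = 0" by simp
  qed (use J in auto)
  finally show ?thesis .
qed

end

theorem theorem2p5:
  fixes C :: "('o, 'm, 'k::alg_closed_field) moncat"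
    and I :: "'i set" and S S_dual :: "'i \<Rightarrow> 'o" and E :: 'o
  assumes "tensor_category C"
    and "frobenius_category C"
    and "subexponential_growth C"
    and "simple_representatives C I S"
    and "\<And>i. i \<in> I \<Longrightarrow> left_dual C (S i) (S_dual i)"
    and "injective_hull C (Unit C) E"
  shows "coradically_finite C \<and>
    real (category_loewy_length C)
      \<le> (\<Sum>\<^sub>\<infinity>i\<in>I. real (multiplicity_in C E (S i)) *
            spectral_radius C (S i \<otimes>\<^bsub>C\<^esub> E \<otimes>\<^bsub>C\<^esub> S_dual i))"
proof -
  interpret tensor_category C by (rule assms(1))
  let ?B = "\<Sum>\<^sub>\<infinity>i\<in>I. real (multiplicity_in C E (S i)) * spectral_radius C (S i \<otimes>\<^bsub>C\<^esub> E \<otimes>\<^bsub>C\<^esub> S_dual i)"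
  obtain e where e: "mono_arr C e" "Dom C e = Unit C" "Cod C e = E" and E: "injective_obj C E"
    using assms(6) by (auto simp: injective_hull_def essential_mono_def Hom_iff)
  define N where "N = nat \<lfloor>?B\<rfloor>"
  have N: "obj_length C (T \<otimes>\<^bsub>C\<^esub> E) \<le> N" if "simple_obj C T" for T
    using length_tensor_injective_le[OF e E that assms(3-5)] unfolding N_def
    by (simp add: le_nat_floor)
  have bound: "loewy_length C X \<le> N" if X: "X \<in> Obj C" for X
  proof (rule loewy_length_le_of_injectives[OF _ X])
    fix T assume T: "simple_obj C T"
    then have "T \<in> Obj C" by (simp add: simple_obj_def)
    then obtain m where "mono_arr C m" "Dom C m = T" "Cod C m = T \<otimes>\<^bsub>C\<^esub> E"
      using embedding_into_tensor[OF e(1,2), of T] e(3) by auto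
    then show "\<exists>m. mono_arr C m \<and> Dom C m = T \<and> injective_obj C (Cod C m) \<and> obj_length C (Cod C m) \<le> N"
      using tensor_left_injective[OF \<open>T \<in> Obj C\<close> E] N[OF T] by auto
  qed
  have "coradical_filtration C N = Obj C" using bound by (force simp: coradical_filtration_def)
  moreover have "category_loewy_length C \<le> N"
    unfolding category_loewy_length_def
  proof (rule Max.boundedI)
    show "finite (loewy_length C ` Obj C)"
      by (rule finite_subset[of _ "{..N}"]) (use bound in auto)
    show "loewy_length C ` Obj C \<noteq> {}" using Unit_Obj by blast
  qed (use bound in auto)
  \<comment> \<open>Without this, \<open>N\<close> might exceed the bound, as \<open>nat\<close> replaces negative numbers by 0.\<close>
  moreover have "0 \<le> ?B"
  proof (rule infsum_nonneg)
    fix i assume i: "i \<in> I"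
    then have "S i \<otimes>\<^bsub>C\<^esub> E \<otimes>\<^bsub>C\<^esub> S_dual i \<in> Obj C" "simple_obj C (S i)"
      using assms(4) assms(5)[OF i] E
      by (auto simp: left_dual_def injective_obj_def simple_representatives_def)
    then have "0 \<le> spectral_radius C (S i \<otimes>\<^bsub>C\<^esub> E \<otimes>\<^bsub>C\<^esub> S_dual i)"
      using multiplicity_le_spectral_radius[OF e E _ _ assms(3)] of_nat_0_le_iff order_trans by blast
    then show "0 \<le> real (multiplicity_in C E (S i)) * spectral_radius C (S i \<otimes>\<^bsub>C\<^esub> E \<otimes>\<^bsub>C\<^esub> S_dual i)"
      by simp
  qed
  then have "real N \<le> ?B" unfolding N_def by simp
  ultimately show ?thesis unfolding coradically_finite_def by force
qed

end
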